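(* Let $I_{\mathfrak Z}\subset R$ be the saturated ideal defining the zero-dimensional scheme $\mathfrak Z$ concentrated at the point $p=(a_1:\dots:a_n:1)\in\mathbb A^n\subset\mathbb P^n$, and let $L_{\mathfrak Z}=(I_{\mathfrak Z})^{-1}\subset\Gamma$ be its global inverse system. Let $J'\subset R'$ be the ideal defining $\mathfrak Z\subset\mathbb A^n$ and $L'=(J')^{-1}\subset\widehat{\Gamma'}$ its affine inverse system. Put $q=(a_1,\dots,a_n)$, let $J=T_q^{-1}(J')$, and let $L''=J^{-1}\subset\Gamma'$ be its inverse system. Let $\alpha=\alpha(\mathfrak Z)$, suppose that $V''\subset\Gamma'_{\le\alpha}$ generates $L''$ (so $L''=R'\circ V''$), and set $V=\operatorname{Homog}(V'',L_p,\alpha)$. (i) Then the global inverse system $L_{\mathfrak Z}$ satisfies $$(L_{\mathfrak Z})_i=\operatorname{Homog}(L''_{\le\alpha},L_p,i)=R_\alpha\circ\bigl(V\cdot_{rp}L_p^{[i]}\bigr).$$ (ii) Furthermore, let $g$ denote the linear transformation of $R$ taking $p$ to the origin $p_0=(0:\dots:0:1)$, and $g^*$ the contragradient transform on $\Gamma$ (for which $g^*(X_i)=X_i$ for $1\le i\le n$ and $g^*(Z)=L_p$), and set $\mathfrak Z_o=\operatorname{Proj}(R/g(I_{\mathfrak Z}))$, $L_o=(I_{\mathfrak Z_o})^{-1}$. Then, with $L=L_{\mathfrak Z}$, we have $L=g^*\circ L_o$. The $R$-module $L_{\mathfrak Z}$ is isomorphic to $L_o$. Also, if $\mathfrak Z$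 is any zero-dimensional scheme concentrated at $p$, then $L_{\mathfrak Z}=(I_{\mathfrak Z})^{-1}$ satisfies $(L_{\mathfrak Z})_i=\operatorname{Homog}(L''_{\le\alpha},L_p,i)$ for a suitable $L''\subset\Gamma'_{\le\alpha}$, where $\alpha=\alpha(\mathfrak Z)$; conversely, if an inverse system $L$ satisfies $L_i=\operatorname{Homog}(L''_{\le\alpha},L_p,i)$, then $L=L_{\mathfrak Z}$ for a zero-dimensional scheme $\mathfrak Z$ concentrated at $p$.
   Context: $k$ is a field which is algebraically closed (or else all zero-dimensional schemes considered have $k$-rational support), and $\operatorname{char}k=0$ or $\operatorname{char}k$ is larger than the degree of every form considered. $R=k[x_1,\dots,x_n,z]$ ($z=x_{n+1}$) is the coordinate ring of $\mathbb P^n$; $\Gamma=k_{DP}[X_1,\dots,X_n,Z]$ ($Z=X_{n+1}$) is the divided power ring with basis $X^{[U]}$ and product $X^{[U]}X^{[V]}=\binom{U+V}{U}X^{[U+V]}$. $R$ acts on $\Gamma$ by contraction, $x^K\circ X^{[U]}=X^{[U-K]}$ ($0$ if an exponent is negative). An inverse system in $\Gamma$ is a graded $R$-submodule of $\Gamma$; for a graded ideal $I$, $I^{-1}$ is the graded submodule of all elements of $\Gamma$ annihilated by $I$. $R'=k[y_1,\dots,y_n]$ is the coordinate ring of $\mathbb A^n=\{x_{n+1}\neq0\}$ (set $z=1$, $x_i=y_i$), $\Gamma'=k_{DP}[Y_1,\dots,Y_n]$, and $\widehat{\Gamma'}$ is its completion, a divided power series ring; $R'$ acts on both by contraction. For an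 ideal $J'\subset R'$, $(J')^{-1}\subset\widehat{\Gamma'}$ is the $R'$-submodule of elements annihilated by $J'$; if the ideal is concentrated at the origin this lies in $\Gamma'$. $T_q(J)=(h(y_1-a_1,\dots,y_n-a_n): h\in J)$ is the translated ideal. $\alpha(\mathfrak Z)$ is the socle degree of the Artinian local ring of $\mathfrak Z$ at $p$ (the largest $i$ with $\mathfrak m^i\ne0$). $L_p=a_1X_1+\dots+a_nX_n+Z$, and $L_p^{[m]}=\sum_{|U|=m}a^UX^{[U]}$ (with $a_{n+1}=1$) is its $m$-th divided power. For $f=\sum_i f_i\in\Gamma'$ with $f_i\in\Gamma'_i$ and $u\ge0$, $$\operatorname{Homog}(f,L_p,u)=\sum_{0\le i\le u}f_i(X_1,\dots,X_n)\cdot L_p^{[u-i]}\in\Gamma_u,$$ and for a subset $S\subset\Gamma'$, $\operatorname{Homog}(S,L_p,u)$ is the span of the $\operatorname{Homog}(f,L_p,u)$, $f\in S$. For $w=\sum_i w_i\cdot L_p^{[m-i]}\in \Gamma_m$ with $w_i\in k_{DP}[X_1,\dots,X_n]_i$, the raised-power product is $w\cdot_{rp}L_p^{[u]}=\sum_i w_i\cdot L_p^{[m+u-i]}$; for a subspace $V$, $V\cdot_{rp}L_p^{[u]}=\{w\cdot_{rp}L_p^{[u]}: w\in V\}$. $L''_{\le\alpha}$ denotes the elements of $L''$ of degree $\le\alpha$. The linear transformation $g$ is the change of coordinates given by translation in $\mathbb A^n$, so $\mathfrak Z_o$ is concentrated at $p_0$.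
   Formalization: "The R-module L_Z is isomorphic to L_o" is read as an isomorphism g* linear over the automorphism g of R (untwisted it fails for p ≠ p_0, as annihilators differ), and the converse assumes L ≠ 0 (L = 0 would give the empty scheme). *)

theory Defs
  imports Complex_Main "HOL-Library.Poly_Mapping" "HOL-Library.Function_Algebras"
begin

section \<open>Polynomial rings\<close>

text \<open>
  Variables are indexed by a finite type. If \<open>'n\<close> indexes the variables \<open>y_1, ..., y_n\<close> of
  \<open>R' = k[y_1, ..., y_n]\<close>, then \<open>'n option\<close> indexes the variables of
  \<open>R = k[x_1, ..., x_n, z]\<close>: \<open>Some i\<close> stands for \<open>x_i\<close> and \<open>None\<close> for \<open>z = x_{n+1}\<close>.
  Exponent vectors are functions into \<open>nat\<close> with pointwise addition.
\<close>

type_synonym ('v, 'k) mpoly = "('v \<Rightarrow> nat) \<Rightarrow>\<^sub>0 'k"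

definition mdeg :: "('v::finite \<Rightarrow> nat) \<Rightarrow> nat" where
  "mdeg U = (\<Sum>v\<in>UNIV. U v)"

definition unit_exp :: "'v \<Rightarrow> 'v \<Rightarrow> nat" where
  "unit_exp v = (\<lambda>w. if w = v then 1 else 0)"

definition monom :: "('v \<Rightarrow> nat) \<Rightarrow> ('v, 'k::comm_ring_1) mpoly" where
  "monom U = Poly_Mapping.single U 1"

definition Var :: "'v \<Rightarrow> ('v, 'k::comm_ring_1) mpoly" where
  "Var v = monom (unit_exp v)"

definition Const :: "'k \<Rightarrow> ('v, 'k::comm_ring_1) mpoly" where
  "Const c = Poly_Mapping.single 0 c"

definition poly_subst :: "('v \<Rightarrow> ('w, 'k) mpoly) \<Rightarrow> ('v::finite, 'k::comm_ring_1) mpoly \<Rightarrow> ('w, 'k) mpoly" where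
  "poly_subst \<sigma> f = (\<Sum>U\<in>Poly_Mapping.keys f. Const (Poly_Mapping.lookup f U) * (\<Prod>v\<in>UNIV. \<sigma> v ^ U v))"

definition homogeneous :: "nat \<Rightarrow> ('v::finite, 'k::comm_ring_1) mpoly \<Rightarrow> bool" where
  "homogeneous d f \<longleftrightarrow> (\<forall>U\<in>Poly_Mapping.keys f. mdeg U = d)"

definition poly_part :: "nat \<Rightarrow> ('v::finite, 'k::comm_ring_1) mpoly \<Rightarrow> ('v, 'k) mpoly" where
  "poly_part d f = (\<Sum>U\<in>{U \<in> Poly_Mapping.keys f. mdeg U = d}. Poly_Mapping.single U (Poly_Mapping.lookup f U))"

section \<open>Ideals\<close>

text \<open>
  An ideal is a submodule of the ring. (The locale \<^locale>\<open>module\<close> is not interpreted for the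
  multiplication of a ring, since its simplification rules reverse \<open>mult.assoc\<close>.)
\<close>

abbreviation is_ideal :: "'a::comm_ring_1 set \<Rightarrow> bool" where
  "is_ideal \<equiv> module.subspace (*)"

abbreviation ideal_gen :: "'a::comm_ring_1 set \<Rightarrow> 'a set" where
  "ideal_gen \<equiv> module.span (*)"

lemma module_ring: "module ((*) :: 'a::comm_ring_1 \<Rightarrow> 'a \<Rightarrow> 'a)"
  by unfold_locales (simp_all add: algebra_simps)

fun ideal_pow :: "'a::comm_ring_1 set \<Rightarrow> nat \<Rightarrow> 'a set" where
  "ideal_pow I 0 = UNIV"
| "ideal_pow I (Suc m) = ideal_gen {f * g | f g. f \<in> I \<and> g \<in> ideal_pow I m}"

definition prime_ideal :: "'a::comm_ring_1 set \<Rightarrow> bool" where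
  "prime_ideal P \<longleftrightarrow> is_ideal P \<and> P \<noteq> UNIV \<and> (\<forall>f g. f * g \<in> P \<longrightarrow> f \<in> P \<or> g \<in> P)"

definition graded_ideal :: "('v::finite, 'k::comm_ring_1) mpoly set \<Rightarrow> bool" where
  "graded_ideal I \<longleftrightarrow> is_ideal I \<and> (\<forall>f\<in>I. \<forall>d. poly_part d f \<in> I)"

definition irrelevant_ideal :: "('v, 'k::comm_ring_1) mpoly set" where
  "irrelevant_ideal = ideal_gen (range Var)"

definition saturation :: "('v, 'k::comm_ring_1) mpoly set \<Rightarrow> ('v, 'k) mpoly set" where
  "saturation I = {f. \<exists>m. \<forall>h\<in>ideal_pow irrelevant_ideal m. h * f \<in> I}"

section \<open>Zero-dimensional schemes concentrated at a point\<close>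

text \<open>The point set of the scheme \<open>Proj (R/I)\<close>.\<close>

definition Proj_points :: "('v::finite, 'k::comm_ring_1) mpoly set \<Rightarrow> ('v, 'k) mpoly set set" where
  "Proj_points I = {P. prime_ideal P \<and> graded_ideal P \<and> I \<subseteq> P \<and> \<not> irrelevant_ideal \<subseteq> P}"

text \<open>Krull dimension zero: nonempty, and no strict specializations between points.\<close>

definition zero_dimensional :: "('v::finite, 'k::comm_ring_1) mpoly set \<Rightarrow> bool" where
  "zero_dimensional I \<longleftrightarrow>
     Proj_points I \<noteq> {} \<and> (\<forall>P\<in>Proj_points I. \<forall>Q\<in>Proj_points I. P \<subseteq> Q \<longrightarrow> P = Q)"

text \<open>
  A point \<open>q = (a_1, ..., a_n)\<close> of affine space is a function \<open>a\<close>. The homogeneous prime ideal of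
  \<open>p = (a_1 : ... : a_n : 1)\<close> is generated by the forms \<open>x_i - a_i z\<close>, the maximal ideal
  of \<open>q\<close> in \<open>R'\<close> by the \<open>y_i - a_i\<close>.
\<close>

definition proj_point_ideal :: "('n \<Rightarrow> 'k) \<Rightarrow> ('n option, 'k::comm_ring_1) mpoly set" where
  "proj_point_ideal a = ideal_gen (range (\<lambda>i. Var (Some i) - Const (a i) * Var None))"

definition affine_point_ideal :: "('n \<Rightarrow> 'k) \<Rightarrow> ('n, 'k::comm_ring_1) mpoly set" where
  "affine_point_ideal a = ideal_gen (range (\<lambda>i. Var i - Const (a i)))"

text \<open>\<open>I\<close> is the saturated ideal of a zero-dimensional scheme with support \<open>{p}\<close>.\<close>

definition punctual_scheme_ideal ::
    "('n::finite \<Rightarrow> 'k) \<Rightarrow> ('n option, 'k::comm_ring_1) mpoly set \<Rightarrow> bool" where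
  "punctual_scheme_ideal a I \<longleftrightarrow>
     graded_ideal I \<and> saturation I = I \<and> zero_dimensional I \<and> Proj_points I = {proj_point_ideal a}"

definition dehomogenize :: "('n::finite option, 'k::comm_ring_1) mpoly \<Rightarrow> ('n, 'k) mpoly" where
  "dehomogenize = poly_subst (\<lambda>v. case v of Some i \<Rightarrow> Var i | None \<Rightarrow> 1)"

text \<open>\<open>translate a h = h (y_1 - a_1, ..., y_n - a_n)\<close>, so \<open>T_q J\<close> is \<open>translate a ` J\<close>.\<close>

definition translate :: "('n::finite \<Rightarrow> 'k) \<Rightarrow> ('n, 'k::comm_ring_1) mpoly \<Rightarrow> ('n, 'k) mpoly" where
  "translate a = poly_subst (\<lambda>i. Var i - Const (a i))"

text \<open>
  The local ring at \<open>q\<close> of the affine scheme defined by \<open>J'\<close> is the localization of \<open>R'/J'\<close>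
  at \<open>q\<close>, and \<open>local_kernel a J'\<close> is the kernel of the map from \<open>R'\<close> to it. The \<open>i\<close>-th power
  of the maximal ideal of the local ring is generated by the image of
  \<open>ideal_pow (affine_point_ideal a) i\<close>, so it is nonzero iff the latter is not
  contained in the kernel.
\<close>

definition local_kernel :: "('n \<Rightarrow> 'k) \<Rightarrow> ('n, 'k::comm_ring_1) mpoly set \<Rightarrow> ('n, 'k) mpoly set" where
  "local_kernel a J' = {f. \<exists>s. s \<notin> affine_point_ideal a \<and> s * f \<in> J'}"

definition socle_degree :: "('n \<Rightarrow> 'k) \<Rightarrow> ('n, 'k::comm_ring_1) mpoly set \<Rightarrow> nat" where
  "socle_degree a J' = (GREATEST i. \<not> ideal_pow (affine_point_ideal a) i \<subseteq> local_kernel a J')"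

section \<open>Divided power rings and contraction\<close>

text \<open>
  A divided power series is represented by its coefficient function:
  \<open>F\<close> stands for the formal sum of the \<open>F U \<cdot> X^{[U]}\<close>. The divided power ring itself is the
  subset \<open>dp_ring\<close> of finitely supported functions. Addition and zero are pointwise. The pointwise
  product of functions is never used; the product of the divided power ring is \<open>dp_mult\<close>.
\<close>

type_synonym ('v, 'k) dps = "('v \<Rightarrow> nat) \<Rightarrow> 'k"

definition dp_ring :: "('v, 'k::comm_ring_1) dps set" where
  "dp_ring = {F. finite {U. F U \<noteq> 0}}"

definition dp_hom :: "nat \<Rightarrow> ('v::finite, 'k::comm_ring_1) dps set" where
  "dp_hom d = {F \<in> dp_ring. \<forall>U. F U \<noteq> 0 \<longrightarrow> mdeg U = d}"

definition dp_le :: "nat \<Rightarrow> ('v::finite, 'k::comm_ring_1) dps set" where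
  "dp_le d = {F \<in> dp_ring. \<forall>U. F U \<noteq> 0 \<longrightarrow> mdeg U \<le> d}"

definition dp_part :: "nat \<Rightarrow> ('v::finite, 'k::comm_ring_1) dps \<Rightarrow> ('v, 'k) dps" where
  "dp_part d F = (\<lambda>U. if mdeg U = d then F U else 0)"

definition dp_monom :: "('v \<Rightarrow> nat) \<Rightarrow> ('v, 'k::comm_ring_1) dps" where
  "dp_monom U = (\<lambda>W. if W = U then 1 else 0)"

definition dp_mult :: "('v::finite, 'k::comm_ring_1) dps \<Rightarrow> ('v, 'k) dps \<Rightarrow> ('v, 'k) dps" where
  "dp_mult F G = (\<lambda>W. \<Sum>U\<in>{U. U \<le> W}. of_nat (\<Prod>v\<in>UNIV. W v choose U v) * F U * G (W - U))"

definition dp_scale :: "'k \<Rightarrow> ('v, 'k::comm_ring_1) dps \<Rightarrow> ('v, 'k) dps" where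
  "dp_scale c F = (\<lambda>U. c * F U)"

interpretation kspace: module "dp_scale :: 'k::comm_ring_1 \<Rightarrow> ('v, 'k) dps \<Rightarrow> ('v, 'k) dps"
  by standard (auto simp: dp_scale_def fun_eq_iff algebra_simps)

text \<open>
  Contraction: \<open>x^K\<close> sends \<open>X^{[W]}\<close> to \<open>X^{[W - K]}\<close>, hence the coefficient of \<open>X^{[U]}\<close> in
  \<open>contract r F\<close> collects the products of the coefficient of \<open>x^K\<close> in \<open>r\<close> and that
  of \<open>X^{[U + K]}\<close> in \<open>F\<close>.
\<close>

definition contract :: "('v, 'k::comm_ring_1) mpoly \<Rightarrow> ('v, 'k) dps \<Rightarrow> ('v, 'k) dps" where
  "contract r F = (\<lambda>U. \<Sum>K\<in>Poly_Mapping.keys r. Poly_Mapping.lookup r K * F (U + K))"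

lemma contract_superset:
  assumes "finite A" "Poly_Mapping.keys r \<subseteq> A"
  shows "contract r F U = (\<Sum>K\<in>A. Poly_Mapping.lookup r K * F (U + K))"
  unfolding contract_def
  by (rule sum.mono_neutral_left) (use assms in \<open>auto simp: in_keys_iff\<close>)

lemma contract_add_left: "contract (r + s) F = contract r F + contract s F"
proof
  fix U
  let ?A = "Poly_Mapping.keys r \<union> Poly_Mapping.keys s"
  have "Poly_Mapping.keys (r + s) \<subseteq> ?A" by (rule Poly_Mapping.keys_add)
  then show "contract (r + s) F U = (contract r F + contract s F) U"
    by (simp add: contract_superset[of ?A] Poly_Mapping.lookup_add algebra_simps sum.distrib)
qed

lemma contract_add_right: "contract r (F + G) = contract r F + contract r G"
  by (auto simp: contract_def fun_eq_iff algebra_simps sum.distrib)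

lemma contract_zero_left: "contract 0 F = 0"
  by (auto simp: contract_def fun_eq_iff)

lemma contract_sum_left: "contract (sum f A) F = (\<Sum>x\<in>A. contract (f x) F)"
  by (induction A rule: infinite_finite_induct) (auto simp: contract_zero_left contract_add_left)

lemma contract_sum_right: "contract r (sum f A) = (\<Sum>x\<in>A. contract r (f x))"
proof (induction A rule: infinite_finite_induct)
  case (insert x A)
  then show ?case by (metis contract_add_right sum.insert)
qed (auto simp: contract_def fun_eq_iff)

lemma contract_single: "contract (Poly_Mapping.single K c) F = (\<lambda>U. c * F (U + K))"
  by (cases "c = 0") (auto simp: contract_def fun_eq_iff)

lemma mpoly_expand: "r = (\<Sum>K\<in>Poly_Mapping.keys r. Poly_Mapping.single K (Poly_Mapping.lookup r K))"
proof (rule poly_mapping_eqI)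
  fix U
  show "Poly_Mapping.lookup r U = Poly_Mapping.lookup (\<Sum>K\<in>Poly_Mapping.keys r. Poly_Mapping.single K (Poly_Mapping.lookup r K)) U"
    by (auto simp: lookup_sum lookup_single when_def in_keys_iff sum.delta' sum.delta)
qed

lemma contract_mult: "contract (r * s) F = contract r (contract s F)"
proof -
  have single: "contract (Poly_Mapping.single K c * Poly_Mapping.single M d) F =
      contract (Poly_Mapping.single K c) (contract (Poly_Mapping.single M d) F)" for K M c d
    by (simp add: mult_single contract_single mult.assoc add.assoc)
  let ?r = "\<lambda>K. Poly_Mapping.single K (Poly_Mapping.lookup r K)"
  let ?s = "\<lambda>K. Poly_Mapping.single K (Poly_Mapping.lookup s K)"
  have "contract (r * s) F = contract ((\<Sum>K\<in>Poly_Mapping.keys r. ?r K) * (\<Sum>M\<in>Poly_Mapping.keys s. ?s M)) F"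
    by (simp flip: mpoly_expand)
  also have "\<dots> = (\<Sum>K\<in>Poly_Mapping.keys r. \<Sum>M\<in>Poly_Mapping.keys s. contract (?r K) (contract (?s M) F))"
    by (simp add: sum_product contract_sum_left single)
  also have "\<dots> = contract (\<Sum>K\<in>Poly_Mapping.keys r. ?r K) (contract (\<Sum>M\<in>Poly_Mapping.keys s. ?s M) F)"
    by (simp add: contract_sum_left contract_sum_right sum.swap[of _ "Poly_Mapping.keys s"])
  finally show ?thesis by (simp flip: mpoly_expand)
qed

text \<open>
  Divided power series form a module under contraction: \<open>contraction.subspace L\<close> says that \<open>L\<close> is a
  submodule and \<open>contraction.span B\<close> is the submodule generated by \<open>B\<close>.
\<close>

interpretation contraction:
  module "contract :: ('v, 'k::comm_ring_1) mpoly \<Rightarrow> ('v, 'k) dps \<Rightarrow> ('v, 'k) dps"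
proof
  show "contract 1 F = F" for F :: "('v, 'k) dps"
    by (simp flip: single_one add: contract_single)
qed (simp_all add: contract_add_right contract_add_left contract_mult)

section \<open>Inverse systems\<close>

text \<open>
  Graded submodules of the divided power ring.
\<close>

definition inverse_system :: "('v::finite, 'k::comm_ring_1) dps set \<Rightarrow> bool" where
  "inverse_system L \<longleftrightarrow>
     L \<subseteq> dp_ring \<and> contraction.subspace L \<and> (\<forall>F\<in>L. \<forall>d. dp_part d F \<in> L)"

definition global_inverse :: "('v, 'k::comm_ring_1) mpoly set \<Rightarrow> ('v, 'k) dps set" where
  "global_inverse I = {F \<in> dp_ring. \<forall>r\<in>I. contract r F = 0}"

text \<open>
  In the affine case the annihilator is taken in the completed ring, i.e.\ among all divided power
  series.
\<close>

definition affine_inverse :: "('n, 'k::comm_ring_1) mpoly set \<Rightarrow> ('n, 'k) dps set" where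
  "affine_inverse J = {F. \<forall>h\<in>J. contract h F = 0}"

section \<open>Homogenization\<close>

text \<open>The inclusion of \<open>k_DP[X_1, ..., X_n]\<close> in \<open>k_DP[X_1, ..., X_n, Z]\<close>.\<close>

definition dp_embed :: "('n, 'k::comm_ring_1) dps \<Rightarrow> ('n option, 'k) dps" where
  "dp_embed f = (\<lambda>U. if U None = 0 then f (\<lambda>i. U (Some i)) else 0)"

text \<open>The divided power \<open>L_p^{[m]}\<close> of \<open>L_p = a_1 X_1 + ... + a_n X_n + Z\<close>.\<close>

definition Lp_pow :: "('n::finite \<Rightarrow> 'k) \<Rightarrow> nat \<Rightarrow> ('n option, 'k::comm_ring_1) dps" where
  "Lp_pow a m = (\<lambda>U. if mdeg U = m then (\<Prod>i\<in>UNIV. a i ^ U (Some i)) else 0)"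

definition Homog1 :: "('n::finite, 'k::comm_ring_1) dps \<Rightarrow> ('n \<Rightarrow> 'k) \<Rightarrow> nat \<Rightarrow> ('n option, 'k) dps" where
  "Homog1 f a u = (\<Sum>i\<le>u. dp_mult (dp_embed (dp_part i f)) (Lp_pow a (u - i)))"

definition Homog :: "('n::finite, 'k::comm_ring_1) dps set \<Rightarrow> ('n \<Rightarrow> 'k) \<Rightarrow> nat \<Rightarrow> ('n option, 'k) dps set" where
  "Homog S a u = kspace.span ((\<lambda>f. Homog1 f a u) ` S)"

text \<open>
  The raised-power product of a subset of degree \<open>m\<close> with \<open>L_p^{[u]}\<close>; \<open>w i\<close> is the
  coefficient, a form of degree \<open>i\<close> in \<open>X_1, ..., X_n\<close>, of \<open>L_p^{[m - i]}\<close>.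
\<close>

definition raised_power ::
    "('n::finite \<Rightarrow> 'k) \<Rightarrow> nat \<Rightarrow> ('n option, 'k::comm_ring_1) dps set \<Rightarrow> nat \<Rightarrow> ('n option, 'k) dps set" where
  "raised_power a m V u =
     {\<Sum>i\<le>m. dp_mult (dp_embed (w i)) (Lp_pow a (m + u - i)) | w.
        (\<forall>i\<le>m. w i \<in> dp_hom i) \<and> (\<Sum>i\<le>m. dp_mult (dp_embed (w i)) (Lp_pow a (m - i))) \<in> V}"

definition forms_act :: "nat \<Rightarrow> ('v::finite, 'k::comm_ring_1) dps set \<Rightarrow> ('v, 'k) dps set" where
  "forms_act d W = kspace.span {contract r w | r w. homogeneous d r \<and> w \<in> W}"

section \<open>Change of coordinates\<close>

text \<open>
  The change of coordinates \<open>g\<close> of \<open>R\<close> sends \<open>x_i\<close> to \<open>x_i + a_i z\<close> and fixes \<open>z\<close>; it takes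
  the ideal of \<open>p = (a_1 : ... : a_n : 1)\<close> to that of \<open>(0 : ... : 0 : 1)\<close>. Its
  contragredient \<open>g*\<close> is the transpose for the pairing \<open>\<langle>r, F\<rangle> = (r \<circ> F) 0\<close>, for which monomials
  and divided power monomials are dual bases.
\<close>

definition gmap :: "('n::finite \<Rightarrow> 'k) \<Rightarrow> ('n option, 'k::comm_ring_1) mpoly \<Rightarrow> ('n option, 'k) mpoly" where
  "gmap a = poly_subst (\<lambda>v. case v of Some i \<Rightarrow> Var (Some i) + Const (a i) * Var None | None \<Rightarrow> Var None)"

definition gstar :: "('n::finite \<Rightarrow> 'k) \<Rightarrow> ('n option, 'k::comm_ring_1) dps \<Rightarrow> ('n option, 'k) dps" where
  "gstar a F = (\<lambda>U. contract (gmap a (monom U)) F 0)"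

end

theory Submission
  imports Defs "HOL-Library.FuncSet"
begin

text \<open>
  The change of coordinates \<open>g\<close> moves \<open>p\<close> to the origin, and \<open>g*\<close>, being its transpose, intertwines the
  two contraction actions (\<open>contract_gstar\<close>). Homogenization at the origin only pads monomials with divided
  powers of \<open>Z\<close> (\<open>homog_dps\<close>), and by the binomial theorem homogenization with respect to \<open>L_p\<close> is its
  image under \<open>g*\<close> (\<open>Homog1_conv_gstar\<close>). At the origin a form of degree \<open>d\<close> acts on homogenizations as
  its dehomogenization acts on the affine series (\<open>contract_homog_dps\<close>). So everything reduces to
  comparing homogeneous and affine duality.

  The comparison rests on two facts about the saturated ideal \<open>I\<close> of a scheme supported at \<open>p\<close>. First,
  \<open>z\<close> is a nonzerodivisor modulo \<open>I\<close> (\<open>punctual_z_nonzerodivisor\<close>): the hyperplane \<open>z = 0\<close> contains no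
  point of the scheme, so \<open>I + (z)\<close> contains powers of all variables, multiplication by \<open>z\<close> is surjective on
  \<open>R/I\<close> in large degrees and, by finite-dimensionality, eventually injective; saturation extends
  injectivity to all degrees. Hence \<open>I\<close> in degree \<open>u\<close> is the space of polynomials of degree at most \<open>u\<close> in the
  dehomogenized ideal, and a form of degree \<open>u\<close> killed by \<open>I\<close>, read as a functional on polynomials of degree at
  most \<open>u\<close>, extends to a functional killed by the affine ideal (\<open>global_inverse_dp_hom\<close>). Second, a power of
  the maximal ideal of \<open>q\<close> lies in the affine ideal, so that the latter is not changed by localizing and the
  affine inverse system at the origin lives in degrees up to the socle degree
  (\<open>punctual_affine_inverse_dp_le\<close>). Together they give the first equality of (i); the second holds
  because forms of degree \<open>\<alpha>\<close> act at the origin through all polynomials of degree at most \<open>\<alpha>\<close>, and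
  forms of higher degree kill generators of degree at most \<open>\<alpha>\<close> (\<open>forms_act_raised_power\<close>).

  For the converse, the scheme is defined by the annihilator of the given inverse system. It is saturated and
  supported at \<open>p\<close> (\<open>punctual_annihilator\<close>), and Macaulay duality in each degree recovers the inverse system
  (\<open>global_inverse_annihilator\<close>).
\<close>

section \<open>Exponent vectors\<close>

lemma mdeg_zero [simp]: "mdeg 0 = 0"
  by (simp add: mdeg_def)

lemma mdeg_add [simp]: "mdeg (U + W) = mdeg U + mdeg W"
  by (simp add: mdeg_def sum.distrib)

lemma mdeg_unit_exp [simp]: "mdeg (unit_exp v) = 1"
  by (simp add: mdeg_def unit_exp_def)

lemma le_mdeg: "U v \<le> mdeg U"
  unfolding mdeg_def by (rule member_le_sum) auto

lemma mdeg_option: "mdeg U = U None + mdeg (U \<circ> Some)"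
proof -
  have "mdeg U = (\<Sum>v\<in>insert None (range Some). U v)"
    by (simp add: mdeg_def UNIV_option_conv)
  also have "\<dots> = U None + (\<Sum>v\<in>range Some. U v)"
    by (rule sum.insert) auto
  also have "(\<Sum>v\<in>range Some. U v) = mdeg (U \<circ> Some)"
    by (simp add: mdeg_def sum.reindex)
  finally show ?thesis .
qed

lemma finite_mdeg_le: "finite {U :: 'v::finite \<Rightarrow> nat. mdeg U \<le> d}"
proof (rule finite_subset)
  show "{U :: 'v \<Rightarrow> nat. mdeg U \<le> d} \<subseteq> PiE UNIV (\<lambda>_. {..d})"
    by (auto intro: order_trans[OF le_mdeg])
  show "finite (PiE (UNIV :: 'v set) (\<lambda>_. {..d}))"
    by (rule finite_PiE) auto
qed

lemma finite_mdeg_eq: "finite {U :: 'v::finite \<Rightarrow> nat. mdeg U = d}"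
  by (rule finite_subset[OF _ finite_mdeg_le[of d]]) auto

lemma dp_leI: "(\<And>U. F U \<noteq> 0 \<Longrightarrow> mdeg U \<le> d) \<Longrightarrow> F \<in> dp_le d"
  unfolding dp_le_def dp_ring_def
  using finite_subset[OF _ finite_mdeg_le[of d], of "{U. F U \<noteq> 0}"] by auto

lemma dp_homI: "(\<And>U. F U \<noteq> 0 \<Longrightarrow> mdeg U = d) \<Longrightarrow> F \<in> dp_hom d"
  unfolding dp_hom_def dp_ring_def
  using finite_subset[OF _ finite_mdeg_eq[of d], of "{U. F U \<noteq> 0}"] by auto

lemma dp_hom_mdeg: "F \<in> dp_hom d \<Longrightarrow> mdeg U \<noteq> d \<Longrightarrow> F U = 0"
  by (auto simp: dp_hom_def)

lemma dp_le_mdeg: "F \<in> dp_le d \<Longrightarrow> mdeg U > d \<Longrightarrow> F U = 0"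
  by (auto simp: dp_le_def not_le[symmetric])

lemma dp_part_hom: "dp_part d F \<in> dp_hom d"
  by (rule dp_homI) (simp add: dp_part_def split: if_splits)

section \<open>Homomorphisms out of polynomial rings\<close>

definition ring_map :: "('a::comm_ring_1 \<Rightarrow> 'b::comm_ring_1) \<Rightarrow> bool" where
  "ring_map \<phi> \<longleftrightarrow> \<phi> 1 = 1 \<and> (\<forall>f g. \<phi> (f + g) = \<phi> f + \<phi> g) \<and> (\<forall>f g. \<phi> (f * g) = \<phi> f * \<phi> g)"

lemma
  assumes "ring_map \<phi>"
  shows ring_map_1: "\<phi> 1 = 1"
    and ring_map_add: "\<phi> (f + g) = \<phi> f + \<phi> g"
    and ring_map_mult: "\<phi> (f * g) = \<phi> f * \<phi> g"
  using assms by (auto simp: ring_map_def)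

lemma ring_map_0: "ring_map \<phi> \<Longrightarrow> \<phi> 0 = 0"
  using ring_map_add[of \<phi> 0 0] by simp

lemma ring_map_diff: "ring_map \<phi> \<Longrightarrow> \<phi> (f - g) = \<phi> f - \<phi> g"
  using ring_map_add[of \<phi> "f - g" g] by (simp add: algebra_simps)

lemma ring_map_uminus: "ring_map \<phi> \<Longrightarrow> \<phi> (- f) = - \<phi> f"
  using ring_map_diff[of \<phi> 0 f] by (simp add: ring_map_0)

lemma ring_map_sum: "ring_map \<phi> \<Longrightarrow> \<phi> (sum f A) = (\<Sum>x\<in>A. \<phi> (f x))"
  by (induction A rule: infinite_finite_induct) (auto simp: ring_map_0 ring_map_add)

lemma ring_map_prod: "ring_map \<phi> \<Longrightarrow> \<phi> (prod f A) = (\<Prod>x\<in>A. \<phi> (f x))"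
  by (induction A rule: infinite_finite_induct) (auto simp: ring_map_1 ring_map_mult)

lemma ring_map_power: "ring_map \<phi> \<Longrightarrow> \<phi> (f ^ m) = \<phi> f ^ m"
  by (induction m) (auto simp: ring_map_1 ring_map_mult)

lemma ring_map_comp: "ring_map \<phi> \<Longrightarrow> ring_map \<psi> \<Longrightarrow> ring_map (\<lambda>f. \<phi> (\<psi> f))"
  by (simp add: ring_map_def)

lemma ring_map_id: "ring_map (\<lambda>f. f)"
  by (simp add: ring_map_def)

lemmas ring_map_simps =
  ring_map_0 ring_map_1 ring_map_add ring_map_diff ring_map_uminus ring_map_mult ring_map_sum ring_map_prod
  ring_map_power

text \<open>
  Substitutions, evaluations on a line and homogenization all send a monomial to a prescribed
  value and are extended additively; the common pattern also allows index monoids other than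
  exponent vectors, such as \<^typ>\<open>nat\<close> for univariate polynomials.
\<close>

definition mono_ext :: "('k \<Rightarrow> 'b) \<Rightarrow> ('a \<Rightarrow> 'b) \<Rightarrow> ('a::comm_monoid_add \<Rightarrow>\<^sub>0 'k::comm_ring_1) \<Rightarrow> 'b::comm_ring_1" where
  "mono_ext \<iota> c f = (\<Sum>U\<in>Poly_Mapping.keys f. \<iota> (Poly_Mapping.lookup f U) * c U)"

lemma mono_ext_superset:
  assumes "\<iota> 0 = 0" "finite A" "Poly_Mapping.keys f \<subseteq> A"
  shows "mono_ext \<iota> c f = (\<Sum>U\<in>A. \<iota> (Poly_Mapping.lookup f U) * c U)"
  unfolding mono_ext_def
  by (rule sum.mono_neutral_left) (use assms in \<open>auto simp: in_keys_iff\<close>)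

lemma mono_ext_single: "\<iota> 0 = 0 \<Longrightarrow> mono_ext \<iota> c (Poly_Mapping.single U x) = \<iota> x * c U"
  by (cases "x = 0") (auto simp: mono_ext_def)

lemma mono_ext_zero: "mono_ext \<iota> c 0 = 0"
  by (simp add: mono_ext_def)

lemma mono_ext_add:
  assumes "\<iota> 0 = 0" "\<And>x y. \<iota> (x + y) = \<iota> x + \<iota> y"
  shows "mono_ext \<iota> c (f + g) = mono_ext \<iota> c f + mono_ext \<iota> c g"
proof -
  let ?A = "Poly_Mapping.keys f \<union> Poly_Mapping.keys g"
  have "Poly_Mapping.keys (f + g) \<subseteq> ?A" by (rule Poly_Mapping.keys_add)
  then show ?thesis
    by (simp add: mono_ext_superset[of \<iota> ?A] assms Poly_Mapping.lookup_add algebra_simps sum.distrib)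
qed

lemma poly_mapping_expand:
  fixes f :: "'a \<Rightarrow>\<^sub>0 'b::comm_monoid_add"
  shows "f = (\<Sum>U\<in>Poly_Mapping.keys f. Poly_Mapping.single U (Poly_Mapping.lookup f U))"
  by (rule poly_mapping_eqI)
    (auto simp: lookup_sum lookup_single when_def in_keys_iff sum.delta' sum.delta)

text \<open>Reduces identities between additive maps on polynomials to single terms.\<close>

lemma poly_mapping_additive_induct:
  fixes f :: "'a \<Rightarrow>\<^sub>0 'b::comm_monoid_add"
  assumes "P 0" "\<And>U x. P (Poly_Mapping.single U x)" "\<And>f g. P f \<Longrightarrow> P g \<Longrightarrow> P (f + g)"
  shows "P f"
proof -
  have "P (\<Sum>U\<in>A. Poly_Mapping.single U (Poly_Mapping.lookup f U))" for A
    by (induction A rule: infinite_finite_induct) (auto intro: assms)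
  then show ?thesis by (metis poly_mapping_expand)
qed

lemma ring_map_mono_ext:
  assumes \<iota>: "ring_map \<iota>" and c: "c 0 = 1" "\<And>U W. c (U + W) = c U * c W"
  shows "ring_map (mono_ext \<iota> c)"
proof -
  note \<iota>' = ring_map_0[OF \<iota>] ring_map_add[OF \<iota>]
  have add: "mono_ext \<iota> c (f + g) = mono_ext \<iota> c f + mono_ext \<iota> c g" for f g
    by (rule mono_ext_add) (auto simp: \<iota>')
  have "mono_ext \<iota> c (f * g) = mono_ext \<iota> c f * mono_ext \<iota> c g" for f g
  proof (induction f rule: poly_mapping_additive_induct)
    case (2 U x)
    show ?case
    proof (induction g rule: poly_mapping_additive_induct)
      case (2 W y)
      show ?case
        by (simp add: mult_single mono_ext_single \<iota>' ring_map_mult[OF \<iota>] c algebra_simps)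
    qed (auto simp: mono_ext_zero add algebra_simps)
  qed (auto simp: mono_ext_zero add algebra_simps)
  moreover have "mono_ext \<iota> c 1 = 1"
    by (simp flip: single_one add: mono_ext_single \<iota>' c ring_map_1[OF \<iota>])
  ultimately show ?thesis by (simp add: ring_map_def add)
qed

lemma ring_map_Const: "ring_map Const"
  by (simp add: ring_map_def Const_def single_add mult_single)

lemmas Const_simps = ring_map_simps[OF ring_map_Const]

lemma Const_mult_single: "Const c * Poly_Mapping.single U x = Poly_Mapping.single U (c * x)"
  by (simp add: Const_def mult_single)

lemma single_conv_monom: "Poly_Mapping.single U x = Const x * monom U"
  by (simp add: monom_def Const_mult_single)

lemma monom_zero: "monom 0 = 1"
  by (simp add: monom_def)

lemma monom_add: "monom (U + W) = monom U * monom W"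
  by (simp add: monom_def mult_single)

lemma monom_conv_prod:
  "(monom U :: ('v::finite, 'k::comm_ring_1) mpoly) = (\<Prod>v\<in>UNIV. Var v ^ U v)"
proof -
  have pow: "(Var v :: ('v, 'k) mpoly) ^ m = monom (\<lambda>w. if w = v then m else 0)" for v :: 'v and m
  proof (induction m)
    case 0
    show ?case by (simp add: monom_def zero_fun_def[symmetric])
  next
    case (Suc m)
    have "unit_exp v + (\<lambda>w. if w = v then m else 0) = (\<lambda>w. if w = v then Suc m else 0)"
      by (auto simp: unit_exp_def)
    then show ?case
      by (simp add: Suc del: plus_fun_apply) (simp add: Var_def flip: monom_add)
  qed
  have "(\<Prod>v\<in>A. (Var v :: ('v, 'k) mpoly) ^ U v) = monom (\<lambda>w. if w \<in> A then U w else 0)" for A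
  proof (induction A rule: infinite_finite_induct)
    case (insert v A)
    have "(\<lambda>w. if w = v then U v else 0) + (\<lambda>w. if w \<in> A then U w else 0) =
        (\<lambda>w. if w \<in> insert v A then U w else 0)"
      using insert by auto
    then show ?case using insert by (simp add: pow flip: monom_add)
  qed (auto simp: monom_def zero_fun_def[symmetric])
  from this[of UNIV] show ?thesis by simp
qed

lemma mpoly_induct [case_names Const Var add mult]:
  fixes f :: "('v::finite, 'k::comm_ring_1) mpoly"
  assumes C: "\<And>c. P (Const c)" and V: "\<And>v. P (Var v)"
    and A: "\<And>f g. P f \<Longrightarrow> P g \<Longrightarrow> P (f + g)" and M: "\<And>f g. P f \<Longrightarrow> P g \<Longrightarrow> P (f * g)"
  shows "P f"
proof (induction f rule: poly_mapping_additive_induct)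
  case 1
  show ?case using C[of 0] by (simp add: Const_simps)
next
  case (2 U x)
  have one: "P 1" using C[of 1] by (simp add: Const_simps)
  have pow: "P (Var v ^ m)" for v m
    by (induction m) (auto intro: one M V)
  have "P (\<Prod>v\<in>B. Var v ^ U v)" for B
    by (induction B rule: infinite_finite_induct) (auto intro: one M pow)
  then show ?case by (auto simp: single_conv_monom monom_conv_prod intro: M C)
qed (rule A)

lemma ring_map_unique:
  fixes f :: "('v::finite, 'k::comm_ring_1) mpoly"
  assumes "ring_map \<phi>" "ring_map \<psi>"
    and "\<And>c. \<phi> (Const c) = \<psi> (Const c)" "\<And>v. \<phi> (Var v) = \<psi> (Var v)"
  shows "\<phi> f = \<psi> f"
  by (induction f rule: mpoly_induct) (auto simp: assms ring_map_simps)

lemma poly_subst_conv_mono_ext: "poly_subst \<sigma> = mono_ext Const (\<lambda>U. \<Prod>v\<in>UNIV. \<sigma> v ^ U v)"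
  by (auto simp: poly_subst_def mono_ext_def)

lemma ring_map_poly_subst: "ring_map (poly_subst \<sigma>)"
  unfolding poly_subst_conv_mono_ext
  by (rule ring_map_mono_ext) (auto simp: ring_map_Const power_add prod.distrib)

lemma poly_subst_single:
  "poly_subst \<sigma> (Poly_Mapping.single U x) = Const x * (\<Prod>v\<in>UNIV. \<sigma> v ^ U v)"
  by (simp add: poly_subst_conv_mono_ext mono_ext_single Const_simps)

lemma poly_subst_monom: "poly_subst \<sigma> (monom U) = (\<Prod>v\<in>UNIV. \<sigma> v ^ U v)"
  by (simp add: monom_def poly_subst_single Const_simps)

lemma poly_subst_Const: "poly_subst \<sigma> (Const c) = Const c"
  by (simp add: Const_def poly_subst_single) 

lemma prod_power_add:
  "(\<Prod>v\<in>UNIV. l v ^ (U + W) v) = (\<Prod>v\<in>UNIV. l v ^ U v) * (\<Prod>v\<in>(UNIV :: 'v::finite set). l v ^ W v :: 'a::comm_ring_1)"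
  by (simp add: power_add prod.distrib)

lemma prod_power_unit_exp:
  "(\<Prod>w\<in>UNIV. l w ^ unit_exp v w) = (l (v :: 'v::finite) :: 'a::comm_ring_1)"
proof -
  have "(\<Prod>w\<in>UNIV. l w ^ unit_exp v w) = (\<Prod>w\<in>UNIV. if w = v then l w else 1)"
    by (rule prod.cong) (auto simp: unit_exp_def)
  then show ?thesis by simp
qed

lemma poly_subst_Var: "poly_subst \<sigma> (Var v) = \<sigma> v"
  by (simp add: Var_def poly_subst_monom prod_power_unit_exp)

lemma ring_map_gmap: "ring_map (gmap a)"
  unfolding gmap_def by (rule ring_map_poly_subst)

lemma ring_map_dehomogenize: "ring_map dehomogenize"
  unfolding dehomogenize_def by (rule ring_map_poly_subst)

lemma ring_map_translate: "ring_map (translate a)"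
  unfolding translate_def by (rule ring_map_poly_subst)

lemma gmap_simps [simp]:
  "gmap a (Const c) = Const c" "gmap a (Var None) = Var None"
  "gmap a (Var (Some i)) = Var (Some i) + Const (a i) * Var None"
  by (simp_all add: gmap_def poly_subst_Const poly_subst_Var)

lemma dehomogenize_simps [simp]:
  "dehomogenize (Const c) = Const c" "dehomogenize (Var None) = 1"
  "dehomogenize (Var (Some i)) = Var i"
  by (simp_all add: dehomogenize_def poly_subst_Const poly_subst_Var)

lemma translate_simps [simp]:
  "translate a (Const c) = Const c" "translate a (Var i) = Var i - Const (a i)"
  by (simp_all add: translate_def poly_subst_Const poly_subst_Var)

lemma gmap_gmap_uminus: "gmap a (gmap (\<lambda>i. - a i) r) = r"
proof (rule ring_map_unique[OF ring_map_comp[OF ring_map_gmap ring_map_gmap] ring_map_id])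
  fix v :: "'a option"
  show "gmap a (gmap (\<lambda>i. - a i) (Var v)) = Var v"
  proof (cases v)
    case (Some i)
    then show ?thesis by (simp add: ring_map_simps[OF ring_map_gmap] Const_simps)
  qed simp
qed simp

lemma gmap_uminus_gmap: "gmap (\<lambda>i. - a i) (gmap a r) = r"
  using gmap_gmap_uminus[of "\<lambda>i. - a i" r] by simp

lemma bij_gmap: "bij (gmap a)"
  by (rule bijI') (metis gmap_uminus_gmap, metis gmap_gmap_uminus)

lemma translate_dehomogenize_gmap: "translate a (dehomogenize (gmap a r)) = dehomogenize r"
proof (rule ring_map_unique[OF ring_map_comp[OF ring_map_translate
        ring_map_comp[OF ring_map_dehomogenize ring_map_gmap]] ring_map_dehomogenize])
  fix v :: "'a option"
  show "translate a (dehomogenize (gmap a (Var v))) = dehomogenize (Var v)"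
    by (cases v) (auto simp: ring_map_simps[OF ring_map_dehomogenize] ring_map_simps[OF ring_map_translate])
qed simp

lemma translate_translate_uminus: "translate a (translate (\<lambda>i. - a i) h) = h"
proof (rule ring_map_unique[OF ring_map_comp[OF ring_map_translate ring_map_translate] ring_map_id])
  fix v :: 'a
  show "translate a (translate (\<lambda>i. - a i) (Var v)) = Var v"
    by (simp add: ring_map_simps[OF ring_map_translate] Const_simps)
qed simp

lemma translate_uminus_translate: "translate (\<lambda>i. - a i) (translate a h) = h"
  using translate_translate_uminus[of "\<lambda>i. - a i" h] by simp

lemma vimage_translate_dehomogenize:
  "translate a -` (dehomogenize ` I) = dehomogenize ` (gmap a ` I)"
proof (intro set_eqI iffI)
  fix h assume "h \<in> translate a -` (dehomogenize ` I)"
  then obtain r where r: "r \<in> I" "translate a h = dehomogenize r" by auto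
  have "h = translate (\<lambda>i. - a i) (translate a h)"
    by (rule translate_uminus_translate[symmetric])
  also have "\<dots> = translate (\<lambda>i. - a i) (translate a (dehomogenize (gmap a r)))"
    by (simp only: r(2) translate_dehomogenize_gmap)
  also have "\<dots> = dehomogenize (gmap a r)"
    by (rule translate_uminus_translate)
  finally have "h = dehomogenize (gmap a r)" .
  then show "h \<in> dehomogenize ` (gmap a ` I)" using r(1) by (simp only: imageI)
next
  fix h assume "h \<in> dehomogenize ` (gmap a ` I)"
  then obtain r where "r \<in> I" "h = dehomogenize (gmap a r)" by auto
  then show "h \<in> translate a -` (dehomogenize ` I)"
    by (simp only: vimage_eq translate_dehomogenize_gmap imageI)
qed

section \<open>Homogeneous components\<close>

lemma lookup_poly_part: "Poly_Mapping.lookup (poly_part d f) U = (if mdeg U = d then Poly_Mapping.lookup f U else 0)"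
  by (auto simp: poly_part_def lookup_sum lookup_single when_def in_keys_iff sum.delta' sum.delta)

lemma poly_part_zero [simp]: "poly_part d 0 = 0"
  by (rule poly_mapping_eqI) (simp add: lookup_poly_part)

lemma poly_part_add: "poly_part d (f + g) = poly_part d f + poly_part d g"
  by (rule poly_mapping_eqI) (simp add: lookup_poly_part lookup_add)

lemma homogeneous_iff: "homogeneous d f \<longleftrightarrow> (\<forall>U. Poly_Mapping.lookup f U \<noteq> 0 \<longrightarrow> mdeg U = d)"
  by (auto simp: homogeneous_def in_keys_iff)

lemma homogeneous_poly_part: "homogeneous d (poly_part d f)"
  by (auto simp: homogeneous_iff lookup_poly_part)

lemma poly_part_homogeneous: "homogeneous d f \<Longrightarrow> poly_part e f = (if e = d then f else 0)"
  by (rule poly_mapping_eqI) (auto simp: lookup_poly_part homogeneous_iff)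

lemma homogeneous_zero [simp]: "homogeneous d 0"
  by (simp add: homogeneous_iff)

lemma homogeneous_add: "homogeneous d f \<Longrightarrow> homogeneous d g \<Longrightarrow> homogeneous d (f + g)"
  by (auto simp: homogeneous_iff lookup_add) (metis add_0)

lemma homogeneous_sum: "(\<And>x. x \<in> A \<Longrightarrow> homogeneous d (f x)) \<Longrightarrow> homogeneous d (sum f A)"
  by (induction A rule: infinite_finite_induct) (auto intro: homogeneous_add)

lemma homogeneous_single: "mdeg U = d \<Longrightarrow> homogeneous d (Poly_Mapping.single U x)"
  by (auto simp: homogeneous_iff lookup_single when_def)

lemma homogeneous_monom: "homogeneous (mdeg U) (monom U)"
  by (simp add: monom_def homogeneous_single)

lemma homogeneous_Var: "homogeneous 1 (Var v)"
  using homogeneous_monom[of "unit_exp v"] by (simp add: Var_def)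

lemma homogeneous_Const: "homogeneous 0 (Const c)"
  by (simp add: Const_def homogeneous_single)

lemma homogeneous_one: "homogeneous 0 1"
  using homogeneous_Const[of 1] by (simp add: Const_simps)

lemma homogeneous_mult: "homogeneous d f \<Longrightarrow> homogeneous e g \<Longrightarrow> homogeneous (d + e) (f * g)"
  unfolding homogeneous_def using keys_mult[of f g] by fastforce

lemma homogeneous_power: "homogeneous d f \<Longrightarrow> homogeneous (m * d) (f ^ m)"
  by (induction m) (auto intro: homogeneous_mult homogeneous_one)

lemma homogeneous_prod:
  "finite A \<Longrightarrow> (\<And>x. x \<in> A \<Longrightarrow> homogeneous (d x) (f x)) \<Longrightarrow> homogeneous (sum d A) (prod f A)"
  by (induction A rule: finite_induct) (auto intro: homogeneous_mult homogeneous_one)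

lemma homogeneous_induct [consumes 1, case_names zero single add]:
  assumes "homogeneous d f"
    and "P 0" "\<And>U x. mdeg U = d \<Longrightarrow> P (Poly_Mapping.single U x)" "\<And>f g. P f \<Longrightarrow> P g \<Longrightarrow> P (f + g)"
  shows "P f"
proof -
  have "P (\<Sum>U\<in>A. Poly_Mapping.single U (Poly_Mapping.lookup f U))" if "A \<subseteq> Poly_Mapping.keys f" for A
    using that by (induction A rule: infinite_finite_induct)
      (use assms in \<open>auto simp: homogeneous_def\<close>)
  then show ?thesis by (metis order_refl poly_mapping_expand)
qed

lemma finite_degrees_poly:
  obtains D where "\<And>U. Poly_Mapping.lookup f U \<noteq> 0 \<Longrightarrow> mdeg U \<le> D"
proof
  show "mdeg U \<le> (\<Sum>U\<in>Poly_Mapping.keys f. mdeg U)" if "Poly_Mapping.lookup f U \<noteq> 0" for U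
    by (rule member_le_sum) (use that in \<open>auto simp: in_keys_iff\<close>)
qed

lemma sum_poly_part:
  assumes "\<And>U. Poly_Mapping.lookup f U \<noteq> 0 \<Longrightarrow> mdeg U \<le> D"
  shows "(\<Sum>d\<le>D. poly_part d f) = f"
  by (rule poly_mapping_eqI) (use assms in \<open>auto simp: lookup_sum lookup_poly_part\<close>)

lemma poly_part_mult:
  "poly_part d (f * g) = (\<Sum>i\<le>d. poly_part i f * poly_part (d - i) g)"
proof (induction f rule: poly_mapping_additive_induct)
  case (2 U x)
  show ?case
  proof (induction g rule: poly_mapping_additive_induct)
    case (2 W y)
    have part: "poly_part i (Poly_Mapping.single V z) = (if i = mdeg V then Poly_Mapping.single V z else 0)" for i z and V :: "'a \<Rightarrow> nat"
      by (rule poly_part_homogeneous) (simp add: homogeneous_single)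
    have sum: "(\<Sum>i\<le>d. poly_part i (Poly_Mapping.single U x) * poly_part (d - i) (Poly_Mapping.single W y)) =
        (\<Sum>i\<in>{..d} \<inter> {mdeg U}. if d - i = mdeg W then Poly_Mapping.single U x * Poly_Mapping.single W y else 0)"
      by (rule sum.mono_neutral_cong_right) (auto simp: part)
    have "{..d} \<inter> {mdeg U} = (if mdeg U \<le> d then {mdeg U} else {})"
      by auto
    then show ?case by (subst sum) (auto simp: part mult_single)
  qed (auto simp: poly_part_add algebra_simps sum.distrib)
qed (auto simp: poly_part_add algebra_simps sum.distrib)

lemma poly_part_mult_homogeneous:
  assumes "homogeneous e f"
  shows "poly_part (e + d) (f * g) = f * poly_part d g"
proof (induction g rule: poly_mapping_additive_induct)
  case (2 U x)
  have "homogeneous (e + mdeg U) (f * Poly_Mapping.single U x)"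
    by (rule homogeneous_mult[OF assms homogeneous_single]) simp
  moreover have "homogeneous (mdeg U) (Poly_Mapping.single U x)"
    by (simp add: homogeneous_single)
  ultimately show ?case
    by (simp add: poly_part_homogeneous)
qed (auto simp: poly_part_add algebra_simps)

lemma homogeneous_gmap:
  assumes "homogeneous d r"
  shows "homogeneous d (gmap a r)"
  using assms
proof (induction rule: homogeneous_induct)
  case (single U x)
  have lin: "homogeneous 1 (gmap a (Var v))" for v
    using homogeneous_mult[OF homogeneous_Const homogeneous_Var]
    by (cases v) (auto intro!: homogeneous_add homogeneous_Var simp del: One_nat_def)
  have "homogeneous (\<Sum>v\<in>UNIV. U v * 1) (\<Prod>v\<in>UNIV. gmap a (Var v) ^ U v)"
    by (rule homogeneous_prod) (auto intro: homogeneous_power lin simp del: mult_1_right One_nat_def)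
  then have "homogeneous (mdeg U) (gmap a (monom U))"
    by (simp add: monom_conv_prod ring_map_simps[OF ring_map_gmap] mdeg_def)
  from homogeneous_mult[OF homogeneous_Const this] show ?case
    by (simp add: single_conv_monom ring_map_simps[OF ring_map_gmap] single)
qed (auto simp: ring_map_simps[OF ring_map_gmap] intro: homogeneous_add)

lemma poly_part_gmap: "poly_part d (gmap a r) = gmap a (poly_part d r)"
proof (induction r rule: poly_mapping_additive_induct)
  case (2 U x)
  have h: "homogeneous (mdeg U) (Poly_Mapping.single U x)"
    by (simp add: homogeneous_single)
  show ?case
    using poly_part_homogeneous[OF h, of d] poly_part_homogeneous[OF homogeneous_gmap[OF h], of d]
    by (simp add: ring_map_0[OF ring_map_gmap])
qed (auto simp: poly_part_add ring_map_simps[OF ring_map_gmap])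

section \<open>Contraction\<close>

lemma contract_Const: "contract (Const c) F = dp_scale c F"
  by (simp add: Const_def contract_single dp_scale_def)

lemma Const_mult_lookup: "Poly_Mapping.lookup (Const c * h) K = c * Poly_Mapping.lookup h K"
proof (induction h rule: poly_mapping_additive_induct)
  case (2 U x)
  show ?case by (simp add: Const_mult_single lookup_single when_def)
qed (simp_all add: distrib_left lookup_add)

lemma contract_monom: "contract (monom K) F = (\<lambda>U. F (U + K))"
  by (simp add: monom_def contract_single)

lemma contract_single_zero: "contract (Poly_Mapping.single K c) F 0 = c * F K"
  by (simp only: contract_single add_0)

lemma contract_dp_scale: "contract r (dp_scale c F) = dp_scale c (contract r F)"
  by (metis contract_Const contract_mult mult.commute)

lemma dp_part_conv_contract:
  "contract (poly_part d r) F U = contract r (dp_part (mdeg U + d) F) U"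
proof (induction r rule: poly_mapping_additive_induct)
  case (2 K x)
  have "poly_part d (Poly_Mapping.single K x) = (if d = mdeg K then Poly_Mapping.single K x else 0)"
    by (rule poly_part_homogeneous) (simp add: homogeneous_single)
  then show ?case by (auto simp: contract_single contract_zero_left dp_part_def)
qed (auto simp: poly_part_add contract_add_left contract_zero_left)

lemma contract_at: "contract r F U = contract (monom U * r) F 0"
proof -
  have "contract (monom U * r) F 0 = contract (monom U) (contract r F) 0"
    by (rule fun_cong[OF contract_mult])
  also have "\<dots> = contract r F (0 + U)"
    by (rule fun_cong[OF contract_monom])
  also have "0 + U = U" by (rule add_0)
  finally show ?thesis by (rule sym)
qed

lemma contract_at_zero_homogeneous:
  assumes "homogeneous d r" "\<And>U. mdeg U = d \<Longrightarrow> F U = 0"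
  shows "contract r F 0 = 0"
  using assms(1)
proof (induction rule: homogeneous_induct)
  case (single U x)
  then show ?case by (simp only: contract_single_zero assms(2) mult_zero_right)
qed (auto simp: contract_zero_left contract_add_left)

lemma dp_ring_le:
  assumes "F \<in> dp_ring"
  obtains D where "F \<in> dp_le D"
proof
  have fin: "finite {U. F U \<noteq> 0}" using assms by (simp add: dp_ring_def)
  show "F \<in> dp_le (\<Sum>U\<in>{U. F U \<noteq> 0}. mdeg U)"
    by (rule dp_leI, rule member_le_sum) (use fin in auto)
qed

lemma sum_fun_apply: "(\<Sum>x\<in>A. f x) U = (\<Sum>x\<in>A. f x U)"
  by (induction A rule: infinite_finite_induct) auto

lemma sum_dp_part: "F \<in> dp_le D \<Longrightarrow> (\<Sum>d\<le>D. dp_part d F) = F"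
proof
  fix U assume "F \<in> dp_le D"
  then show "(\<Sum>d\<le>D. dp_part d F) U = F U"
    by (auto simp: sum_fun_apply dp_part_def dp_le_mdeg)
qed

lemma gstar_add: "gstar a (F + G) = gstar a F + gstar a G"
  by (simp add: gstar_def fun_eq_iff contract_add_right)

text \<open>
  The transpose of \<open>g\<close> intertwines contraction because pairing \<open>g(x^U) r\<close> with \<open>F\<close> is a bilinear
  expression in which the ring element can be moved onto \<open>F\<close>.
\<close>

lemma contract_gstar: "contract r (gstar a F) = gstar a (contract (gmap a r) F)"
proof (induction r rule: poly_mapping_additive_induct)
  case 1
  show ?case
    by (simp add: contract_zero_left ring_map_simps[OF ring_map_gmap] gstar_def fun_eq_iff)
      (simp add: contract_def)
next
  case (2 K x)
  show ?case
  proof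
    fix U
    have "monom U * Poly_Mapping.single K x = Const x * monom (U + K)"
      by (simp add: monom_def mult_single Const_mult_single)
    then have g: "gmap a (monom U) * gmap a (Poly_Mapping.single K x) = Const x * gmap a (monom (U + K))"
      by (metis gmap_simps(1) ring_map_mult[OF ring_map_gmap])
    have "gstar a (contract (gmap a (Poly_Mapping.single K x)) F) U =
        contract (gmap a (monom U) * gmap a (Poly_Mapping.single K x)) F 0"
      unfolding gstar_def contract_mult ..
    also have "\<dots> = x * gstar a F (U + K)"
      unfolding g contract_mult contract_Const dp_scale_def gstar_def ..
    finally show "contract (Poly_Mapping.single K x) (gstar a F) U =
        gstar a (contract (gmap a (Poly_Mapping.single K x)) F) U"
      by (simp only: contract_single)
  qed
next
  case (3 f g)
  then show ?case
    by (simp only: contract_add_left ring_map_add[OF ring_map_gmap] gstar_add)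
qed

lemma gstar_pairing: "contract r (gstar a F) 0 = contract (gmap a r) F 0"
proof -
  have "contract r (gstar a F) 0 = gstar a (contract (gmap a r) F) 0"
    by (simp only: contract_gstar)
  also have "\<dots> = contract (gmap a r) F 0"
    by (simp only: gstar_def monom_zero ring_map_1[OF ring_map_gmap] contraction.scale_one)
  finally show ?thesis .
qed

lemma gstar_dp_scale: "gstar a (dp_scale c F) = dp_scale c (gstar a F)"
  by (simp add: gstar_def fun_eq_iff contract_dp_scale) (simp add: dp_scale_def)

lemma gstar_zero: "gstar a 0 = 0"
  by (simp add: gstar_def fun_eq_iff)

lemma gstar_gstar_uminus: "gstar a (gstar (\<lambda>i. - a i) F) = F"
proof
  fix U
  have "gstar a (gstar (\<lambda>i. - a i) F) U = contract (gmap (\<lambda>i. - a i) (gmap a (monom U))) F 0"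
    by (subst gstar_def) (rule gstar_pairing)
  then show "gstar a (gstar (\<lambda>i. - a i) F) U = F U"
    by (simp add: gmap_uminus_gmap contract_monom)
qed

lemma gstar_uminus_gstar: "gstar (\<lambda>i. - a i) (gstar a F) = F"
  using gstar_gstar_uminus[of "\<lambda>i. - a i" F] by simp

lemma gstar_eq_iff: "gstar a F = gstar a G \<longleftrightarrow> F = G"
  by (metis gstar_uminus_gstar)

lemma gstar_eq_zero: "gstar a F = 0 \<longleftrightarrow> F = 0"
  using gstar_eq_iff[of a F 0] by (simp add: gstar_zero)

lemma gstar_dp_hom: "F \<in> dp_hom d \<Longrightarrow> gstar a F \<in> dp_hom d"
proof (rule dp_homI, rule ccontr)
  fix U assume *: "F \<in> dp_hom d" "gstar a F U \<noteq> 0" "mdeg U \<noteq> d"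
  have "contract (gmap a (monom U)) F 0 = 0"
    by (rule contract_at_zero_homogeneous[OF homogeneous_gmap[OF homogeneous_monom]])
      (use * in \<open>auto simp: dp_hom_mdeg\<close>)
  with * show False by (simp add: gstar_def)
qed

lemma gstar_dp_ring: "F \<in> dp_ring \<Longrightarrow> gstar a F \<in> dp_ring"
proof -
  assume "F \<in> dp_ring"
  then obtain D where D: "F \<in> dp_le D" by (rule dp_ring_le)
  have "gstar a F \<in> dp_le D"
  proof (rule dp_leI, rule ccontr)
    fix U assume *: "gstar a F U \<noteq> 0" "\<not> mdeg U \<le> D"
    have "contract (gmap a (monom U)) F 0 = 0"
      by (rule contract_at_zero_homogeneous[OF homogeneous_gmap[OF homogeneous_monom]])
        (use * D in \<open>auto simp: dp_le_mdeg\<close>)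
    with * show False by (simp add: gstar_def)
  qed
  then show ?thesis by (simp add: dp_le_def)
qed

section \<open>Homogenization of divided power series\<close>

text \<open>
  For \<open>p\<close> the origin, homogenizing pads every \<open>X^{[K]}\<close> with the divided power of \<open>Z\<close> that brings
  it to degree \<open>u\<close>; terms of degree above \<open>u\<close> are lost.
\<close>

definition homog_dps :: "nat \<Rightarrow> ('n::finite, 'k::comm_ring_1) dps \<Rightarrow> ('n option, 'k) dps" where
  "homog_dps u f = (\<lambda>U. if mdeg U = u then f (U \<circ> Some) else 0)"

lemma homog_dps_dp_hom: "homog_dps u f \<in> dp_hom u"
  by (rule dp_homI) (simp add: homog_dps_def split: if_splits)

lemma homog_dps_add: "homog_dps u (f + g) = homog_dps u f + homog_dps u g"
  by (auto simp: homog_dps_def fun_eq_iff)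

lemma homog_dps_dp_scale: "homog_dps u (dp_scale c f) = dp_scale c (homog_dps u f)"
  by (auto simp: homog_dps_def dp_scale_def fun_eq_iff)

lemma homog_dps_zero: "homog_dps u 0 = 0"
  by (auto simp: homog_dps_def fun_eq_iff)

lemma plus_comp: "((U :: 'v \<Rightarrow> nat) + W) \<circ> g = (U \<circ> g) + (W \<circ> g)"
  by (simp add: fun_eq_iff)

lemma case_option_comp_Some [simp]: "case_option m K \<circ> Some = K"
  by (simp add: fun_eq_iff)

lemma mdeg_case_option [simp]: "mdeg (case_option m K) = m + mdeg K"
  by (simp add: mdeg_option)

lemma case_option_None_Some: "case_option (U None) (U \<circ> Some) = U"
  by (auto simp: fun_eq_iff split: option.splits)

lemma homog_dps_case_option: "mdeg K \<le> u \<Longrightarrow> homog_dps u f (case_option (u - mdeg K) K) = f K"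
  by (simp add: homog_dps_def)

lemma homog_dps_zero_degree:
  fixes f :: "('n::finite, 'k::comm_ring_1) dps"
  shows "homog_dps 0 f 0 = f 0"
proof -
  have "(0 :: 'n option \<Rightarrow> nat) \<circ> Some = 0" by (simp add: fun_eq_iff)
  then show ?thesis by (simp add: homog_dps_def)
qed

lemma homog_dps_cong: "(\<And>K. mdeg K \<le> u \<Longrightarrow> f K = g K) \<Longrightarrow> homog_dps u f = homog_dps u g"
  by (auto simp: homog_dps_def fun_eq_iff mdeg_option)

lemma homog_dps_inj:
  assumes "homog_dps u f = homog_dps u g" "f \<in> dp_le u" "g \<in> dp_le u"
  shows "f = g"
proof
  fix K
  show "f K = g K"
    using assms homog_dps_case_option[of K u f] homog_dps_case_option[of K u g]
    by (cases "mdeg K \<le> u") (auto simp: dp_le_mdeg)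
qed

lemma dp_hom_conv_homog_dps:
  assumes "F \<in> dp_hom u"
  shows "F = homog_dps u (\<lambda>K. F (case_option (u - mdeg K) K))"
proof
  fix U :: "'a option \<Rightarrow> nat"
  have "case_option (mdeg U - mdeg (U \<circ> Some)) (U \<circ> Some) = U"
    using mdeg_option[of U] case_option_None_Some[of U] by simp
  then show "F U = homog_dps u (\<lambda>K. F (case_option (u - mdeg K) K)) U"
    using dp_hom_mdeg[OF assms, of U] by (auto simp: homog_dps_def)
qed

lemma prod_UNIV_option: "(\<Prod>v\<in>UNIV. g v) = g None * (\<Prod>i\<in>(UNIV :: 'n::finite set). g (Some i))"
proof -
  have "(\<Prod>v\<in>UNIV. g v) = (\<Prod>v\<in>insert None (range Some). g v)"
    by (simp add: UNIV_option_conv)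
  also have "\<dots> = g None * (\<Prod>v\<in>range Some. g v)"
    by (rule prod.insert) auto
  finally show ?thesis by (simp add: prod.reindex)
qed

lemma dehomogenize_single:
  "dehomogenize (Poly_Mapping.single U x) = Poly_Mapping.single (U \<circ> Some) x"
  by (simp add: dehomogenize_def poly_subst_single prod_UNIV_option single_conv_monom[of "U \<circ> Some"]
      monom_conv_prod)

text \<open>
  Contracting by a form and setting \<open>z = 1\<close> commute with homogenization: \<open>z\<close> only lowers the padding.
\<close>

lemma contract_homog_dps:
  assumes "homogeneous d r"
  shows "contract r (homog_dps (u + d) f) = homog_dps u (contract (dehomogenize r) f)"
  using assms
proof (induction rule: homogeneous_induct)
  case (single U x)
  then show ?case
    by (auto simp: contract_single dehomogenize_single homog_dps_def fun_eq_iff plus_comp)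
qed (simp_all only: contract_zero_left contract_add_left homog_dps_zero homog_dps_add
    ring_map_0[OF ring_map_dehomogenize] ring_map_add[OF ring_map_dehomogenize])

lemma contract_homog_dps_zero:
  assumes "homogeneous d r" "u < d"
  shows "contract r (homog_dps u f) = 0"
  using assms(1)
proof (induction rule: homogeneous_induct)
  case (single U x)
  then show ?case using assms(2)
    by (auto simp: contract_single homog_dps_def fun_eq_iff)
qed (auto simp: contract_zero_left contract_add_left)

lemma finite_le_exp: "finite {K. K \<le> (U :: 'v::finite \<Rightarrow> nat)}"
  by (rule finite_subset[OF _ finite_mdeg_le[of "mdeg U"]]) (auto simp: mdeg_def le_fun_def sum_mono)

text \<open>Each factor is expanded by the binomial theorem and the product multiplied out.\<close>

lemma translated_monom:
  "(\<Prod>i\<in>UNIV. (Var i + Const (a i)) ^ U i) =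
    (\<Sum>K | K \<le> U. Poly_Mapping.single K
       (of_nat (\<Prod>i\<in>UNIV. U i choose K i) * (\<Prod>i\<in>(UNIV :: 'n::finite set). (a i :: 'k::comm_ring_1) ^ (U i - K i))))"
proof -
  have of_nat: "of_nat m = Const (of_nat m :: 'k)" for m
    by (induction m) (auto simp: Const_simps)
  have PiE: "PiE UNIV (\<lambda>i. {..U i}) = {K. K \<le> U}"
    by (auto simp: le_fun_def)
  have trm: "(\<Prod>i\<in>UNIV. of_nat (U i choose K i) * Var i ^ K i * Const (a i) ^ (U i - K i)) =
      Poly_Mapping.single K (of_nat (\<Prod>i\<in>UNIV. U i choose K i) * (\<Prod>i\<in>UNIV. a i ^ (U i - K i)))" for K
    by (simp add: prod.distrib single_conv_monom[of K] monom_conv_prod Const_simps of_nat algebra_simps)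
  have "(\<Prod>i\<in>UNIV. (Var i + Const (a i)) ^ U i) =
      (\<Prod>i\<in>UNIV. \<Sum>j\<le>U i. of_nat (U i choose j) * Var i ^ j * Const (a i) ^ (U i - j))"
    by (simp add: binomial_ring)
  also have "\<dots> = (\<Sum>K\<in>PiE UNIV (\<lambda>i. {..U i}).
      \<Prod>i\<in>UNIV. of_nat (U i choose K i) * Var i ^ K i * Const (a i) ^ (U i - K i))"
    by (rule prod_sum_PiE) auto
  finally show ?thesis by (simp add: PiE trm)
qed

text \<open>
  Comparison of coefficients: on the right they come from the Taylor expansion of
  \<open>g(x^U)\<close>, on the left from the structure constants of divided power multiplication.
\<close>

lemma Homog1_conv_gstar:
  fixes a :: "'n::finite \<Rightarrow> 'k::comm_ring_1"
  shows "Homog1 f a u = gstar a (homog_dps u f)"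
proof
  fix W :: "'n option \<Rightarrow> nat"
  let ?W = "\<lambda>i. W (Some i)"
  let ?t = "\<lambda>K. of_nat (\<Prod>i\<in>UNIV. ?W i choose K i) * (\<Prod>i\<in>UNIV. a i ^ (?W i - K i)) * f K"
  have right: "gstar a (homog_dps u f) W = (if mdeg W = u then \<Sum>K | K \<le> ?W. ?t K else 0)"
  proof (cases "mdeg W = u")
    case True
    have hom: "homogeneous u (gmap a (monom W))"
      using homogeneous_gmap[OF homogeneous_monom[of W], of a] by (simp add: True)
    have "gstar a (homog_dps u f) W = contract (dehomogenize (gmap a (monom W))) f 0"
      using contract_homog_dps[OF hom, of 0 f] by (simp add: gstar_def homog_dps_zero_degree)
    also have "dehomogenize (gmap a (monom W)) = (\<Prod>i\<in>UNIV. (Var i + Const (a i)) ^ ?W i)"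
      by (simp add: monom_conv_prod prod_UNIV_option ring_map_simps[OF ring_map_gmap]
          ring_map_simps[OF ring_map_dehomogenize])
    also have "contract \<dots> f 0 = (\<Sum>K | K \<le> ?W. ?t K)"
      by (simp add: translated_monom contract_sum_left contract_single sum_fun_apply)
    finally show ?thesis using True by simp
  next
    case False
    then show ?thesis
      using gstar_dp_hom[OF homog_dps_dp_hom[of u f], of a] by (simp add: dp_hom_mdeg)
  qed
  have part: "dp_mult (dp_embed (dp_part i f)) (Lp_pow a (u - i)) W =
      (\<Sum>K | K \<le> ?W. if mdeg K = i \<and> mdeg W = u then ?t K else 0)" if "i \<le> u" for i
  proof -
    let ?s = "\<lambda>U. of_nat (\<Prod>v\<in>UNIV. W v choose U v) * dp_embed (dp_part i f) U * Lp_pow a (u - i) (W - U)"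
    have "(\<Sum>U | U \<le> W. ?s U) = (\<Sum>U\<in>case_option 0 ` {K. K \<le> ?W}. ?s U)"
    proof (rule sum.mono_neutral_right)
      show "case_option 0 ` {K. K \<le> ?W} \<subseteq> {U. U \<le> W}"
        by (auto simp: le_fun_def split: option.splits)
      show "\<forall>U\<in>{U. U \<le> W} - case_option 0 ` {K. K \<le> ?W}. ?s U = 0"
      proof
        fix U assume U: "U \<in> {U. U \<le> W} - case_option 0 ` {K. K \<le> ?W}"
        then have "U \<circ> Some \<le> ?W" by (auto simp: le_fun_def)
        with U have "U None \<noteq> 0"
          using case_option_None_Some[of U] by (metis DiffD2 image_eqI mem_Collect_eq)
        then show "?s U = 0" by (simp add: dp_embed_def)
      qed
    qed (rule finite_le_exp)
    also have "\<dots> = (\<Sum>K | K \<le> ?W. ?s (case_option 0 K))"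
      by (rule sum.reindex_cong[OF _ refl refl]) (auto intro!: inj_onI dest: arg_cong[where f = "\<lambda>U. U \<circ> Some"])
    also have "\<dots> = (\<Sum>K | K \<le> ?W. if mdeg K = i \<and> mdeg W = u then ?t K else 0)"
    proof (rule sum.cong[OF refl])
      fix K assume "K \<in> {K. K \<le> ?W}"
      then have "case_option 0 K \<le> W"
        by (auto simp: le_fun_def split: option.splits)
      then have "(W - case_option 0 K) + case_option 0 K = W"
        by (auto simp: le_fun_def fun_eq_iff)
      then have deg: "mdeg (W - case_option 0 K) + mdeg K = mdeg W"
        using mdeg_add[of "W - case_option 0 K" "case_option 0 K"] by simp
      then have "mdeg K = i \<Longrightarrow> mdeg (W - case_option 0 K) = u - i \<longleftrightarrow> mdeg W = u"
        using that by auto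
      then show "?s (case_option 0 K) = (if mdeg K = i \<and> mdeg W = u then ?t K else 0)"
        by (auto simp: dp_embed_def dp_part_def Lp_pow_def prod_UNIV_option algebra_simps)
    qed
    finally show ?thesis by (simp add: dp_mult_def)
  qed
  have "Homog1 f a u W = (\<Sum>i\<le>u. \<Sum>K | K \<le> ?W. if mdeg K = i \<and> mdeg W = u then ?t K else 0)"
    unfolding Homog1_def using part by (simp add: sum_fun_apply)
  also have "\<dots> = (\<Sum>K | K \<le> ?W. \<Sum>i\<le>u. if mdeg K = i \<and> mdeg W = u then ?t K else 0)"
    by (rule sum.swap)
  also have "\<dots> = (\<Sum>K | K \<le> ?W. if mdeg W = u then ?t K else 0)"
  proof (rule sum.cong[OF refl])
    fix K assume "K \<in> {K. K \<le> ?W}"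
    then have "mdeg K \<le> mdeg ?W" by (auto simp: mdeg_def le_fun_def intro: sum_mono)
    then have "mdeg W = u \<Longrightarrow> mdeg K \<le> u" using mdeg_option[of W] by (simp add: comp_def)
    then show "(\<Sum>i\<le>u. if mdeg K = i \<and> mdeg W = u then ?t K else 0) = (if mdeg W = u then ?t K else 0)"
      by (cases "mdeg W = u") auto
  qed
  finally show "Homog1 f a u W = gstar a (homog_dps u f) W"
    by (simp add: right)
qed

section \<open>Ideals and graded primes\<close>

lemma is_ideal_iff:
  "is_ideal I \<longleftrightarrow> 0 \<in> I \<and> (\<forall>x\<in>I. \<forall>y\<in>I. x + y \<in> I) \<and> (\<forall>c. \<forall>x\<in>I. c * x \<in> I)"
  by (simp add: module.subspace_def[OF module_ring])

lemma
  assumes "is_ideal I"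
  shows ideal_0: "0 \<in> I"
    and ideal_add: "x \<in> I \<Longrightarrow> y \<in> I \<Longrightarrow> x + y \<in> I"
    and ideal_mult: "x \<in> I \<Longrightarrow> c * x \<in> I"
  using assms by (auto simp: is_ideal_iff)

lemma ideal_mult_right: "is_ideal I \<Longrightarrow> x \<in> I \<Longrightarrow> x * c \<in> I"
  using ideal_mult[of I x c] by (simp add: mult.commute)

lemma ideal_diff: "is_ideal I \<Longrightarrow> x \<in> I \<Longrightarrow> y \<in> I \<Longrightarrow> x - y \<in> I"
  using ideal_add[of I x "- 1 * y"] ideal_mult[of I y "- 1"] by simp

lemma ideal_sum: "is_ideal I \<Longrightarrow> (\<And>x. x \<in> A \<Longrightarrow> f x \<in> I) \<Longrightarrow> sum f A \<in> I"
  by (induction A rule: infinite_finite_induct) (auto intro: ideal_0 ideal_add)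

lemma ideal_diff_iff: "is_ideal I \<Longrightarrow> x - y \<in> I \<Longrightarrow> x \<in> I \<longleftrightarrow> y \<in> I"
  using ideal_add[of I "x - y" y] ideal_diff[of I x "x - y"] by auto

lemma is_ideal_ideal_gen: "is_ideal (ideal_gen A)"
  by (rule module.subspace_span[OF module_ring])

lemma ideal_gen_base: "x \<in> A \<Longrightarrow> x \<in> ideal_gen A"
  by (rule module.span_base[OF module_ring])

lemma ideal_gen_minimal: "A \<subseteq> I \<Longrightarrow> is_ideal I \<Longrightarrow> ideal_gen A \<subseteq> I"
  by (rule module.span_minimal[OF module_ring])

lemma ideal_gen_mult:
  assumes I: "is_ideal I" and AB: "\<And>x y. x \<in> A \<Longrightarrow> y \<in> B \<Longrightarrow> x * y \<in> I"
    and f: "f \<in> ideal_gen A" and g: "g \<in> ideal_gen B"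
  shows "f * g \<in> I"
proof -
  have colon: "is_ideal {f. \<forall>y\<in>C. f * y \<in> I}" for C
    using I by (auto simp: is_ideal_iff algebra_simps mult.assoc)
  have "ideal_gen A \<subseteq> {f. \<forall>y\<in>B. f * y \<in> I}"
    by (rule ideal_gen_minimal[OF _ colon]) (use AB in auto)
  then have "ideal_gen B \<subseteq> {g. \<forall>x\<in>{f}. g * x \<in> I}"
    by (intro ideal_gen_minimal[OF _ colon]) (use f in \<open>auto simp: mult.commute\<close>)
  with g show ?thesis by (auto simp: mult.commute)
qed

lemma is_ideal_sum_principal:
  assumes "is_ideal I"
  shows "is_ideal {x + r * t | x r. x \<in> I}"
  unfolding is_ideal_iff
proof (intro conjI ballI allI)
  show "0 \<in> {x + r * t | x r. x \<in> I}"
    using ideal_0[OF assms] by (auto intro!: exI[of _ 0])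
next
  fix u v assume "u \<in> {x + r * t | x r. x \<in> I}" "v \<in> {x + r * t | x r. x \<in> I}"
  then obtain x r y s where "u = x + r * t" "v = y + s * t" "x \<in> I" "y \<in> I" by auto
  then have "u + v = (x + y) + (r + s) * t" "x + y \<in> I"
    using ideal_add[OF assms] by (auto simp: algebra_simps)
  then show "u + v \<in> {x + r * t | x r. x \<in> I}" by blast
next
  fix c u assume "u \<in> {x + r * t | x r. x \<in> I}"
  then obtain x r where "u = x + r * t" "x \<in> I" by auto
  then have "c * u = c * x + (c * r) * t" "c * x \<in> I"
    using ideal_mult[OF assms] by (simp_all add: distrib_left mult.assoc)
  then show "c * u \<in> {x + r * t | x r. x \<in> I}" by blast
qed

lemma prime_ideal_one: "prime_ideal P \<Longrightarrow> 1 \<notin> P"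
  using ideal_mult[of P 1] by (auto simp: prime_ideal_def)

lemma prime_ideal_power: "prime_ideal P \<Longrightarrow> f ^ m \<in> P \<Longrightarrow> f \<in> P"
  by (induction m) (auto simp: prime_ideal_one, auto simp: prime_ideal_def)

text \<open>
  An ideal \<open>P\<close> maximal among those that contain no power of \<open>s\<close> is prime: for \<open>f\<close> and \<open>g\<close> outside
  \<open>P\<close>, both \<open>P + (f)\<close> and \<open>P + (g)\<close> contain a power of \<open>s\<close>, and the product of the two powers
  lies in \<open>P + (f g)\<close>.
\<close>

lemma exists_prime_avoiding:
  assumes I: "is_ideal I" and s: "\<And>m. s ^ m \<notin> I"
  obtains P where "prime_ideal P" "I \<subseteq> P" "s \<notin> P"
proof -
  let ?A = "{K. is_ideal K \<and> I \<subseteq> K \<and> (\<forall>m. s ^ m \<notin> K)}"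
  have "\<exists>M\<in>?A. \<forall>X\<in>?A. M \<subseteq> X \<longrightarrow> X = M"
  proof (rule subset_Zorn_nonempty)
    show "?A \<noteq> {}" using I s by blast
  next
    fix C assume C: "C \<noteq> {}" "subset.chain ?A C"
    then have CA: "C \<subseteq> ?A" and lin: "\<And>X Y. X \<in> C \<Longrightarrow> Y \<in> C \<Longrightarrow> X \<subseteq> Y \<or> Y \<subseteq> X"
      by (auto simp: subset.chain_def)
    have "is_ideal (\<Union>C)"
      unfolding is_ideal_iff
    proof (intro conjI ballI allI)
      show "0 \<in> \<Union>C" using C(1) CA ideal_0 by blast
    next
      fix x y assume "x \<in> \<Union>C" "y \<in> \<Union>C"
      then obtain X Y where "X \<in> C" "Y \<in> C" "x \<in> X" "y \<in> Y" by blast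
      then obtain X where "X \<in> C" "x \<in> X" "y \<in> X" using lin by blast
      then show "x + y \<in> \<Union>C" using CA ideal_add by blast
    next
      fix c x assume "x \<in> \<Union>C"
      then show "c * x \<in> \<Union>C" using CA ideal_mult by blast
    qed
    moreover have "I \<subseteq> \<Union>C" using C(1) CA by blast
    ultimately show "\<Union>C \<in> ?A" using CA by blast
  qed
  then obtain P where PA: "P \<in> ?A" and max: "\<forall>X\<in>?A. P \<subseteq> X \<longrightarrow> X = P"
    by (elim bexE)
  from PA have P: "is_ideal P" "I \<subseteq> P" "\<And>m. s ^ m \<notin> P" by auto
  have meets: "\<exists>x r m. x \<in> P \<and> s ^ m = x + r * f" if "f \<notin> P" for f
  proof (rule ccontr)
    assume *: "\<not> ?thesis"
    let ?X = "{x + r * f | x r. x \<in> P}"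
    have PX: "P \<subseteq> ?X"
    proof
      fix x assume "x \<in> P"
      moreover have "x = x + 0 * f" by simp
      ultimately show "x \<in> ?X" by blast
    qed
    then have "?X \<in> ?A" using is_ideal_sum_principal[OF P(1)] P(2) * by blast
    with max have "P \<subseteq> ?X \<longrightarrow> ?X = P" by (rule bspec)
    then have "?X = P" using PX by (rule mp)
    moreover have "0 + 1 * f \<in> ?X" using ideal_0[OF P(1)] by blast
    ultimately show False using that by simp
  qed
  have "prime_ideal P"
    unfolding prime_ideal_def
  proof (intro conjI allI impI)
    show "P \<noteq> UNIV" using P(3)[of 0] by auto
  next
    fix f g assume fg: "f * g \<in> P"
    show "f \<in> P \<or> g \<in> P"
    proof (rule ccontr)
      assume "\<not> ?thesis"
      then have "f \<notin> P" "g \<notin> P" by auto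
      then obtain x r i y t j where *: "x \<in> P" "s ^ i = x + r * f" "y \<in> P" "s ^ j = y + t * g"
        using meets[of f] meets[of g] by blast
      have "s ^ (i + j) = (x + r * f) * (y + t * g)"
        by (simp only: power_add *(2,4))
      also have "\<dots> = (y + t * g) * x + (r * f) * y + (r * t) * (f * g)"
        by (simp add: algebra_simps)
      also have "\<dots> \<in> P"
        by (rule ideal_add[OF P(1) ideal_add[OF P(1) ideal_mult[OF P(1) *(1)]
              ideal_mult[OF P(1) *(3)]] ideal_mult[OF P(1) fg]])
      finally show False using P(3) by blast
    qed
  qed (rule P(1))
  moreover have "s \<notin> P" using P(3)[of 1] by simp
  ultimately show thesis using that P(2) by blast
qed

lemma graded_ideal_is_ideal: "graded_ideal I \<Longrightarrow> is_ideal I"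
  by (simp add: graded_ideal_def)

lemma graded_ideal_poly_part: "graded_ideal I \<Longrightarrow> f \<in> I \<Longrightarrow> poly_part d f \<in> I"
  by (simp add: graded_ideal_def)

lemma ideal_if_poly_parts:
  assumes "is_ideal I" "\<And>d. poly_part d f \<in> I"
  shows "f \<in> I"
proof -
  obtain D where "\<And>U. Poly_Mapping.lookup f U \<noteq> 0 \<Longrightarrow> mdeg U \<le> D"
    by (rule finite_degrees_poly[of f]) blast
  then have "(\<Sum>d\<le>D. poly_part d f) = f" by (rule sum_poly_part)
  moreover have "(\<Sum>d\<le>D. poly_part d f) \<in> I" using assms by (intro ideal_sum)
  ultimately show ?thesis by simp
qed

text \<open>
  For two elements with components outside the prime, the product of the lowest such components is, modulo
  the prime, a component of the product; so the largest graded ideal inside a prime is prime.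
\<close>

lemma prime_graded_core:
  fixes P :: "('v::finite, 'k::comm_ring_1) mpoly set"
  assumes P: "prime_ideal P"
  shows "prime_ideal {f. \<forall>d. poly_part d f \<in> P}"
    and "graded_ideal {f. \<forall>d. poly_part d f \<in> P}"
    and "{f. \<forall>d. poly_part d f \<in> P} \<subseteq> P"
proof -
  let ?C = "{f. \<forall>d. poly_part d f \<in> P}"
  have iP: "is_ideal P" using P by (simp add: prime_ideal_def)
  show sub: "?C \<subseteq> P" using ideal_if_poly_parts[OF iP] by blast
  have iC: "is_ideal ?C"
    unfolding is_ideal_iff
    by (auto simp: poly_part_add poly_part_mult intro!: ideal_0[OF iP] ideal_add[OF iP]
        ideal_sum[OF iP] ideal_mult[OF iP])
  moreover have "poly_part e (poly_part d f) = (if e = d then poly_part d f else 0)" for e d and f :: "('v, 'k) mpoly"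
    by (rule poly_part_homogeneous[OF homogeneous_poly_part])
  ultimately show "graded_ideal ?C"
    by (auto simp: graded_ideal_def ideal_0[OF iP])
  show "prime_ideal ?C"
    unfolding prime_ideal_def
  proof (intro conjI allI impI)
    show "?C \<noteq> UNIV" using prime_ideal_one[OF P] sub by blast
  next
    fix f g assume fg: "f * g \<in> ?C"
    show "f \<in> ?C \<or> g \<in> ?C"
    proof (rule ccontr)
      assume "\<not> ?thesis"
      then have ex: "\<exists>d. poly_part d f \<notin> P" "\<exists>d. poly_part d g \<notin> P" by auto
      define d where "d = (LEAST d. poly_part d f \<notin> P)"
      define e where "e = (LEAST d. poly_part d g \<notin> P)"
      have d: "poly_part d f \<notin> P" "\<And>i. i < d \<Longrightarrow> poly_part i f \<in> P"
        unfolding d_def using LeastI_ex[OF ex(1)] not_less_Least by auto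
      have e: "poly_part e g \<notin> P" "\<And>i. i < e \<Longrightarrow> poly_part i g \<in> P"
        unfolding e_def using LeastI_ex[OF ex(2)] not_less_Least by auto
      have "poly_part (d + e) (f * g) = (\<Sum>i\<in>{..d + e}. poly_part i f * poly_part (d + e - i) g)"
        by (rule poly_part_mult)
      also have "\<dots> = poly_part d f * poly_part e g +
          (\<Sum>i\<in>{..d + e} - {d}. poly_part i f * poly_part (d + e - i) g)"
        by (subst sum.remove[of _ d]) auto
      finally have "poly_part d f * poly_part e g = poly_part (d + e) (f * g) -
          (\<Sum>i\<in>{..d + e} - {d}. poly_part i f * poly_part (d + e - i) g)"
        by (simp add: algebra_simps)
      also have "\<dots> \<in> P"
      proof (intro ideal_diff[OF iP] ideal_sum[OF iP])
        show "poly_part (d + e) (f * g) \<in> P" using fg by simp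
      next
        fix i assume i: "i \<in> {..d + e} - {d}"
        show "poly_part i f * poly_part (d + e - i) g \<in> P"
        proof (cases "i < d")
          case True
          then show ?thesis using d(2) ideal_mult_right[OF iP] by blast
        next
          case False
          with i have "d + e - i < e" by auto
          then show ?thesis using e(2) ideal_mult[OF iP] by blast
        qed
      qed
      finally show False using P d(1) e(1) by (auto simp: prime_ideal_def)
    qed
  qed (rule iC)
qed

text \<open>
  The graded core of a prime over \<open>K\<close>. For \<open>K = I + (t)\<close> with a form \<open>t\<close> this prime contains \<open>t\<close> as
  well as \<open>I\<close>.
\<close>

lemma exists_graded_prime_avoiding:
  assumes "graded_ideal I" "is_ideal K" "I \<subseteq> K" "\<And>m. s ^ m \<notin> K"
  obtains P where "prime_ideal P" "graded_ideal P" "I \<subseteq> P" "s \<notin> P"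
    "\<And>d t. homogeneous d t \<Longrightarrow> t \<in> K \<Longrightarrow> t \<in> P"
proof -
  obtain P where P: "prime_ideal P" "K \<subseteq> P" "s \<notin> P"
    by (rule exists_prime_avoiding[OF assms(2,4)])
  have "0 \<in> P" using P(1) by (simp add: prime_ideal_def ideal_0)
  show thesis
  proof (rule that[of "{f. \<forall>d. poly_part d f \<in> P}"])
    show "I \<subseteq> {f. \<forall>d. poly_part d f \<in> P}"
      using assms(1,3) P(2) by (auto simp: graded_ideal_def)
    show "s \<notin> {f. \<forall>d. poly_part d f \<in> P}"
      using prime_graded_core(3)[OF P(1)] P(3) by blast
    show "t \<in> {f. \<forall>d. poly_part d f \<in> P}" if "homogeneous d t" "t \<in> K" for d t
      using that P(2) \<open>0 \<in> P\<close> by (auto simp: poly_part_homogeneous)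
  qed (rule prime_graded_core[OF P(1)])+
qed

text \<open>A power of an ideal is generated by the monomials in its generators.\<close>

lemma ideal_pow_subset:
  fixes l :: "'v::finite \<Rightarrow> 'a::comm_ring_1"
  assumes I: "is_ideal I" and mono: "\<And>U. mdeg U = N \<Longrightarrow> (\<Prod>v\<in>UNIV. l v ^ U v) \<in> I"
  shows "ideal_pow (ideal_gen (range l)) N \<subseteq> I"
proof -
  let ?G = "\<lambda>N. {(\<Prod>v\<in>UNIV. l v ^ U v) | U. mdeg U = N}"
  have "ideal_pow (ideal_gen (range l)) N \<subseteq> ideal_gen (?G N)"
  proof (induction N)
    case 0
    have "(\<Prod>v\<in>UNIV. l v ^ (0 :: 'v \<Rightarrow> nat) v) \<in> ?G 0"
      by (intro CollectI exI[of _ 0]) simp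
    from ideal_gen_base[OF this] have one: "1 \<in> ideal_gen (?G 0)" by simp
    have "x \<in> ideal_gen (?G 0)" for x
      using ideal_mult[OF is_ideal_ideal_gen one, of x] by simp
    then show ?case by auto
  next
    case (Suc N)
    have "f * g \<in> ideal_gen (?G (Suc N))"
      if "f \<in> ideal_gen (range l)" "g \<in> ideal_gen (?G N)" for f g
    proof (rule ideal_gen_mult[OF is_ideal_ideal_gen _ that])
      fix x y assume "x \<in> range l" "y \<in> ?G N"
      then obtain v U where xy: "x = l v" "y = (\<Prod>v\<in>UNIV. l v ^ U v)" "mdeg U = N" by auto
      then have "x * y = (\<Prod>w\<in>UNIV. l w ^ (unit_exp v + U) w)" "mdeg (unit_exp v + U) = Suc N"
        by (simp_all only: prod_power_add prod_power_unit_exp mdeg_add mdeg_unit_exp)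
      then show "x * y \<in> ideal_gen (?G (Suc N))"
        by (intro ideal_gen_base) blast
    qed
    then show ?case using Suc
      by (auto intro!: ideal_gen_minimal[OF _ is_ideal_ideal_gen])
  qed
  also have "ideal_gen (?G N) \<subseteq> I" by (rule ideal_gen_minimal[OF _ I]) (use mono in auto)
  finally show ?thesis .
qed

lemma prod_power_mem_ideal_pow:
  fixes l :: "'v::finite \<Rightarrow> 'a::comm_ring_1"
  assumes l: "\<And>v. l v \<in> I"
  shows "mdeg U = N \<Longrightarrow> (\<Prod>v\<in>UNIV. l v ^ U v) \<in> ideal_pow I N"
proof (induction N arbitrary: U)
  case (Suc N)
  have "\<exists>v. U v \<noteq> 0"
    by (rule ccontr) (use Suc.prems in \<open>simp add: mdeg_def\<close>)
  then obtain v where v: "U v \<noteq> 0" by blast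
  define W where "W = (\<lambda>w. U w - unit_exp v w)"
  have U: "U = unit_exp v + W" using v by (auto simp: W_def unit_exp_def)
  have "mdeg U = 1 + mdeg W" by (simp only: U mdeg_add mdeg_unit_exp)
  with Suc.prems have "mdeg W = N" by simp
  moreover have "(\<Prod>w\<in>UNIV. l w ^ U w) = l v * (\<Prod>w\<in>UNIV. l w ^ W w)"
    by (simp only: U prod_power_add prod_power_unit_exp)
  ultimately show ?case using Suc.IH[of W] l[of v]
    by (auto intro!: ideal_gen_base)
qed simp

text \<open>Pigeonhole: a monomial of large degree in elements with powers in \<open>I\<close> contains one of these powers.\<close>

lemma prod_power_mem_ideal:
  fixes l :: "'v::finite \<Rightarrow> 'a::comm_ring_1"
  assumes I: "is_ideal I" and l: "\<And>v. l v ^ m v \<in> I" and U: "(\<Sum>v\<in>UNIV. m v) \<le> mdeg U"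
  shows "(\<Prod>v\<in>UNIV. l v ^ U v) \<in> I"
proof -
  have "\<exists>v. m v \<le> U v"
  proof (rule ccontr)
    assume "\<not> ?thesis"
    then have "mdeg U < (\<Sum>v\<in>UNIV. m v)"
      unfolding mdeg_def by (intro sum_strict_mono) (auto simp: not_le)
    with U show False by simp
  qed
  then obtain v where v: "m v \<le> U v" by blast
  have "(\<Prod>v\<in>UNIV. l v ^ U v) = l v ^ U v * (\<Prod>w\<in>UNIV - {v}. l w ^ U w)"
    by (rule prod.remove) auto
  also have "l v ^ U v = l v ^ m v * l v ^ (U v - m v)"
    using v by (simp flip: power_add)
  finally show ?thesis
    using l[of v] by (simp add: mult.assoc ideal_mult_right[OF I])
qed

section \<open>The prime ideal of a point\<close>

text \<open>
  Restriction of a polynomial to the line through \<open>(a_1, ..., a_n, 1)\<close>, as a polynomial in a parameter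
  \<open>t\<close>: \<open>x_i\<close> goes to \<open>a_i t\<close> and \<open>z\<close> to \<open>t\<close>.
\<close>

definition restrict_line :: "('n::finite \<Rightarrow> 'k) \<Rightarrow> ('n option, 'k::comm_ring_1) mpoly \<Rightarrow> nat \<Rightarrow>\<^sub>0 'k" where
  "restrict_line a = mono_ext (Poly_Mapping.single 0)
     (\<lambda>U. Poly_Mapping.single (mdeg U) (\<Prod>i\<in>UNIV. a i ^ U (Some i)))"

lemma ring_map_single_0: "ring_map (Poly_Mapping.single (0 :: nat))"
  by (simp add: ring_map_def single_add mult_single)

lemma ring_map_restrict_line: "ring_map (restrict_line a)"
  unfolding restrict_line_def
  by (rule ring_map_mono_ext[OF ring_map_single_0]) (auto simp: mult_single power_add prod.distrib)

lemma restrict_line_single: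
  "restrict_line a (Poly_Mapping.single U x) = Poly_Mapping.single (mdeg U) (x * (\<Prod>i\<in>UNIV. a i ^ U (Some i)))"
  by (simp add: restrict_line_def mono_ext_single mult_single)

lemma restrict_line_Const: "restrict_line a (Const c) = Poly_Mapping.single 0 c"
  by (simp add: Const_def restrict_line_single)

lemma unit_exp_Some [simp]: "unit_exp None (Some i) = 0" "unit_exp (Some j) (Some i) = unit_exp j i"
  by (simp_all add: unit_exp_def)

lemma restrict_line_z: "restrict_line a (Var None) = Poly_Mapping.single 1 1"
  by (simp add: Var_def monom_def restrict_line_single)

lemma restrict_line_x: "restrict_line a (Var (Some i)) = Poly_Mapping.single 1 (a i)"
  by (simp add: Var_def monom_def restrict_line_single prod_power_unit_exp)

lemma lookup_restrict_line:
  "Poly_Mapping.lookup (restrict_line a r) d = contract r (Lp_pow a d) 0"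
proof (induction r rule: poly_mapping_additive_induct)
  case (2 U x)
  show ?case
    by (simp only: contract_single_zero restrict_line_single Lp_pow_def)
      (simp add: lookup_single when_def)
qed (simp_all add: ring_map_simps[OF ring_map_restrict_line] contract_zero_left contract_add_left lookup_add)

text \<open>The inclusion of \<open>k[t]\<close> that sends the parameter \<open>t\<close> of the line to \<open>z\<close>.\<close>

definition line_poly :: "(nat \<Rightarrow>\<^sub>0 'k::comm_ring_1) \<Rightarrow> ('n option, 'k) mpoly" where
  "line_poly = mono_ext Const (\<lambda>d. Var None ^ d)"

lemma ring_map_line_poly: "ring_map line_poly"
  unfolding line_poly_def by (rule ring_map_mono_ext[OF ring_map_Const]) (auto simp: power_add)

lemma line_poly_single: "line_poly (Poly_Mapping.single d c) = Const c * Var None ^ d"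
  by (simp add: line_poly_def mono_ext_single Const_simps)

text \<open>
  Both sides are ring maps in \<open>r\<close>, so the congruence need only be checked on the variables, where it
  says that \<open>x_i\<close> is congruent to \<open>a_i z\<close>.
\<close>

lemma diff_line_poly_mem: "r - line_poly (restrict_line a r) \<in> proj_point_ideal a"
proof (induction r rule: mpoly_induct)
  let ?P = "proj_point_ideal a"
  have iP: "is_ideal ?P" unfolding proj_point_ideal_def by (rule is_ideal_ideal_gen)
  {
    case (Const c)
    show ?case by (simp add: restrict_line_Const line_poly_single ideal_0[OF iP])
  next
    case (Var v)
    show ?case
    proof (cases v)
      case None
      then show ?thesis by (simp add: restrict_line_z line_poly_single ideal_0[OF iP] Const_simps)
    next
      case (Some i)
      then show ?thesis unfolding proj_point_ideal_def
        by (auto simp: restrict_line_x line_poly_single intro!: ideal_gen_base)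
    qed
  next
    case (add f g)
    from ideal_add[OF iP this] show ?case
      by (simp add: ring_map_add[OF ring_map_line_poly] ring_map_add[OF ring_map_restrict_line] algebra_simps)
  next
    case (mult f g)
    let ?l = "\<lambda>f. line_poly (restrict_line a f)"
    have "f * g - ?l (f * g) = f * (g - ?l g) + ?l g * (f - ?l f)"
      by (simp add: ring_map_mult[OF ring_map_line_poly] ring_map_mult[OF ring_map_restrict_line] algebra_simps)
    also have "\<dots> \<in> ?P" using mult by (intro ideal_add[OF iP] ideal_mult[OF iP])
    finally show ?case .
  }
qed

text \<open>As the kernel of a ring map into the domain \<open>k[t]\<close>, the ideal of a point is visibly prime.\<close>

lemma proj_point_ideal_iff: "r \<in> proj_point_ideal a \<longleftrightarrow> restrict_line a r = 0"
proof
  have "is_ideal {r. restrict_line a r = 0}"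
    by (auto simp: is_ideal_iff ring_map_simps[OF ring_map_restrict_line])
  then have "proj_point_ideal a \<subseteq> {r. restrict_line a r = 0}"
    unfolding proj_point_ideal_def
    by (rule ideal_gen_minimal[rotated])
      (auto simp: ring_map_simps[OF ring_map_restrict_line] restrict_line_x restrict_line_z
        restrict_line_Const mult_single)
  then show "r \<in> proj_point_ideal a \<Longrightarrow> restrict_line a r = 0" by blast
  show "restrict_line a r = 0 \<Longrightarrow> r \<in> proj_point_ideal a"
    using diff_line_poly_mem[of r a] by (simp add: ring_map_0[OF ring_map_line_poly])
qed

text \<open>
  The pairing with \<open>L_p^{[d]}\<close> evaluates the part of degree \<open>d\<close> at the point; this links the ideal of
  the point to inverse systems.
\<close>

lemma proj_point_ideal_iff_contract:
  "r \<in> proj_point_ideal a \<longleftrightarrow> (\<forall>d. contract r (Lp_pow a d) 0 = 0)"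
  by (simp add: proj_point_ideal_iff poly_mapping_eq_iff fun_eq_iff lookup_restrict_line)

lemma z_notin_proj_point_ideal: "Var None \<notin> proj_point_ideal (a :: 'n::finite \<Rightarrow> 'k::comm_ring_1)"
  unfolding proj_point_ideal_iff restrict_line_z
  by (metis lookup_single_eq lookup_zero zero_neq_one)

lemma prime_proj_point_ideal: "prime_ideal (proj_point_ideal (a :: 'n::finite \<Rightarrow> 'k::field))"
  unfolding prime_ideal_def
proof (intro conjI allI impI)
  show "is_ideal (proj_point_ideal a)" unfolding proj_point_ideal_def by (rule is_ideal_ideal_gen)
  show "proj_point_ideal a \<noteq> UNIV" using z_notin_proj_point_ideal by blast
qed (simp add: proj_point_ideal_iff ring_map_mult[OF ring_map_restrict_line])

lemma graded_proj_point_ideal: "graded_ideal (proj_point_ideal a)"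
proof -
  have "contract (poly_part d r) (Lp_pow a e) 0 = (if e = d then contract r (Lp_pow a e) 0 else 0)" for d e r
  proof -
    have "dp_part (mdeg (0 :: 'a option \<Rightarrow> nat) + d) (Lp_pow a e) = (if e = d then Lp_pow a e else 0)"
      by (auto simp: dp_part_def Lp_pow_def fun_eq_iff)
    then show ?thesis by (subst dp_part_conv_contract) (auto simp: contract_def)
  qed
  moreover have "is_ideal (proj_point_ideal a)"
    unfolding proj_point_ideal_def by (rule is_ideal_ideal_gen)
  ultimately show ?thesis
    by (auto simp: graded_ideal_def proj_point_ideal_iff_contract)
qed

lemma x_minus_az_mem: "Var (Some i) - Const (a i) * Var None \<in> proj_point_ideal a"
  unfolding proj_point_ideal_def by (auto intro: ideal_gen_base)

lemma Var_mem_irrelevant: "Var v \<in> irrelevant_ideal"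
  unfolding irrelevant_ideal_def by (auto intro: ideal_gen_base)

lemma is_ideal_irrelevant: "is_ideal irrelevant_ideal"
  unfolding irrelevant_ideal_def by (rule is_ideal_ideal_gen)

section \<open>Ideals of schemes concentrated at a point\<close>

lemma
  assumes "punctual_scheme_ideal a I"
  shows punctual_graded: "graded_ideal I"
    and punctual_is_ideal: "is_ideal I"
    and punctual_saturation: "saturation I = I"
    and punctual_Proj_points: "Proj_points I = {proj_point_ideal a}"
  using assms by (auto simp: punctual_scheme_ideal_def graded_ideal_def)

text \<open>
  Otherwise some graded prime over \<open>I\<close> contains neither \<open>z\<close> nor \<open>x_i - a_i z\<close>; the former makes it a
  point of the scheme, the latter a point different from \<open>p\<close>. The factor \<open>z\<close> becomes \<open>1\<close> in the
  affine chart.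
\<close>

lemma punctual_linear_power:
  assumes I: "punctual_scheme_ideal a I"
  obtains m where "((Var (Some i) - Const (a i) * Var None) * Var None) ^ m \<in> I"
proof (rule ccontr)
  let ?s = "(Var (Some i) - Const (a i) * Var None) * Var None"
  assume "\<not> thesis"
  with that have "\<And>m. ?s ^ m \<notin> I" by blast
  with punctual_graded[OF I] punctual_is_ideal[OF I] order_refl
  obtain P where P: "prime_ideal P" "graded_ideal P" "I \<subseteq> P" "?s \<notin> P"
    by (rule exists_graded_prime_avoiding) blast
  have iP: "is_ideal P" using P(1) by (simp add: prime_ideal_def)
  have "Var None \<notin> P" using P(4) ideal_mult[OF iP] by blast
  then have "P \<in> Proj_points I" using P
    by (auto simp: Proj_points_def dest: subsetD[OF _ Var_mem_irrelevant])
  then have "Var (Some i) - Const (a i) * Var None \<in> P"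
    using punctual_Proj_points[OF I] x_minus_az_mem by auto
  then show False using P(4) ideal_mult_right[OF iP] by blast
qed

text \<open>The hyperplane \<open>z = 0\<close> misses the support, so \<open>I + (z)\<close> has the irrelevant ideal as radical.\<close>

lemma punctual_Var_power:
  assumes I: "punctual_scheme_ideal a I"
  obtains m where "Var v ^ m \<in> {x + r * Var None | x r. x \<in> I}"
proof (rule ccontr)
  let ?K = "{x + r * Var None | x r. x \<in> I}"
  assume "\<not> thesis"
  with that have pow: "\<And>m. Var v ^ m \<notin> ?K" by blast
  have IK: "I \<subseteq> ?K"
  proof
    fix x assume "x \<in> I"
    moreover have "x = x + 0 * Var None" by simp
    ultimately show "x \<in> ?K" by blast
  qed
  obtain P where P: "prime_ideal P" "graded_ideal P" "I \<subseteq> P" "Var v \<notin> P"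
    "\<And>d t. homogeneous d t \<Longrightarrow> t \<in> ?K \<Longrightarrow> t \<in> P"
    by (rule exists_graded_prime_avoiding[OF punctual_graded[OF I]
          is_ideal_sum_principal[OF punctual_is_ideal[OF I]] IK pow]) blast
  have "0 + 1 * Var None \<in> ?K" using ideal_0[OF punctual_is_ideal[OF I]] by blast
  then have "Var None \<in> P" using P(5)[OF homogeneous_Var] by simp
  moreover have "P \<in> Proj_points I" using P
    by (auto simp: Proj_points_def dest: subsetD[OF _ Var_mem_irrelevant])
  ultimately show False using punctual_Proj_points[OF I] z_notin_proj_point_ideal by auto
qed

definition poly_scale :: "'k \<Rightarrow> ('v, 'k::comm_ring_1) mpoly \<Rightarrow> ('v, 'k) mpoly" where
  "poly_scale c f = Const c * f"

interpretation poly_vs: vector_space "poly_scale :: 'k::field \<Rightarrow> ('v, 'k) mpoly \<Rightarrow> ('v, 'k) mpoly"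
  by standard (auto simp: poly_scale_def Const_simps algebra_simps)

text \<open>
  The forms of degree \<open>N\<close> that some power of \<open>z\<close> multiplies into \<open>I\<close> have a finite basis, so a single
  power of \<open>z\<close> works for all of them.
\<close>

lemma uniform_z_power:
  fixes I :: "('n::finite option, 'k::field) mpoly set"
  assumes I: "is_ideal I"
  obtains D where "\<And>s j. homogeneous N s \<Longrightarrow> Var None ^ j * s \<in> I \<Longrightarrow> Var None ^ D * s \<in> I"
proof -
  let ?K = "{s. homogeneous N s \<and> (\<exists>j. Var None ^ j * s \<in> I)}"
  let ?M = "monom ` {U. mdeg U = N} :: ('n option, 'k) mpoly set"
  obtain B where B: "B \<subseteq> ?K" "poly_vs.independent B" "?K \<subseteq> poly_vs.span B"
    by (rule poly_vs.maximal_independent_subset)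
  have "B \<subseteq> poly_vs.span ?M"
  proof
    fix s assume "s \<in> B"
    then have "homogeneous N s" using B(1) by auto
    then show "s \<in> poly_vs.span ?M"
    proof (induction rule: homogeneous_induct)
      case (single U x)
      then have "poly_scale x (monom U) \<in> poly_vs.span ?M"
        by (intro poly_vs.span_scale poly_vs.span_base) auto
      moreover have "poly_scale x (monom U) = Poly_Mapping.single U x"
        by (simp add: single_conv_monom poly_scale_def)
      ultimately show ?case by (simp only:)
    qed (auto intro: poly_vs.span_zero poly_vs.span_add)
  qed
  then have finB: "finite B"
    using poly_vs.independent_span_bound[OF _ B(2)] finite_mdeg_eq by blast
  have "\<forall>s\<in>B. \<exists>j. Var None ^ j * s \<in> I" using B(1) by auto
  then obtain j where j: "\<And>s. s \<in> B \<Longrightarrow> Var None ^ j s * s \<in> I" by metis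
  define D where "D = (\<Sum>s\<in>B. j s)"
  have "poly_vs.span B \<subseteq> {s. Var None ^ D * s \<in> I}"
  proof (rule poly_vs.span_minimal)
    show "B \<subseteq> {s. Var None ^ D * s \<in> I}"
    proof
      fix s assume s: "s \<in> B"
      then have "j s \<le> D" unfolding D_def using finB by (intro member_le_sum) auto
      then have "Var None ^ D * s = Var None ^ (D - j s) * (Var None ^ j s * s)"
        by (simp flip: power_add mult.assoc)
      then show "s \<in> {s. Var None ^ D * s \<in> I}" using j[OF s] ideal_mult[OF I] by simp
    qed
    show "poly_vs.subspace {s. Var None ^ D * s \<in> I}"
      unfolding poly_vs.subspace_def
      using ideal_0[OF I] ideal_add[OF I] ideal_mult[OF I]
      by (auto simp: poly_scale_def distrib_left mult.left_commute[of _ "Const _"])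
  qed
  with B(3) show thesis by (intro that[of D]) blast
qed

text \<open>
  From a degree \<open>N\<close> on, every form of degree \<open>d\<close> is, modulo \<open>I\<close>, \<open>z^{d - N}\<close> times a form of degree
  \<open>N\<close>. Hence a form \<open>f\<close> of large degree with \<open>z f\<close> in \<open>I\<close> comes from a form of degree \<open>N\<close> that a power
  of \<open>z\<close> multiplies into \<open>I\<close>; as a uniform power suffices, \<open>f\<close> is itself in \<open>I\<close>. Saturation extends
  this to all degrees.
\<close>

lemma punctual_z_nonzerodivisor:
  fixes a :: "'n::finite \<Rightarrow> 'k::field"
  assumes pI: "punctual_scheme_ideal a I" and zs: "Var None * s \<in> I"
  shows "s \<in> I"
proof -
  let ?z = "Var None :: ('n option, 'k) mpoly"
  note gI = punctual_graded[OF pI] and I = punctual_is_ideal[OF pI]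
  let ?K = "{x + r * ?z | x r. x \<in> I}"
  have iK: "is_ideal ?K" by (rule is_ideal_sum_principal[OF I])
  have "\<exists>m. Var v ^ m \<in> ?K" for v by (rule punctual_Var_power[OF pI]) blast
  then have "\<exists>m. \<forall>v. Var v ^ m v \<in> ?K" by (intro choice allI)
  then obtain m where "\<forall>v. Var v ^ m v \<in> ?K" by (elim exE)
  then have m: "Var v ^ m v \<in> ?K" for v by (rule spec)
  define N where "N = (\<Sum>v\<in>UNIV. m v)"
  have monom_mem: "monom U \<in> ?K" if "N \<le> mdeg U" for U
    unfolding monom_conv_prod
    by (rule prod_power_mem_ideal[where m = m, OF iK m]) (use that in \<open>simp add: N_def\<close>)
  have form: "r \<in> ?K" if "homogeneous d r" "N \<le> d" for d r
    using that(1)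
  proof (induction rule: homogeneous_induct)
    case (single U x)
    with that(2) have "monom U \<in> ?K" by (intro monom_mem) simp
    then show ?case unfolding single_conv_monom by (rule ideal_mult[OF iK])
  qed (rule ideal_0[OF iK], rule ideal_add[OF iK])
  have reduce: "\<exists>s. homogeneous N s \<and> r - ?z ^ e * s \<in> I" if "homogeneous (N + e) r" for e r
    using that
  proof (induction e arbitrary: r)
    case 0
    then show ?case by (intro exI[of _ r]) (simp add: ideal_0[OF I])
  next
    case (Suc e)
    have "r \<in> ?K" by (rule form[OF Suc.prems le_add1])
    then obtain x t where xt: "r = x + t * ?z" "x \<in> I" by blast
    have "r = poly_part (1 + (N + e)) r"
      by (simp add: poly_part_homogeneous[OF Suc.prems])
    also have "\<dots> = poly_part (1 + (N + e)) x + ?z * poly_part (N + e) t"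
      by (simp only: xt(1) poly_part_add mult.commute[of t] poly_part_mult_homogeneous[OF homogeneous_Var])
    finally have r: "r = poly_part (1 + (N + e)) x + ?z * poly_part (N + e) t" .
    obtain s where s: "homogeneous N s" "poly_part (N + e) t - ?z ^ e * s \<in> I"
      using Suc.IH[OF homogeneous_poly_part] by blast
    have "r - ?z ^ Suc e * s = poly_part (1 + (N + e)) x + ?z * (poly_part (N + e) t - ?z ^ e * s)"
      by (subst r) (simp add: algebra_simps)
    also have "\<dots> \<in> I"
      by (intro ideal_add[OF I] ideal_mult[OF I] s(2) graded_ideal_poly_part[OF gI] xt(2))
    finally show ?case using s(1) by blast
  qed
  obtain D where D: "\<And>s j. homogeneous N s \<Longrightarrow> ?z ^ j * s \<in> I \<Longrightarrow> ?z ^ D * s \<in> I"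
    by (rule uniform_z_power[OF I]) blast
  have "poly_part e s \<in> I" for e
  proof -
    let ?s = "poly_part e s"
    have zs': "?z * ?s \<in> I"
      using graded_ideal_poly_part[OF gI zs, of "1 + e"]
      by (simp only: poly_part_mult_homogeneous[OF homogeneous_Var])
    have "monom U * ?s \<in> I" if "mdeg U = N + D" for U
    proof -
      have "homogeneous (N + (D + e)) (monom U * ?s)"
        using homogeneous_mult[OF homogeneous_monom homogeneous_poly_part, of U e s] that
        by (simp add: add.assoc)
      then obtain t where t: "homogeneous N t" "monom U * ?s - ?z ^ (D + e) * t \<in> I"
        using reduce by blast
      have "?z * (monom U * ?s) \<in> I"
        using ideal_mult[OF I zs', of "monom U"] by (simp add: mult.left_commute)
      moreover have "?z * (monom U * ?s) - ?z ^ Suc (D + e) * t \<in> I"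
        using ideal_mult[OF I t(2), of ?z] by (simp add: algebra_simps)
      ultimately have "?z ^ Suc (D + e) * t \<in> I"
        using ideal_diff_iff[OF I] by blast
      from ideal_mult[OF I D[OF t(1) this], of "?z ^ e"]
      have "?z ^ (D + e) * t \<in> I" by (simp add: power_add algebra_simps)
      then show ?thesis using ideal_diff_iff[OF I t(2)] by blast
    qed
    then have "ideal_pow irrelevant_ideal (N + D) \<subseteq> {h. h * ?s \<in> I}"
      unfolding irrelevant_ideal_def
      by (intro ideal_pow_subset)
        (auto simp: monom_conv_prod is_ideal_iff distrib_right mult.assoc ideal_0[OF I]
          intro: ideal_add[OF I] ideal_mult[OF I])
    then have "?s \<in> saturation I" by (auto simp: saturation_def)
    then show ?thesis by (simp add: punctual_saturation[OF pI])
  qed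
  then show ?thesis by (rule ideal_if_poly_parts[OF I])
qed

lemma dehomogenize_poly_subst: "dehomogenize (poly_subst (\<lambda>i. Var (Some i)) h) = h"
  by (rule ring_map_unique[OF ring_map_comp[OF ring_map_dehomogenize ring_map_poly_subst] ring_map_id])
    (auto simp: poly_subst_Var poly_subst_Const)

lemma is_ideal_dehomogenize:
  assumes "is_ideal I"
  shows "is_ideal (dehomogenize ` I)"
  unfolding is_ideal_iff
proof (intro conjI ballI allI)
  show "0 \<in> dehomogenize ` I"
    using ideal_0[OF assms] ring_map_0[OF ring_map_dehomogenize] by (metis imageI)
next
  fix x y assume "x \<in> dehomogenize ` I" "y \<in> dehomogenize ` I"
  then show "x + y \<in> dehomogenize ` I"
    using ideal_add[OF assms] by (auto simp flip: ring_map_add[OF ring_map_dehomogenize])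
next
  fix c x assume "x \<in> dehomogenize ` I"
  then obtain r where r: "r \<in> I" "x = dehomogenize r" by blast
  have "c * x = dehomogenize (poly_subst (\<lambda>i. Var (Some i)) c * r)"
    by (simp add: r(2) ring_map_mult[OF ring_map_dehomogenize] dehomogenize_poly_subst)
  then show "c * x \<in> dehomogenize ` I" using ideal_mult[OF assms r(1)] by blast
qed

lemma punctual_ideal_pow:
  assumes I: "punctual_scheme_ideal a I"
  obtains N where "ideal_pow (affine_point_ideal a) N \<subseteq> dehomogenize ` I"
proof -
  note J' = is_ideal_dehomogenize[OF punctual_is_ideal[OF I]]
  have "\<exists>m. (Var i - Const (a i)) ^ m \<in> dehomogenize ` I" for i
  proof -
    obtain m where "((Var (Some i) - Const (a i) * Var None) * Var None) ^ m \<in> I"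
      by (rule punctual_linear_power[OF I])
    from imageI[OF this, of dehomogenize] show ?thesis
      by (intro exI[of _ m]) (simp add: ring_map_simps[OF ring_map_dehomogenize])
  qed
  then obtain m where m: "\<And>i. (Var i - Const (a i)) ^ m i \<in> dehomogenize ` I" by metis
  show thesis
  proof (rule that)
    show "ideal_pow (affine_point_ideal a) (\<Sum>i\<in>UNIV. m i) \<subseteq> dehomogenize ` I"
      unfolding affine_point_ideal_def
      by (rule ideal_pow_subset[OF J']) (simp add: prod_power_mem_ideal[OF J' m])
  qed
qed

lemma affine_point_residue:
  fixes h :: "('n::finite, 'k::comm_ring_1) mpoly"
  shows "\<exists>c. h - Const c \<in> affine_point_ideal a"
proof (induction h rule: mpoly_induct)
  let ?M = "affine_point_ideal a"
  have iM: "is_ideal ?M" unfolding affine_point_ideal_def by (rule is_ideal_ideal_gen)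
  {
    case (Const c)
    show ?case by (intro exI[of _ c]) (simp add: ideal_0[OF iM])
  next
    case (Var i)
    show ?case unfolding affine_point_ideal_def
      by (intro exI[of _ "a i"] ideal_gen_base) blast
  next
    case (add f g)
    then obtain c d where "f - Const c \<in> ?M" "g - Const d \<in> ?M" by blast
    from ideal_add[OF iM this] show ?case
      by (intro exI[of _ "c + d"]) (simp add: Const_simps algebra_simps)
  next
    case (mult f g)
    then obtain c d where cd: "f - Const c \<in> ?M" "g - Const d \<in> ?M" by blast
    have "f * g - Const (c * d) = f * (g - Const d) + Const d * (f - Const c)"
      by (simp add: Const_simps algebra_simps)
    also have "\<dots> \<in> ?M" using cd by (intro ideal_add[OF iM] ideal_mult[OF iM])
    finally show ?case by blast
  }
qed

text \<open>
  Elements outside the maximal ideal are already invertible modulo an ideal containing a power of it,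
  so localizing does not enlarge such an ideal.
\<close>

lemma local_kernel_subset:
  fixes a :: "'n::finite \<Rightarrow> 'k::field"
  assumes J: "is_ideal J" and N: "ideal_pow (affine_point_ideal a) N \<subseteq> J"
  shows "local_kernel a J \<subseteq> J"
proof
  let ?M = "affine_point_ideal a"
  have iM: "is_ideal ?M" unfolding affine_point_ideal_def by (rule is_ideal_ideal_gen)
  fix f assume "f \<in> local_kernel a J"
  then obtain s where s: "s \<notin> ?M" "s * f \<in> J" by (auto simp: local_kernel_def)
  obtain c where c: "s - Const c \<in> ?M" using affine_point_residue by blast
  with s(1) have "c \<noteq> 0" by (auto simp: Const_simps)
  have "\<forall>t\<in>ideal_pow ?M (N - k). t * f \<in> J" for k
  proof (induction k)
    case 0
    show ?case using N ideal_mult_right[OF J] by auto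
  next
    case (Suc k)
    show ?case
    proof (cases "k < N")
      case True
      show ?thesis
      proof
        fix t assume t: "t \<in> ideal_pow ?M (N - Suc k)"
        have "N - k = Suc (N - Suc k)" using True by simp
        then have "(s - Const c) * t \<in> ideal_pow ?M (N - k)"
          using c t by (auto intro: ideal_gen_base)
        with Suc have "(s - Const c) * t * f \<in> J" by blast
        from ideal_diff[OF J ideal_mult[OF J s(2), of t] this]
        have "Const c * (t * f) \<in> J" by (simp add: algebra_simps)
        from ideal_mult[OF J this, of "Const (1 / c)"]
        have "Const (1 / c) * Const c * (t * f) \<in> J" by (simp only: mult.assoc)
        moreover have "Const (1 / c) * Const c = (1 :: ('n, 'k) mpoly)"
          using \<open>c \<noteq> 0\<close> by (simp add: Const_def mult_single)
        ultimately show "t * f \<in> J" by simp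
      qed
    qed (use Suc in simp)
  qed
  from this[of N] have "1 * f \<in> J" by (simp del: mult_1_left)
  then show "f \<in> J" by simp
qed

lemma one_notin_affine_point_ideal: "1 \<notin> affine_point_ideal (a :: 'n::finite \<Rightarrow> 'k::comm_ring_1)"
proof
  \<comment> \<open>Evaluation at the point.\<close>
  let ?ev = "mono_ext (\<lambda>c. c) (\<lambda>U. \<Prod>i\<in>UNIV. a i ^ U i)"
  have ev: "ring_map ?ev"
    by (rule ring_map_mono_ext) (auto simp: ring_map_id power_add prod.distrib)
  have "is_ideal {h. ?ev h = 0}"
    by (auto simp: is_ideal_iff ring_map_simps[OF ev])
  then have "affine_point_ideal a \<subseteq> {h. ?ev h = 0}"
    unfolding affine_point_ideal_def
    by (rule ideal_gen_minimal[rotated])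
      (auto simp: ring_map_diff[OF ev] Var_def monom_def Const_def mono_ext_single prod_power_unit_exp)
  moreover assume "1 \<in> affine_point_ideal a"
  ultimately show False using ring_map_1[OF ev] by auto
qed

lemma ideal_pow_antimono: "i \<le> j \<Longrightarrow> ideal_pow I j \<subseteq> ideal_pow I i"
proof (induction j rule: dec_induct)
  case (step j)
  have ideal: "is_ideal (ideal_pow I j)"
    by (cases j) (auto simp: is_ideal_iff[of UNIV] is_ideal_ideal_gen)
  have "ideal_pow I (Suc j) \<subseteq> ideal_pow I j"
    unfolding ideal_pow.simps
    by (rule ideal_gen_minimal[OF _ ideal]) (auto intro: ideal_mult[OF ideal])
  with step show ?case by blast
qed simp

text \<open>
  The powers of the maximal ideal that are nonzero in the local ring are bounded, so the greatest such
  exponent exists and the next power vanishes; since localizing does not enlarge the ideal, it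
  vanishes already in the affine coordinate ring.
\<close>

lemma punctual_socle_degree:
  fixes a :: "'n::finite \<Rightarrow> 'k::field"
  assumes I: "punctual_scheme_ideal a I"
  shows "ideal_pow (affine_point_ideal a) (Suc (socle_degree a (dehomogenize ` I))) \<subseteq> dehomogenize ` I"
proof -
  let ?J = "dehomogenize ` I" and ?M = "affine_point_ideal a"
  note J = is_ideal_dehomogenize[OF punctual_is_ideal[OF I]]
  obtain N where N: "ideal_pow ?M N \<subseteq> ?J" by (rule punctual_ideal_pow[OF I])
  note lk = local_kernel_subset[OF J N]
  have "?J \<subseteq> local_kernel a ?J"
    using one_notin_affine_point_ideal[of a] by (force simp: local_kernel_def)
  then have bound: "i \<le> N" if "\<not> ideal_pow ?M i \<subseteq> local_kernel a ?J" for i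
    using that N ideal_pow_antimono[of N i ?M] by (meson nat_le_linear order_trans)
  show ?thesis
  proof (rule ccontr)
    assume "\<not> ?thesis"
    then have "\<not> ideal_pow ?M (Suc (socle_degree a ?J)) \<subseteq> local_kernel a ?J"
      using lk by blast
    then have "Suc (socle_degree a ?J) \<le> socle_degree a ?J"
      unfolding socle_degree_def[of a ?J] by (rule Greatest_le_nat[where b = N]) (rule bound)
    then show False by simp
  qed
qed

section \<open>Duality for homogenized inverse systems\<close>

lemma exists_separating_functional:
  fixes s :: "'k::field \<Rightarrow> 'b::ab_group_add \<Rightarrow> 'b"
  assumes vs: "vector_space s" and S: "module.subspace s S" and e: "e \<notin> S"
  obtains g where "\<And>x y. g (x + y) = g x + g y" "\<And>c x. g (s c x) = c * g x"
    "\<And>x. x \<in> S \<Longrightarrow> g x = 0" "g e = 1"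
proof -
  interpret V: vector_space s by (rule vs)
  interpret K: vector_space "(*) :: 'k \<Rightarrow> 'k \<Rightarrow> 'k"
    by unfold_locales (simp_all add: algebra_simps)
  interpret P: vector_space_pair s "(*) :: 'k \<Rightarrow> 'k \<Rightarrow> 'k" ..
  obtain B where B: "B \<subseteq> S" "V.independent B" "S \<subseteq> V.span B"
    by (rule V.maximal_independent_subset)
  have "V.span B \<subseteq> S" by (rule V.span_minimal[OF B(1) S])
  then have "V.independent (insert e B)" using e B(2) by (intro V.independent_insertI) auto
  then obtain g where g: "Vector_Spaces.linear s (*) g" "\<forall>x\<in>insert e B. g x = (if x = e then 1 else 0)"
    using P.linear_independent_extend[of "insert e B" "\<lambda>x. if x = e then 1 else 0"] by blast
  interpret g: Vector_Spaces.linear s "(*)" g by (rule g(1))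
  show thesis
  proof (rule that)
    show "g (x + y) = g x + g y" for x y by (rule g.add)
    show "g (s c x) = c * g x" for c x by (rule g.scale)
    show "g e = 1" using g(2) by simp
    fix x assume "x \<in> S"
    then have x: "x \<in> V.span B" using B(3) by blast
    have "g b = 0" if "b \<in> B" for b using g(2) that e B(1) by auto
    from this x show "g x = 0" by (rule g.eq_0_on_span)
  qed
qed

lemma Var_None_power: "Var None ^ m = monom (case_option m (0 :: 'n::finite \<Rightarrow> nat))"
  by (simp add: monom_conv_prod prod_UNIV_option)

text \<open>
  Terms of degree above \<open>u\<close> are kept without any power of \<open>z\<close>, so that setting \<open>z = 1\<close> inverts the
  map for every \<open>u\<close>.
\<close>

definition homog_poly :: "nat \<Rightarrow> ('n::finite, 'k::comm_ring_1) mpoly \<Rightarrow> ('n option, 'k) mpoly" where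
  "homog_poly u = mono_ext Const (\<lambda>K. monom (case_option (u - mdeg K) K))"

lemma homog_poly_zero: "homog_poly u 0 = 0"
  by (simp add: homog_poly_def mono_ext_zero)

lemma homog_poly_add: "homog_poly u (f + g) = homog_poly u f + homog_poly u g"
  unfolding homog_poly_def by (rule mono_ext_add) (auto simp: Const_simps)

lemma homog_poly_sum: "homog_poly u (sum f A) = (\<Sum>x\<in>A. homog_poly u (f x))"
  by (induction A rule: infinite_finite_induct) (auto simp: homog_poly_zero homog_poly_add)

lemma homog_poly_single:
  "homog_poly u (Poly_Mapping.single K x) = Poly_Mapping.single (case_option (u - mdeg K) K) x"
  by (simp add: homog_poly_def mono_ext_single Const_simps flip: single_conv_monom)

lemma dehomogenize_homog_poly: "dehomogenize (homog_poly u h) = h"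
proof (induction h rule: poly_mapping_additive_induct)
  case (2 K x)
  show ?case by (simp add: homog_poly_single dehomogenize_single)
qed (simp_all add: homog_poly_zero homog_poly_add ring_map_simps[OF ring_map_dehomogenize])

lemma homogeneous_homog_poly:
  assumes "\<And>K. Poly_Mapping.lookup h K \<noteq> 0 \<Longrightarrow> mdeg K \<le> u"
  shows "homogeneous u (homog_poly u h)"
  unfolding homog_poly_def mono_ext_def
proof (rule homogeneous_sum)
  fix K assume "K \<in> Poly_Mapping.keys h"
  then have "mdeg K \<le> u" using assms by (simp add: in_keys_iff)
  then show "homogeneous u (Const (Poly_Mapping.lookup h K) * monom (case_option (u - mdeg K) K))"
    by (simp add: homogeneous_single flip: single_conv_monom)
qed

lemma homog_poly_dehomogenize:
  assumes "homogeneous e r" "e \<le> d"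
  shows "homog_poly d (dehomogenize r) = Var None ^ (d - e) * r"
  using assms(1)
proof (induction rule: homogeneous_induct)
  case (single U x)
  have "case_option (d - e) 0 + U = case_option (d - mdeg (U \<circ> Some)) (U \<circ> Some)"
    using single assms(2) mdeg_option[of U] by (auto simp: fun_eq_iff split: option.splits)
  then show ?case
    by (simp only: dehomogenize_single homog_poly_single Var_None_power monom_def mult_single mult_1_left)
qed (simp_all add: homog_poly_zero homog_poly_add ring_map_simps[OF ring_map_dehomogenize] distrib_left)

text \<open>
  Homogenizing an element of the dehomogenized ideal to a sufficiently large degree gives an element of
  \<open>I\<close>; the superfluous powers of \<open>z\<close> can be cancelled.
\<close>

lemma homog_poly_mem:
  assumes gI: "graded_ideal I" and z: "\<And>s. Var None * s \<in> I \<Longrightarrow> s \<in> I"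
    and h: "h \<in> dehomogenize ` I" and u: "\<And>K. Poly_Mapping.lookup h K \<noteq> 0 \<Longrightarrow> mdeg K \<le> u"
  shows "homog_poly u h \<in> I"
proof -
  note I = graded_ideal_is_ideal[OF gI]
  obtain r where r: "r \<in> I" "h = dehomogenize r" using h by blast
  obtain D0 where D0: "\<And>U. Poly_Mapping.lookup r U \<noteq> 0 \<Longrightarrow> mdeg U \<le> D0"
    by (rule finite_degrees_poly[of r]) blast
  define D where "D = max D0 u"
  have "(\<Sum>d\<le>D. poly_part d r) = r"
    by (rule sum_poly_part) (use D0 in \<open>auto simp: D_def intro: le_max_iff_disj[THEN iffD2]\<close>)
  then have "h = (\<Sum>d\<le>D. dehomogenize (poly_part d r))"
    by (simp add: r(2) flip: ring_map_sum[OF ring_map_dehomogenize])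
  then have "homog_poly D h = (\<Sum>d\<le>D. homog_poly D (dehomogenize (poly_part d r)))"
    by (simp only: homog_poly_sum)
  also have "\<dots> = (\<Sum>d\<le>D. Var None ^ (D - d) * poly_part d r)"
    by (rule sum.cong) (auto intro: homog_poly_dehomogenize homogeneous_poly_part)
  also have "\<dots> \<in> I"
    by (intro ideal_sum[OF I] ideal_mult[OF I] graded_ideal_poly_part[OF gI r(1)])
  finally have "homog_poly D h \<in> I" .
  moreover have "homog_poly D h = Var None ^ (D - u) * homog_poly u h"
    using homog_poly_dehomogenize[OF homogeneous_homog_poly[OF u], where d = D]
    by (simp add: D_def dehomogenize_homog_poly)
  moreover have "Var None ^ j * s \<in> I \<Longrightarrow> s \<in> I" for j s
    by (induction j) (auto simp: mult.assoc dest: z)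
  ultimately show ?thesis by metis
qed

text \<open>
  Let \<open>z\<close> be a nonzerodivisor modulo \<open>I\<close> and \<open>J\<close> the dehomogenization of \<open>I\<close>. A form of degree \<open>u\<close>
  annihilated by \<open>I\<close> is a functional on the polynomials of degree at most \<open>u\<close> that vanishes on
  \<open>J\<close>; extending it to a functional on all polynomials vanishing on \<open>J\<close> exhibits it as the
  homogenization of an element of the affine inverse system.
\<close>

lemma global_inverse_dp_hom:
  fixes I :: "('n::finite option, 'k::field) mpoly set"
  assumes gI: "graded_ideal I" and z: "\<And>s. Var None * s \<in> I \<Longrightarrow> s \<in> I"
  shows "global_inverse I \<inter> dp_hom u = homog_dps u ` affine_inverse (dehomogenize ` I)"
proof (intro set_eqI iffI)
  fix F assume "F \<in> homog_dps u ` affine_inverse (dehomogenize ` I)"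
  then obtain f where f: "F = homog_dps u f" "\<And>r. r \<in> I \<Longrightarrow> contract (dehomogenize r) f = 0"
    by (auto simp: affine_inverse_def)
  have "contract r F = 0" if r: "r \<in> I" for r
  proof -
    obtain D where "\<And>U. Poly_Mapping.lookup r U \<noteq> 0 \<Longrightarrow> mdeg U \<le> D"
      by (rule finite_degrees_poly[of r]) blast
    then have rD: "(\<Sum>d\<le>D. poly_part d r) = r" by (rule sum_poly_part)
    have "contract (poly_part d r) F = 0" for d
    proof (cases "d \<le> u")
      case True
      then show ?thesis
        using contract_homog_dps[OF homogeneous_poly_part, of d r "u - d" f]
          f(2)[OF graded_ideal_poly_part[OF gI r]]
        by (simp add: f(1) homog_dps_zero)
    next
      case False
      then show ?thesis
        unfolding f(1) by (intro contract_homog_dps_zero[OF homogeneous_poly_part]) simp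
    qed
    then have "contract (\<Sum>d\<le>D. poly_part d r) F = 0" by (simp only: contract_sum_left sum.neutral_const)
    then show ?thesis by (simp only: rD)
  qed
  moreover have "F \<in> dp_hom u" by (simp add: f(1) homog_dps_dp_hom)
  ultimately show "F \<in> global_inverse I \<inter> dp_hom u"
    by (simp add: global_inverse_def dp_hom_def)
next
  fix F assume "F \<in> global_inverse I \<inter> dp_hom u"
  then have F: "F \<in> dp_hom u" "\<And>r. r \<in> I \<Longrightarrow> contract r F = 0"
    by (auto simp: global_inverse_def)
  note J = is_ideal_dehomogenize[OF graded_ideal_is_ideal[OF gI]]
  let ?J = "dehomogenize ` I"
  let ?f = "\<lambda>K. F (case_option (u - mdeg K) K)"
  have Ff: "F = homog_dps u ?f" by (rule dp_hom_conv_homog_dps[OF F(1)])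
  let ?low = "{h :: ('n, 'k) mpoly. \<forall>K. Poly_Mapping.lookup h K \<noteq> 0 \<longrightarrow> mdeg K \<le> u}"
  let ?\<phi> = "\<lambda>h. contract h ?f 0"
  have \<phi>_J: "?\<phi> h = 0" if h: "h \<in> ?low" "h \<in> ?J" for h
  proof -
    have "homogeneous u (homog_poly u h)" using h(1) by (intro homogeneous_homog_poly) simp
    from contract_homog_dps[OF this, of 0 ?f]
    have "contract (homog_poly u h) F = homog_dps 0 (contract h ?f)"
      by (simp add: dehomogenize_homog_poly flip: Ff)
    moreover have "homog_poly u h \<in> I" using h by (intro homog_poly_mem[OF gI z]) auto
    ultimately have "homog_dps 0 (contract h ?f) = 0" using F(2) by simp
    then show ?thesis using homog_dps_zero_degree[of "contract h ?f"] by simp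
  qed
  have "\<exists>G. (\<forall>h\<in>?J. contract h G = 0) \<and> (\<forall>K. mdeg K \<le> u \<longrightarrow> G K = ?f K)"
  proof (cases "\<forall>K. mdeg K \<le> u \<longrightarrow> ?f K = 0")
    case True
    then show ?thesis by (intro exI[of _ 0]) (auto simp: contract_def fun_eq_iff)
  next
    case False
    then obtain K0 where K0: "mdeg K0 \<le> u" "?f K0 \<noteq> 0" by blast
    \<comment> \<open>A functional that vanishes on the space \<open>S\<close> below and has value 1 at \<open>e\<close> agrees with \<open>\<phi>\<close> in
      low degrees, because a polynomial differs from a multiple of \<open>e\<close> by an element of the kernel of \<open>\<phi>\<close>,
      and it vanishes on \<open>J\<close>.\<close>
    define e :: "('n, 'k) mpoly" where "e = Poly_Mapping.single K0 (1 / ?f K0)"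
    have e: "e \<in> ?low" "?\<phi> e = 1"
      unfolding e_def contract_single_zero using K0 by (auto simp: lookup_single when_def)
    let ?S = "{h + j | h j. h \<in> ?low \<and> ?\<phi> h = 0 \<and> j \<in> ?J}"
    have low_add: "h + h' \<in> ?low" if "h \<in> ?low" "h' \<in> ?low" for h h'
      using that by (auto simp: lookup_add) (metis add_0)
    have \<phi>_add: "?\<phi> (h + h') = ?\<phi> h + ?\<phi> h'" for h h' by (simp add: contract_add_left)
    have \<phi>_scale: "?\<phi> (Const c * h) = c * ?\<phi> h" for c h
      unfolding contract_mult contract_Const dp_scale_def ..
    have low_scale: "Const c * h \<in> ?low" if "h \<in> ?low" for c h
      using that by (auto simp: Const_mult_lookup)
    have S: "poly_vs.subspace ?S"
      unfolding poly_vs.subspace_def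
    proof (intro conjI ballI allI)
      show "0 \<in> ?S" using ideal_0[OF J] by (auto intro!: exI[of _ 0] simp: contract_zero_left)
    next
      fix x y assume "x \<in> ?S" "y \<in> ?S"
      then obtain h j h' j' where *: "x = h + j" "y = h' + j'" "h \<in> ?low" "h' \<in> ?low"
        "?\<phi> h = 0" "?\<phi> h' = 0" "j \<in> ?J" "j' \<in> ?J" by blast
      have "x + y = (h + h') + (j + j')" by (simp add: *)
      moreover have "h + h' \<in> ?low" "?\<phi> (h + h') = 0" "j + j' \<in> ?J"
        using * low_add ideal_add[OF J] by (auto simp only: \<phi>_add add_0)
      ultimately show "x + y \<in> ?S" by blast
    next
      fix c x assume "x \<in> ?S"
      then obtain h j where *: "x = h + j" "h \<in> ?low" "?\<phi> h = 0" "j \<in> ?J" by blast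
      have "poly_scale c x = Const c * h + Const c * j" by (simp add: * poly_scale_def distrib_left)
      moreover have "Const c * h \<in> ?low" "?\<phi> (Const c * h) = 0" "Const c * j \<in> ?J"
        using * low_scale ideal_mult[OF J] by (auto simp only: \<phi>_scale mult_zero_right)
      ultimately show "poly_scale c x \<in> ?S" by blast
    qed
    have "e \<notin> ?S"
    proof
      assume "e \<in> ?S"
      then obtain h j where *: "e = h + j" "h \<in> ?low" "?\<phi> h = 0" "j \<in> ?J" by blast
      have "j = e + Const (- 1) * h" by (simp add: *(1) Const_simps)
      then have "j \<in> ?low" using low_add low_scale e(1) *(2) by blast
      then have "?\<phi> j = 0" using \<phi>_J *(4) by blast
      then show False using e(2) *(3) \<phi>_add[of h j] by (simp flip: *(1))
    qed
    obtain g where g: "\<And>x y. g (x + y) = g x + g y" "\<And>c x. g (poly_scale c x) = c * g x"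
      "\<And>x. x \<in> ?S \<Longrightarrow> g x = 0" "g e = 1"
      by (rule exists_separating_functional[OF poly_vs.vector_space_axioms S \<open>e \<notin> ?S\<close>]) blast
    have gJ: "g j = 0" if "j \<in> ?J" for j
    proof (rule g(3))
      have "j = 0 + j" by simp
      moreover have "0 \<in> ?low" "?\<phi> 0 = 0" by (auto simp: contract_zero_left)
      ultimately show "j \<in> ?S" using that by blast
    qed
    have glow: "g h = ?\<phi> h" if h: "h \<in> ?low" for h
    proof -
      have "h + Const (- ?\<phi> h) * e \<in> ?low" using low_add low_scale h e(1) by blast
      moreover have "?\<phi> (h + Const (- ?\<phi> h) * e) = 0"
        by (simp only: \<phi>_add \<phi>_scale e(2)) simp
      moreover have "h + Const (- ?\<phi> h) * e = (h + Const (- ?\<phi> h) * e) + 0" by simp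
      ultimately have "h + Const (- ?\<phi> h) * e \<in> ?S" using ideal_0[OF J] by blast
      then have "g (h + poly_scale (- ?\<phi> h) e) = 0" unfolding poly_scale_def by (rule g(3))
      then show ?thesis unfolding g(1,2) g(4) by simp
    qed
    let ?G = "\<lambda>K. g (monom K)"
    have contr: "contract h ?G U = g (h * monom U)" for h U
    proof (induction h rule: poly_mapping_additive_induct)
      case 1
      have "g 0 = 0" using g(2)[of 0 0] by simp
      then show ?case by (simp add: contract_zero_left)
    next
      case (2 K x)
      have "Poly_Mapping.single K x * monom U = poly_scale x (monom (U + K))"
        by (simp add: poly_scale_def monom_def mult_single Const_mult_single add.commute)
      then show ?case by (simp only: contract_single g(2))
    next
      case (3 h h')
      then show ?case by (simp add: contract_add_left distrib_right g(1))
    qed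
    have "contract h ?G = 0" if "h \<in> ?J" for h
    proof
      fix U
      have "h * monom U \<in> ?J" using that by (rule ideal_mult_right[OF J])
      then show "contract h ?G U = 0 U" by (simp only: contr gJ zero_fun_apply)
    qed
    moreover have "?G K = ?f K" if "mdeg K \<le> u" for K
    proof -
      have "monom K \<in> ?low" using that by (auto simp: monom_def lookup_single when_def)
      from glow[OF this] show ?thesis
        by (simp only: monom_def contract_single_zero mult_1_left)
    qed
    ultimately show ?thesis by blast
  qed
  then obtain G where G: "G \<in> affine_inverse ?J" "\<And>K. mdeg K \<le> u \<Longrightarrow> G K = ?f K"
    by (auto simp: affine_inverse_def)
  have "F = homog_dps u G" by (subst Ff, rule homog_dps_cong) (simp add: G(2))
  with G(1) show "F \<in> homog_dps u ` affine_inverse ?J" by blast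
qed

section \<open>Transport along the translation\<close>

lemma graded_ideal_gmap:
  assumes "graded_ideal I"
  shows "graded_ideal (gmap a ` I)"
proof -
  note I = graded_ideal_is_ideal[OF assms]
  have "is_ideal (gmap a ` I)"
    unfolding is_ideal_iff
  proof (intro conjI ballI allI)
    show "0 \<in> gmap a ` I"
      using ideal_0[OF I] ring_map_0[OF ring_map_gmap] by (metis imageI)
  next
    fix x y assume "x \<in> gmap a ` I" "y \<in> gmap a ` I"
    then show "x + y \<in> gmap a ` I"
      using ideal_add[OF I] by (auto simp flip: ring_map_add[OF ring_map_gmap])
  next
    fix c x assume "x \<in> gmap a ` I"
    then obtain r where r: "r \<in> I" "x = gmap a r" by blast
    have "c * x = gmap a (gmap (\<lambda>i. - a i) c * r)"
      by (simp add: r(2) ring_map_mult[OF ring_map_gmap] gmap_gmap_uminus)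
    then show "c * x \<in> gmap a ` I" using ideal_mult[OF I r(1)] by blast
  qed
  then show ?thesis
    using assms by (auto simp: graded_ideal_def poly_part_gmap)
qed

lemma gmap_mem_iff: "gmap a r \<in> gmap a ` I \<longleftrightarrow> r \<in> I"
  by (rule inj_image_mem_iff[OF bij_is_inj[OF bij_gmap]])

lemma subset_saturation: "is_ideal I \<Longrightarrow> I \<subseteq> saturation I"
  by (auto simp: saturation_def intro!: exI[of _ 0] ideal_mult)

text \<open>Holds because \<open>g\<close> maps the irrelevant ideal into itself.\<close>

lemma saturation_gmap:
  assumes "graded_ideal I" "saturation I = I"
  shows "saturation (gmap a ` I) = gmap a ` I"
proof
  note I = graded_ideal_is_ideal[OF assms(1)]
  show "saturation (gmap a ` I) \<subseteq> gmap a ` I"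
  proof
    fix f assume "f \<in> saturation (gmap a ` I)"
    then obtain m where m: "\<And>h. h \<in> ideal_pow irrelevant_ideal m \<Longrightarrow> h * f \<in> gmap a ` I"
      by (auto simp: saturation_def)
    define s where "s = gmap (\<lambda>i. - a i) f"
    have f: "f = gmap a s" by (simp add: s_def gmap_gmap_uminus)
    have "monom U * s \<in> I" if U: "mdeg U = m" for U
    proof -
      have "gmap a (Var v) \<in> irrelevant_ideal" for v
        by (cases v) (auto intro: ideal_add[OF is_ideal_irrelevant] ideal_mult[OF is_ideal_irrelevant]
            Var_mem_irrelevant)
      from prod_power_mem_ideal_pow[OF this U]
      have "gmap a (monom U) \<in> ideal_pow irrelevant_ideal m"
        by (simp add: monom_conv_prod ring_map_simps[OF ring_map_gmap])
      from m[OF this] show ?thesis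
        by (simp add: f gmap_mem_iff flip: ring_map_mult[OF ring_map_gmap])
    qed
    then have "ideal_pow irrelevant_ideal m \<subseteq> {h. h * s \<in> I}"
      unfolding irrelevant_ideal_def
      by (intro ideal_pow_subset)
        (auto simp: monom_conv_prod is_ideal_iff distrib_right mult.assoc ideal_0[OF I]
          intro: ideal_add[OF I] ideal_mult[OF I])
    then have "s \<in> saturation I" by (auto simp: saturation_def)
    then show "f \<in> gmap a ` I" using assms(2) f by blast
  qed
  show "gmap a ` I \<subseteq> saturation (gmap a ` I)"
    by (rule subset_saturation[OF graded_ideal_is_ideal[OF graded_ideal_gmap[OF assms(1)]]])
qed

lemma global_inverse_gstar: "global_inverse I = gstar a ` global_inverse (gmap a ` I)"
proof (intro set_eqI iffI)
  fix F assume "F \<in> gstar a ` global_inverse (gmap a ` I)"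
  then show "F \<in> global_inverse I"
    by (auto simp: global_inverse_def contract_gstar gstar_zero gstar_dp_ring)
next
  fix F assume F: "F \<in> global_inverse I"
  let ?G = "gstar (\<lambda>i. - a i) F"
  have FG: "F = gstar a ?G" by (simp only: gstar_gstar_uminus)
  have "contract (gmap a r) ?G = 0" if "r \<in> I" for r
  proof -
    have "gstar a (contract (gmap a r) ?G) = contract r (gstar a ?G)"
      by (rule contract_gstar[symmetric])
    also have "\<dots> = 0" unfolding FG[symmetric] using F that by (simp add: global_inverse_def)
    finally show ?thesis by (simp only: gstar_eq_zero)
  qed
  then have "?G \<in> global_inverse (gmap a ` I)"
    using F by (auto simp: global_inverse_def gstar_dp_ring)
  with FG show "F \<in> gstar a ` global_inverse (gmap a ` I)" by blast
qed

lemma gstar_image_dp_hom: "gstar a ` X \<inter> dp_hom u = gstar a ` (X \<inter> dp_hom u)"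
proof (intro set_eqI iffI)
  fix F assume "F \<in> gstar a ` X \<inter> dp_hom u"
  then obtain G where G: "G \<in> X" "F = gstar a G" "F \<in> dp_hom u" by blast
  then have "G = gstar (\<lambda>i. - a i) F" by (simp only: gstar_uminus_gstar)
  then have "G \<in> dp_hom u" using G(3) by (simp only: gstar_dp_hom)
  then show "F \<in> gstar a ` (X \<inter> dp_hom u)" using G by blast
qed (auto simp: gstar_dp_hom)

text \<open>The change of coordinates \<open>g\<close> moves \<open>p\<close> to the origin, where duality applies, and \<open>g*\<close> moves back.\<close>

theorem punctual_global_inverse:
  fixes a :: "'n::finite \<Rightarrow> 'k::field"
  assumes I: "punctual_scheme_ideal a I"
  shows "global_inverse I \<inter> dp_hom u =
    (\<lambda>f. Homog1 f a u) ` affine_inverse (translate a -` (dehomogenize ` I))"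
proof -
  have z: "s \<in> gmap a ` I" if "Var None * s \<in> gmap a ` I" for s
  proof -
    have "gmap a (Var None * gmap (\<lambda>i. - a i) s) \<in> gmap a ` I"
      using that by (simp add: ring_map_mult[OF ring_map_gmap] gmap_gmap_uminus)
    then have "gmap (\<lambda>i. - a i) s \<in> I"
      unfolding gmap_mem_iff by (rule punctual_z_nonzerodivisor[OF I])
    then have "gmap a (gmap (\<lambda>i. - a i) s) \<in> gmap a ` I" by (rule imageI)
    then show ?thesis by (simp only: gmap_gmap_uminus)
  qed
  have "global_inverse I \<inter> dp_hom u = gstar a ` (global_inverse (gmap a ` I) \<inter> dp_hom u)"
    by (subst global_inverse_gstar) (rule gstar_image_dp_hom)
  also have "\<dots> = gstar a ` homog_dps u ` affine_inverse (dehomogenize ` (gmap a ` I))"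
    by (subst global_inverse_dp_hom[OF graded_ideal_gmap[OF punctual_graded[OF I]] z]) auto
  finally show ?thesis
    by (simp add: image_image vimage_translate_dehomogenize Homog1_conv_gstar)
qed

text \<open>Monomials of degree above the socle degree lie in the translated ideal.\<close>

lemma punctual_affine_inverse_dp_le:
  fixes a :: "'n::finite \<Rightarrow> 'k::field"
  assumes I: "punctual_scheme_ideal a I"
  shows "affine_inverse (translate a -` (dehomogenize ` I)) \<subseteq> dp_le (socle_degree a (dehomogenize ` I))"
proof
  let ?J = "dehomogenize ` I"
  fix f assume f: "f \<in> affine_inverse (translate a -` ?J)"
  show "f \<in> dp_le (socle_degree a ?J)"
  proof (rule dp_leI, rule ccontr)
    fix K assume K: "f K \<noteq> 0" "\<not> mdeg K \<le> socle_degree a ?J"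
    have "Var i - Const (a i) \<in> affine_point_ideal a" for i
      unfolding affine_point_ideal_def by (rule ideal_gen_base) blast
    from prod_power_mem_ideal_pow[OF this refl, where U = K]
    have "translate a (monom K) \<in> ideal_pow (affine_point_ideal a) (mdeg K)"
      by (simp add: monom_conv_prod ring_map_simps[OF ring_map_translate])
    moreover have "ideal_pow (affine_point_ideal a) (mdeg K)
        \<subseteq> ideal_pow (affine_point_ideal a) (Suc (socle_degree a ?J))"
      by (rule ideal_pow_antimono) (use K(2) in simp)
    ultimately have "translate a (monom K) \<in> ?J"
      using punctual_socle_degree[OF I] by blast
    then have "contract (monom K) f = 0" using f by (simp add: affine_inverse_def)
    then have "contract (monom K) f 0 = 0" by simp
    then show False using K(1) by (simp only: contract_monom add_0)
  qed
qed

section \<open>Spaces of homogenizations\<close>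

lemma dp_mult_zero: "dp_mult 0 G = 0"
  by (simp add: dp_mult_def fun_eq_iff)

lemma dp_embed_zero: "dp_embed 0 = 0"
  by (simp add: dp_embed_def fun_eq_iff)

interpretation Homog1_hom: module_hom dp_scale dp_scale "\<lambda>f. Homog1 f a u" for a u
  by unfold_locales
    (simp_all only: Homog1_conv_gstar homog_dps_add homog_dps_dp_scale gstar_add gstar_dp_scale)

lemma Homog_conv_image: "Homog S a u = (\<lambda>f. Homog1 f a u) ` kspace.span S"
  unfolding Homog_def by (rule Homog1_hom.span_image)

lemma kspace_subspace_contraction:
  assumes "contraction.subspace L"
  shows "kspace.subspace L"
  unfolding kspace.subspace_def contract_Const[symmetric]
  using assms by (simp only: contraction.subspace_def) blast

lemma subspace_affine_inverse: "contraction.subspace (affine_inverse J)"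
  unfolding contraction.subspace_def affine_inverse_def
proof (intro conjI ballI allI CollectI)
  fix c x h assume *: "x \<in> {F. \<forall>h\<in>J. contract h F = 0}" "h \<in> J"
  have "contract h (contract c x) = contract c (contract h x)"
    unfolding contract_mult[symmetric] by (simp only: mult.commute)
  also have "\<dots> = 0" using * by (simp add: contract_def fun_eq_iff)
  finally show "contract h (contract c x) = 0" .
qed (auto simp: contract_add_right)

lemma subspace_dp_le: "kspace.subspace (dp_le d :: ('v::finite, 'k::comm_ring_1) dps set)"
  unfolding kspace.subspace_def
proof (intro conjI ballI allI)
  fix x y :: "('v, 'k) dps" assume "x \<in> dp_le d" "y \<in> dp_le d"
  then show "x + y \<in> dp_le d" by (intro dp_leI) (auto simp: dp_le_def, metis add_0)
next
  fix c and x :: "('v, 'k) dps" assume "x \<in> dp_le d"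
  then show "dp_scale c x \<in> dp_le d" by (intro dp_leI) (auto simp: dp_le_def dp_scale_def, metis mult_zero_right)
qed (auto intro: dp_leI)

text \<open>
  The expansion of a form in powers of \<open>L_p\<close> with coefficients in the \<open>X_i\<close> is unique, which makes
  raising the powers of \<open>L_p\<close> the same as homogenizing to a higher degree.
\<close>

lemma raised_power_Homog:
  assumes V: "V \<subseteq> dp_le m"
  shows "raised_power a m (Homog V a m) u = (\<lambda>f. Homog1 f a (m + u)) ` kspace.span V"
proof -
  have span: "kspace.span V \<subseteq> dp_le m" by (rule kspace.span_minimal[OF V subspace_dp_le])
  have expand: "(\<Sum>i\<le>m. dp_mult (dp_embed (w i)) (Lp_pow a (m + j - i))) = Homog1 (\<Sum>i\<le>m. w i) a (m + j)"
    if w: "\<forall>i\<le>m. w i \<in> dp_hom i" for w j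
  proof -
    have part: "dp_part i (\<Sum>i\<le>m. w i) = (if i \<le> m then w i else 0)" for i
    proof
      fix U
      have "w l U = (if l = mdeg U then w l U else 0)" if "l \<le> m" for l
        using w that by (auto simp: dp_hom_mdeg)
      then have "(\<Sum>l\<le>m. w l U) = (\<Sum>l\<le>m. if l = mdeg U then w l U else 0)"
        by (intro sum.cong) auto
      then have "(\<Sum>l\<le>m. w l U) = (if mdeg U \<le> m then w (mdeg U) U else 0)" by simp
      then show "dp_part i (\<Sum>i\<le>m. w i) U = (if i \<le> m then w i else 0) U"
        using w by (auto simp: dp_part_def sum_fun_apply dp_hom_mdeg)
    qed
    show ?thesis
      unfolding Homog1_def part
      by (rule sum.mono_neutral_cong_left) (auto simp: dp_mult_zero dp_embed_zero)
  qed
  show ?thesis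
  proof (intro set_eqI iffI)
    fix F assume "F \<in> raised_power a m (Homog V a m) u"
    then obtain w where w: "\<forall>i\<le>m. w i \<in> dp_hom i"
      "F = (\<Sum>i\<le>m. dp_mult (dp_embed (w i)) (Lp_pow a (m + u - i)))"
      "(\<Sum>i\<le>m. dp_mult (dp_embed (w i)) (Lp_pow a (m - i))) \<in> Homog V a m"
      by (auto simp: raised_power_def)
    let ?f = "\<Sum>i\<le>m. w i"
    have "Homog1 ?f a m \<in> Homog V a m"
      using w(3) expand[OF w(1), of 0] by simp
    then obtain f where f: "f \<in> kspace.span V" "Homog1 ?f a m = Homog1 f a m"
      unfolding Homog_conv_image by blast
    have "?f \<in> dp_le m"
    proof (rule kspace.subspace_sum[OF subspace_dp_le])
      fix i assume "i \<in> {..m}"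
      then have "w i \<in> dp_hom i" using w(1) by simp
      then show "w i \<in> dp_le m" using \<open>i \<in> {..m}\<close> by (intro dp_leI) (auto simp: dp_hom_def)
    qed
    moreover have "homog_dps m ?f = homog_dps m f"
      using f(2) by (simp only: Homog1_conv_gstar gstar_eq_iff)
    moreover have "f \<in> dp_le m" using f(1) span by blast
    ultimately have "?f = f" by (intro homog_dps_inj[of m ?f f])
    then show "F \<in> (\<lambda>f. Homog1 f a (m + u)) ` kspace.span V"
      using f(1) w(2) expand[OF w(1), of u] by auto
  next
    fix F assume "F \<in> (\<lambda>f. Homog1 f a (m + u)) ` kspace.span V"
    then obtain f where f: "f \<in> kspace.span V" "F = Homog1 f a (m + u)" by blast
    let ?w = "\<lambda>i. dp_part i f"
    have w: "\<forall>i\<le>m. ?w i \<in> dp_hom i" by (simp add: dp_part_hom)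
    have "(\<Sum>i\<le>m. ?w i) = f" using f(1) span by (intro sum_dp_part) blast
    then have "F = (\<Sum>i\<le>m. dp_mult (dp_embed (?w i)) (Lp_pow a (m + u - i)))"
      "(\<Sum>i\<le>m. dp_mult (dp_embed (?w i)) (Lp_pow a (m - i))) = Homog1 f a m"
      using expand[OF w, of u] expand[OF w, of 0] f(2) by simp_all
    moreover have "Homog1 f a m \<in> Homog V a m"
      unfolding Homog_conv_image using f(1) by blast
    ultimately show "F \<in> raised_power a m (Homog V a m) u"
      unfolding raised_power_def using w by (intro CollectI exI[of _ ?w]) simp
  qed
qed

lemma contract_Homog1:
  assumes "homogeneous d r"
  shows "contract r (Homog1 f a (u + d)) = Homog1 (contract (dehomogenize (gmap a r)) f) a u"
  unfolding Homog1_conv_gstar contract_gstar contract_homog_dps[OF homogeneous_gmap[OF assms]] ..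

text \<open>
  In coordinates at the origin, forms of degree \<open>m\<close> act on homogenizations through all polynomials of
  degree at most \<open>m\<close>, and the parts of a polynomial of degree above \<open>m\<close> kill \<open>V\<close>.
\<close>

lemma forms_act_raised_power:
  fixes a :: "'n::finite \<Rightarrow> 'k::comm_ring_1"
  assumes V: "V \<subseteq> dp_le m"
  shows "forms_act m (raised_power a m (Homog V a m) u) = (\<lambda>f. Homog1 f a u) ` contraction.span V"
proof -
  let ?L = "contraction.span V"
  have L: "contraction.subspace ?L" by (rule contraction.subspace_span)
  have kL: "kspace.subspace ?L" by (rule kspace_subspace_contraction[OF L])
  have spanL: "kspace.span V \<subseteq> ?L"
    by (rule kspace.span_minimal[OF contraction.span_superset kL])
  let ?A = "{contract r w | r w. homogeneous m r \<and> w \<in> (\<lambda>f. Homog1 f a (m + u)) ` kspace.span V}"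
  have A: "forms_act m (raised_power a m (Homog V a m) u) = kspace.span ?A"
    by (simp add: forms_act_def raised_power_Homog[OF V])
  have "?A \<subseteq> (\<lambda>f. Homog1 f a u) ` ?L"
  proof
    fix F assume "F \<in> ?A"
    then obtain r f where *: "F = contract r (Homog1 f a (u + m))" "homogeneous m r" "f \<in> kspace.span V"
      by (auto simp: add.commute)
    have "contract (dehomogenize (gmap a r)) f \<in> ?L"
      using *(3) spanL by (intro contraction.subspace_scale[OF L]) blast
    then show "F \<in> (\<lambda>f. Homog1 f a u) ` ?L"
      unfolding *(1) contract_Homog1[OF *(2)] by blast
  qed
  then have "kspace.span ?A \<subseteq> (\<lambda>f. Homog1 f a u) ` ?L"
    by (rule kspace.span_minimal[OF _ Homog1_hom.subspace_image[OF kL]])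
  moreover have "(\<lambda>f. Homog1 f a u) ` ?L \<subseteq> kspace.span ?A"
  proof -
    let ?B = "{contract h v | h v. v \<in> V}"
    have "contraction.subspace (kspace.span ?B)"
      unfolding contraction.subspace_def
    proof (intro conjI ballI allI)
      fix c x assume "x \<in> kspace.span ?B"
      then show "contract c x \<in> kspace.span ?B"
      proof (induction rule: kspace.span_induct_alt)
        case base
        then show ?case by (simp add: kspace.span_zero contract_def zero_fun_def[symmetric])
      next
        case (step k b y)
        from step(1) obtain h v where hv: "b = contract h v" "v \<in> V" by blast
        have "contract c b = contract (c * h) v" unfolding hv(1) contract_mult ..
        then have "contract c b \<in> kspace.span ?B"
          using hv(2) by (intro kspace.span_base) blast
        then show ?case unfolding contract_add_right contract_dp_scale
          using step(2) by (intro kspace.span_add kspace.span_scale)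
      qed
    qed (auto intro: kspace.span_zero kspace.span_add)
    moreover have "V \<subseteq> kspace.span ?B"
    proof
      fix v assume "v \<in> V"
      moreover have "v = contract 1 v" by simp
      ultimately show "v \<in> kspace.span ?B" by (intro kspace.span_base) blast
    qed
    ultimately have "?L \<subseteq> kspace.span ?B" by (intro contraction.span_minimal)
    then have "(\<lambda>f. Homog1 f a u) ` ?L \<subseteq> kspace.span ((\<lambda>f. Homog1 f a u) ` ?B)"
      unfolding Homog1_hom.span_image by (rule image_mono)
    also have "\<dots> \<subseteq> kspace.span ?A"
    proof (rule kspace.span_mono, rule subsetI)
      fix F assume "F \<in> (\<lambda>f. Homog1 f a u) ` ?B"
      then obtain h v where hv: "F = Homog1 (contract h v) a u" "v \<in> V" by blast
      define h' where "h' = (\<Sum>d\<le>m. poly_part d h)"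
      have "contract h v = contract h' v"
      proof
        fix U :: "'n \<Rightarrow> nat"
        have *: "dp_part (mdeg U + d) v = (if mdeg U + d \<le> m then dp_part (mdeg U + d) v else 0)" for d
          using V hv(2) by (auto simp: dp_part_def fun_eq_iff dp_le_mdeg)
        obtain D where D: "\<And>U. Poly_Mapping.lookup h U \<noteq> 0 \<Longrightarrow> mdeg U \<le> D"
          by (rule finite_degrees_poly[of h]) blast
        have zero: "contract (poly_part d h) v U = 0" if "m < d" for d
        proof -
          have "dp_part (mdeg U + d) v = 0" using *[of d] that by simp
          then show ?thesis
            by (simp only: dp_part_conv_contract contraction.scale_zero_right zero_fun_apply)
        qed
        have "h = (\<Sum>d\<le>max D m. poly_part d h)"
          by (rule sum_poly_part[symmetric]) (use D in \<open>auto intro: le_max_iff_disj[THEN iffD2]\<close>)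
        then have "contract h v U = contract (\<Sum>d\<le>max D m. poly_part d h) v U" by (rule arg_cong)
        also have "\<dots> = (\<Sum>d\<le>max D m. contract (poly_part d h) v U)"
          by (simp only: contract_sum_left sum_fun_apply)
        also have "\<dots> = (\<Sum>d\<le>m. contract (poly_part d h) v U)"
          by (rule sum.mono_neutral_right) (auto simp: zero)
        also have "\<dots> = contract h' v U"
          by (simp only: h'_def contract_sum_left sum_fun_apply)
        finally show "contract h v U = contract h' v U" .
      qed
      define r where "r = gmap (\<lambda>i. - a i) (homog_poly m h')"
      have r: "homogeneous m r"
        unfolding r_def
        by (intro homogeneous_gmap homogeneous_homog_poly)
          (auto simp: h'_def lookup_sum lookup_poly_part split: if_splits)
      have "dehomogenize (gmap a r) = h'"
        by (simp add: r_def gmap_gmap_uminus dehomogenize_homog_poly)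
      then have "F = contract r (Homog1 v a (m + u))"
        using contract_Homog1[OF r, of v a u] \<open>contract h v = contract h' v\<close> hv(1)
        by (simp add: add.commute)
      then show "F \<in> ?A" using r kspace.span_base[OF hv(2)] by blast
    qed
    finally show ?thesis .
  qed
  ultimately show ?thesis using A by blast
qed

section \<open>Annihilators of inverse systems\<close>

definition annihilator :: "('v, 'k::comm_ring_1) dps set \<Rightarrow> ('v, 'k) mpoly set" where
  "annihilator L = {r. \<forall>F\<in>L. contract r F = 0}"

lemma is_ideal_annihilator: "is_ideal (annihilator L)"
  unfolding is_ideal_iff
proof (intro conjI ballI allI)
  fix c r assume r: "r \<in> annihilator L"
  show "c * r \<in> annihilator L"
    unfolding annihilator_def
  proof (intro CollectI ballI)
    fix F assume "F \<in> L"
    then have "contract r F = 0" using r by (simp add: annihilator_def)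
    then show "contract (c * r) F = 0" by (simp only: contract_mult contraction.scale_zero_right)
  qed
qed (auto simp: annihilator_def contract_zero_left contract_add_left)

lemma graded_annihilator:
  fixes L :: "('v::finite, 'k::comm_ring_1) dps set"
  assumes "\<And>F d. F \<in> L \<Longrightarrow> dp_part d F \<in> L"
  shows "graded_ideal (annihilator L)"
  unfolding graded_ideal_def
proof (intro conjI ballI allI is_ideal_annihilator)
  fix r d assume r: "r \<in> annihilator L"
  show "poly_part d r \<in> annihilator L"
    unfolding annihilator_def
  proof (intro CollectI ballI ext)
    fix F and U :: "'v \<Rightarrow> nat" assume "F \<in> L"
    then have "contract r (dp_part (mdeg U + d) F) = 0"
      using r assms by (simp add: annihilator_def)
    then show "contract (poly_part d r) F U = 0 U" by (simp only: dp_part_conv_contract)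
  qed
qed

lemma contract_eq_zero_if_parts:
  assumes "F \<in> dp_ring" "\<And>e. contract r (dp_part e F) = 0"
  shows "contract r F = 0"
proof -
  obtain D where "F \<in> dp_le D" by (rule dp_ring_le[OF assms(1)])
  then have "contract r F = contract r (\<Sum>e\<le>D. dp_part e F)" by (simp only: sum_dp_part)
  also have "\<dots> = 0" by (simp only: contract_sum_right assms(2) sum.neutral_const)
  finally show ?thesis .
qed

interpretation dps_vs: vector_space "dp_scale :: 'k::field \<Rightarrow> ('v, 'k) dps \<Rightarrow> ('v, 'k) dps"
  by standard (auto simp: dp_scale_def fun_eq_iff algebra_simps)

text \<open>
  Macaulay duality. A form \<open>G\<close> of degree \<open>d\<close> outside \<open>L\<close> is separated from \<open>L\<close> by a functional; on
  forms of degree \<open>d\<close> it is the pairing with some polynomial of degree \<open>d\<close>, which annihilates \<open>L\<close> because \<open>L\<close> is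
  closed under contraction, but does not annihilate \<open>G\<close>.
\<close>

lemma global_inverse_annihilator:
  fixes L :: "('v::finite, 'k::field) dps set"
  assumes L: "inverse_system L"
  shows "global_inverse (annihilator L) = L"
proof
  have LR: "L \<subseteq> dp_ring" and sub: "contraction.subspace L" and part: "\<And>F d. F \<in> L \<Longrightarrow> dp_part d F \<in> L"
    using L by (auto simp: inverse_system_def)
  show "L \<subseteq> global_inverse (annihilator L)"
    using LR by (auto simp: global_inverse_def annihilator_def)
  have "dp_part d F \<in> L" if F: "F \<in> global_inverse (annihilator L)" for F d
  proof (rule ccontr)
    assume notin: "dp_part d F \<notin> L"
    let ?S = "L \<inter> dp_hom d"
    have hom_sub: "kspace.subspace (dp_hom d :: ('v, 'k) dps set)"
      unfolding kspace.subspace_def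
      by (auto simp: dp_scale_def dp_hom_mdeg intro!: dp_homI) (metis add_0 dp_hom_mdeg)+
    have S: "kspace.subspace ?S"
      by (rule kspace.subspace_inter[OF kspace_subspace_contraction[OF sub] hom_sub])
    have "dp_part d F \<notin> ?S" using notin by simp
    then obtain \<phi> where \<phi>: "\<And>x y. \<phi> (x + y) = \<phi> x + \<phi> y" "\<And>c x. \<phi> (dp_scale c x) = c * \<phi> x"
      "\<And>x. x \<in> ?S \<Longrightarrow> \<phi> x = 0" "\<phi> (dp_part d F) = 1"
      by (rule exists_separating_functional[OF dps_vs.vector_space_axioms S]) blast
    let ?D = "{U :: 'v \<Rightarrow> nat. mdeg U = d}"
    define r where "r = (\<Sum>U\<in>?D. Poly_Mapping.single U (\<phi> (dp_monom U)))"
    have \<phi>_0: "\<phi> 0 = 0" using \<phi>(2)[of 0 0] by simp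
    have \<phi>_sum: "\<phi> (\<Sum>U\<in>A. f U) = (\<Sum>U\<in>A. \<phi> (f U))" for A and f :: "('v \<Rightarrow> nat) \<Rightarrow> ('v, 'k) dps"
      by (induction A rule: infinite_finite_induct) (simp_all only: \<phi>_0 \<phi>(1) sum.infinite sum.empty sum.insert not_False_eq_True)
    have pairing: "contract r H 0 = \<phi> H" if "H \<in> dp_hom d" for H
    proof -
      have "H = (\<Sum>U\<in>?D. dp_scale (H U) (dp_monom U))"
      proof
        fix W
        have "(\<Sum>U\<in>?D. dp_scale (H U) (dp_monom U)) W = (\<Sum>U\<in>?D. if U = W then H U else 0)"
          by (simp add: sum_fun_apply) (rule sum.cong, auto simp: dp_scale_def dp_monom_def)
        also have "\<dots> = (if W \<in> ?D then H W else 0)"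
          by (rule sum.delta[OF finite_mdeg_eq])
        finally show "H W = (\<Sum>U\<in>?D. dp_scale (H U) (dp_monom U)) W"
          using dp_hom_mdeg[OF that] by auto
      qed
      then have "\<phi> H = \<phi> (\<Sum>U\<in>?D. dp_scale (H U) (dp_monom U))" by (rule arg_cong)
      also have "\<dots> = (\<Sum>U\<in>?D. \<phi> (dp_monom U) * H U)" by (simp only: \<phi>_sum \<phi>(2) mult.commute)
      also have "\<dots> = contract r H 0"
        by (simp only: r_def contract_sum_left sum_fun_apply contract_single_zero)
      finally show ?thesis by (rule sym)
    qed
    have "homogeneous d r" unfolding r_def by (intro homogeneous_sum homogeneous_single) simp
    then have r: "poly_part d r = r" by (simp add: poly_part_homogeneous)
    have pairing_part: "contract r H 0 = \<phi> (dp_part d H)" for H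
    proof -
      have "contract r H 0 = contract (poly_part d r) H 0" by (simp only: r)
      also have "\<dots> = contract r (dp_part d H) 0"
        by (simp only: dp_part_conv_contract mdeg_zero add_0)
      also have "\<dots> = \<phi> (dp_part d H)" by (rule pairing[OF dp_part_hom])
      finally show ?thesis .
    qed
    have "r \<in> annihilator L"
      unfolding annihilator_def
    proof (intro CollectI ballI ext)
      fix H W assume H: "H \<in> L"
      have "contract r H W = contract (monom W * r) H 0" by (rule contract_at)
      also have "\<dots> = contract r (contract (monom W) H) 0"
        by (simp only: contract_mult mult.commute[of "monom W"])
      also have "\<dots> = \<phi> (dp_part d (contract (monom W) H))" by (rule pairing_part)
      also have "\<dots> = 0"
        using part[OF contraction.subspace_scale[OF sub H]] dp_part_hom by (intro \<phi>(3)) blast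
      finally show "contract r H W = 0 W" by simp
    qed
    then have "contract r F = 0" using F by (simp add: global_inverse_def)
    then have "contract r F 0 = 0" by simp
    then show False using \<phi>(4) by (simp only: pairing_part) simp
  qed
  then show "global_inverse (annihilator L) \<subseteq> L"
  proof (intro subsetI)
    fix F assume parts: "\<And>F d. F \<in> global_inverse (annihilator L) \<Longrightarrow> dp_part d F \<in> L"
      and F: "F \<in> global_inverse (annihilator L)"
    obtain D where "F \<in> dp_le D" using F by (auto simp: global_inverse_def elim: dp_ring_le)
    then have "F = (\<Sum>d\<le>D. dp_part d F)" by (simp only: sum_dp_part)
    also have "\<dots> \<in> L" by (intro contraction.subspace_sum[OF sub] parts F)
    finally show "F \<in> L" .
  qed
qed

section \<open>Recovering the scheme from its inverse system\<close>

lemma dp_monom_zero_mult: "dp_mult (dp_monom 0) G = G"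
proof
  fix W
  have "dp_mult (dp_monom 0) G W = (\<Sum>U\<in>{0}. of_nat (\<Prod>v\<in>UNIV. W v choose U v) * dp_monom 0 U * G (W - U))"
    unfolding dp_mult_def
    by (rule sum.mono_neutral_right[OF finite_le_exp]) (auto simp: dp_monom_def le_fun_def)
  then show "dp_mult (dp_monom 0) G W = G W"
    by (simp add: dp_monom_def)
qed

lemma dp_mult_dp_monom_zero: "dp_mult F (dp_monom 0) = F"
proof
  fix W
  have "dp_mult F (dp_monom 0) W = (\<Sum>U\<in>{W}. of_nat (\<Prod>v\<in>UNIV. W v choose U v) * F U * dp_monom 0 (W - U))"
    unfolding dp_mult_def
    by (rule sum.mono_neutral_right[OF finite_le_exp])
      (auto simp: dp_monom_def le_fun_def fun_eq_iff, metis le_antisym)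
  then show "dp_mult F (dp_monom 0) W = F W"
    by (simp add: dp_monom_def)
qed

lemma dp_embed_dp_monom: "dp_embed (dp_monom K) = dp_monom (case_option 0 K)"
  by (auto simp: dp_embed_def dp_monom_def fun_eq_iff split: option.splits)

lemma homog_dps_dp_monom:
  assumes "mdeg K \<le> u"
  shows "homog_dps u (dp_monom K) = dp_monom (case_option (u - mdeg K) K)"
proof
  fix U
  have "mdeg U = u \<and> U \<circ> Some = K \<longleftrightarrow> U = case_option (u - mdeg K) K"
    using assms mdeg_option[of U] case_option_None_Some[of U] by auto
  then show "homog_dps u (dp_monom K) U = dp_monom (case_option (u - mdeg K) K) U"
    by (auto simp: homog_dps_def dp_monom_def)
qed

lemma dp_part_dp_monom: "dp_part i (dp_monom K) = (if i = mdeg K then dp_monom K else 0)"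
  by (rule ext) (auto simp: dp_part_def dp_monom_def)

lemma Homog1_dp_monom:
  assumes "mdeg K \<le> u"
  shows "Homog1 (dp_monom K) a u = dp_mult (dp_monom (case_option 0 K)) (Lp_pow a (u - mdeg K))"
proof -
  have "Homog1 (dp_monom K) a u =
      (\<Sum>i\<le>u. if i = mdeg K then dp_mult (dp_embed (dp_monom K)) (Lp_pow a (u - i)) else 0)"
    unfolding Homog1_def dp_part_dp_monom
    by (rule sum.cong) (auto simp: dp_embed_zero dp_mult_zero)
  then show ?thesis using assms by (simp add: dp_embed_dp_monom)
qed

lemma case_option_zero: "case_option 0 (0 :: 'n \<Rightarrow> nat) = 0"
  by (auto simp: fun_eq_iff split: option.splits)

lemma Homog1_one: "Homog1 (dp_monom 0) a u = Lp_pow a u"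
  by (simp add: Homog1_dp_monom case_option_zero dp_monom_zero_mult)

lemma Lp_pow_zero: "Lp_pow a 0 = dp_monom 0"
proof
  fix U :: "'a option \<Rightarrow> nat"
  have "mdeg U = 0 \<longleftrightarrow> U = 0" by (auto simp: mdeg_def fun_eq_iff)
  then show "Lp_pow a 0 U = dp_monom 0 U" by (auto simp: Lp_pow_def dp_monom_def)
qed

lemma gstar_Z:
  fixes a :: "'n::finite \<Rightarrow> 'k::comm_ring_1"
  shows "gstar a (dp_monom (unit_exp None)) = Lp_pow a 1"
proof -
  have "case_option 1 (0 :: 'n \<Rightarrow> nat) = unit_exp None"
    by (auto simp: fun_eq_iff unit_exp_def split: option.splits)
  then have "homog_dps 1 (dp_monom (0 :: 'n \<Rightarrow> nat)) = (dp_monom (unit_exp None) :: ('n option, 'k) dps)"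
    by (subst homog_dps_dp_monom) auto
  then show ?thesis using Homog1_one[of a 1] by (simp only: Homog1_conv_gstar)
qed

lemma gstar_X:
  fixes a :: "'n::finite \<Rightarrow> 'k::comm_ring_1"
  shows "gstar a (dp_monom (unit_exp (Some i))) = dp_monom (unit_exp (Some i))"
proof -
  have *: "case_option 0 (unit_exp i) = unit_exp (Some i)"
    by (auto simp: fun_eq_iff unit_exp_def split: option.splits)
  have "Homog1 (dp_monom (unit_exp i)) a 1 = dp_monom (unit_exp (Some i))"
    by (subst Homog1_dp_monom) (auto simp: * Lp_pow_zero dp_mult_dp_monom_zero)
  moreover have "homog_dps 1 (dp_monom (unit_exp i)) = (dp_monom (unit_exp (Some i)) :: ('n option, 'k) dps)"
    by (subst homog_dps_dp_monom) (auto simp: *)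
  ultimately show ?thesis by (simp only: Homog1_conv_gstar)
qed

lemma contract_homogeneous_eq_zero:
  assumes "homogeneous d h" "d > m" "f \<in> dp_le m"
  shows "contract h f = 0"
  using assms(1)
proof (induction rule: homogeneous_induct)
  case (single K x)
  have "f (U + K) = 0" for U by (rule dp_le_mdeg[OF assms(3)]) (use single assms(2) in simp)
  then show ?case by (simp add: contract_single fun_eq_iff)
qed (auto simp: contract_zero_left contract_add_left)

lemma power_mem_ideal_pow: "f \<in> I \<Longrightarrow> f ^ m \<in> ideal_pow I m"
  by (induction m) (auto intro!: ideal_gen_base)

text \<open>
  Let \<open>L\<close> consist of homogenizations of elements of bounded degree. Its annihilator is saturated because \<open>z\<close>
  only lowers the degree of a homogenization, so that every element of \<open>L\<close> is \<open>z^j\<close> applied to another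
  one. Its only point is \<open>p\<close>: powers of the \<open>x_i - a_i z\<close> annihilate \<open>L\<close> because degrees in \<open>M\<close> are
  bounded, and every element of the annihilator vanishes at \<open>p\<close> because the \<open>L_p^{[d]}\<close> lie in \<open>L\<close>.
\<close>

theorem punctual_annihilator:
  fixes a :: "'n::finite \<Rightarrow> 'k::field"
  assumes L: "inverse_system L" "L \<noteq> {0}"
    and M: "M \<subseteq> dp_le m" and LM: "\<And>i. L \<inter> dp_hom i = (\<lambda>f. Homog1 f a i) ` M"
  shows "punctual_scheme_ideal a (annihilator L)"
proof -
  let ?z = "Var None :: ('n option, 'k) mpoly"
  let ?I = "annihilator L"
  have LR: "L \<subseteq> dp_ring" and sub: "contraction.subspace L" and part: "\<And>F d. F \<in> L \<Longrightarrow> dp_part d F \<in> L"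
    using L(1) by (auto simp: inverse_system_def)
  have gI: "graded_ideal ?I" by (rule graded_annihilator) (rule part)
  note I = is_ideal_annihilator[of L]
  have annI: "r \<in> ?I" if "\<And>f e. f \<in> M \<Longrightarrow> contract r (Homog1 f a e) = 0" for r
    unfolding annihilator_def
  proof (intro CollectI ballI)
    fix F assume F: "F \<in> L"
    have parts: "contract r (dp_part e F) = 0" for e
    proof -
      have "dp_part e F \<in> L \<inter> dp_hom e" using part[OF F] dp_part_hom by blast
      then obtain f where "f \<in> M" "dp_part e F = Homog1 f a e" unfolding LM by blast
      then show ?thesis by (simp only: that)
    qed
    have "F \<in> dp_ring" using LR F by blast
    then show "contract r F = 0" by (rule contract_eq_zero_if_parts) (rule parts)
  qed
  have memL: "Homog1 f a e \<in> L" if "f \<in> M" for f e using LM[of e] that by blast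
  have zpow: "Homog1 f a e = contract (?z ^ j) (Homog1 f a (e + j))" for f e j
  proof -
    have "homogeneous j (?z ^ j)" using homogeneous_power[OF homogeneous_Var, of j None] by simp
    moreover have "dehomogenize (gmap a (?z ^ j)) = 1"
      by (simp add: ring_map_power[OF ring_map_gmap] ring_map_power[OF ring_map_dehomogenize])
    ultimately show ?thesis by (subst contract_Homog1) auto
  qed
  have sat: "saturation ?I = ?I"
  proof
    show "?I \<subseteq> saturation ?I" by (rule subset_saturation[OF I])
    show "saturation ?I \<subseteq> ?I"
    proof
      fix r assume "r \<in> saturation ?I"
      then obtain j where j: "\<And>h. h \<in> ideal_pow irrelevant_ideal j \<Longrightarrow> h * r \<in> ?I"
        by (auto simp: saturation_def)
      have "?z ^ j * r \<in> ?I" by (rule j[OF power_mem_ideal_pow[OF Var_mem_irrelevant]])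
      then have zr: "contract (?z ^ j * r) F = 0" if "F \<in> L" for F
        using that by (auto simp: annihilator_def)
      show "r \<in> ?I"
      proof (rule annI)
        fix f e assume "f \<in> M"
        have "contract r (Homog1 f a e) = contract r (contract (?z ^ j) (Homog1 f a (e + j)))"
          by (subst zpow[of f e j]) (rule refl)
        also have "\<dots> = contract (?z ^ j * r) (Homog1 f a (e + j))"
          unfolding contract_mult[symmetric] by (simp only: mult.commute)
        also have "\<dots> = 0" by (rule zr[OF memL[OF \<open>f \<in> M\<close>]])
        finally show "contract r (Homog1 f a e) = 0" .
      qed
    qed
  qed
  have lin: "(Var (Some i) - Const (a i) * ?z) ^ Suc m \<in> ?I" for i
  proof (rule annI)
    fix f e assume f: "f \<in> M"
    have hom: "homogeneous (Suc m) (Var v ^ Suc m)" for v :: "'v::finite"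
      using homogeneous_power[OF homogeneous_Var, of "Suc m" v] by simp
    have g: "gmap a ((Var (Some i) - Const (a i) * ?z) ^ Suc m) = Var (Some i) ^ Suc m"
      by (simp add: ring_map_simps[OF ring_map_gmap])
    have "contract (Var (Some i) ^ Suc m) (homog_dps e f) = 0"
    proof (cases "e < Suc m")
      case True
      then show ?thesis by (rule contract_homog_dps_zero[OF hom])
    next
      case False
      have "contract (Var i ^ Suc m) f = 0"
        by (rule contract_homogeneous_eq_zero[OF hom lessI]) (use f M in auto)
      moreover have "dehomogenize (Var (Some i) ^ Suc m) = (Var i ^ Suc m :: ('n, 'k) mpoly)"
        by (simp only: ring_map_power[OF ring_map_dehomogenize] dehomogenize_simps)
      moreover have "e = (e - Suc m) + Suc m" using False by simp
      ultimately show ?thesis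
        using contract_homog_dps[OF hom, of "Some i" "e - Suc m" f] by (simp only: homog_dps_zero)
    qed
    then show "contract ((Var (Some i) - Const (a i) * ?z) ^ Suc m) (Homog1 f a e) = 0"
      by (simp only: Homog1_conv_gstar contract_gstar g gstar_zero)
  qed
  have Lp: "Lp_pow a d \<in> L" for d
  proof -
    have "0 \<in> L" by (rule contraction.subspace_0[OF sub])
    with L(2) obtain F where F: "F \<in> L" "F \<noteq> 0" by blast
    then obtain W where W: "F W \<noteq> 0" by (auto simp: fun_eq_iff)
    have "dp_part (mdeg W) F \<in> L \<inter> dp_hom (mdeg W)" using part[OF F(1)] dp_part_hom by blast
    then obtain f where f: "f \<in> M" "dp_part (mdeg W) F = Homog1 f a (mdeg W)"
      unfolding LM by blast
    have "f \<noteq> 0"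
    proof
      assume "f = 0"
      then have "dp_part (mdeg W) F = 0" using f(2) by (simp only: Homog1_hom.zero)
      then have "dp_part (mdeg W) F W = 0" by simp
      with W show False by (simp add: dp_part_def)
    qed
    then obtain U0 where U0: "f U0 \<noteq> 0" by (auto simp: fun_eq_iff)
    have "f \<in> dp_le m" using f(1) M by blast
    then have "\<forall>U. f U \<noteq> 0 \<longrightarrow> mdeg U < Suc m" by (auto simp: dp_le_def less_Suc_eq_le)
    then obtain U where U: "f U \<noteq> 0" "\<And>K. f K \<noteq> 0 \<Longrightarrow> mdeg K \<le> mdeg U"
      using ex_has_greatest_nat[of "\<lambda>U. f U \<noteq> 0" U0 mdeg "Suc m"] U0 by blast
    \<comment> \<open>Contracting by a monomial of top degree in \<open>f\<close> leaves a constant.\<close>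
    have top: "contract (monom U) f = dp_scale (f U) (dp_monom 0)"
    proof
      fix K
      have "f (K + U) = 0" if "K \<noteq> 0"
      proof (rule ccontr)
        assume "f (K + U) \<noteq> 0"
        then have "mdeg K = 0" using U(2)[of "K + U"] by simp
        with that show False by (auto simp: mdeg_def fun_eq_iff)
      qed
      moreover have "contract (monom U) f K = f (K + U)" by (simp only: contract_monom)
      moreover have "dp_scale (f U) (dp_monom 0) K = (if K = 0 then f U else 0)"
        by (simp add: dp_scale_def dp_monom_def)
      ultimately show "contract (monom U) f K = dp_scale (f U) (dp_monom 0) K"
        by (cases "K = 0") (simp_all only: add_0 simp_thms if_True if_False)
    qed
    define r where "r = gmap (\<lambda>i. - a i) (monom (case_option 0 U))"
    have "homogeneous (mdeg U) (monom (case_option 0 U))"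
      using homogeneous_monom[of "case_option 0 U"] by simp
    then have hom: "homogeneous (mdeg U) r" unfolding r_def by (rule homogeneous_gmap)
    have "dehomogenize (gmap a r) = monom U"
      by (simp only: r_def gmap_gmap_uminus monom_def dehomogenize_single case_option_comp_Some)
    then have "contract r (Homog1 f a (d + mdeg U)) = dp_scale (f U) (Lp_pow a d)"
      by (simp only: contract_Homog1[OF hom] top Homog1_hom.scale Homog1_one)
    moreover have "contract r (Homog1 f a (d + mdeg U)) \<in> L"
      by (rule contraction.subspace_scale[OF sub memL[OF f(1)]])
    ultimately have "dp_scale (f U) (Lp_pow a d) \<in> L" by simp
    from kspace.subspace_scale[OF kspace_subspace_contraction[OF sub] this, of "1 / f U"]
    show ?thesis using U(1) by (simp add: dp_scale_def)
  qed
  have IP: "?I \<subseteq> proj_point_ideal a"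
    using Lp by (auto simp: proj_point_ideal_iff_contract annihilator_def)
  have pt: "proj_point_ideal a \<in> Proj_points ?I"
    using IP prime_proj_point_ideal[of a] graded_proj_point_ideal[of a] z_notin_proj_point_ideal[of a]
      subsetD[OF _ Var_mem_irrelevant, of "proj_point_ideal a" None]
    by (auto simp: Proj_points_def)
  have "P = proj_point_ideal a" if P: "P \<in> Proj_points ?I" for P
  proof
    have P': "prime_ideal P" "graded_ideal P" "?I \<subseteq> P" "\<not> irrelevant_ideal \<subseteq> P"
      using P by (auto simp: Proj_points_def)
    note iP = graded_ideal_is_ideal[OF P'(2)]
    have lP: "Var (Some i) - Const (a i) * ?z \<in> P" for i
      using prime_ideal_power[OF P'(1)] lin P'(3) by blast
    show sup: "proj_point_ideal a \<subseteq> P"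
      unfolding proj_point_ideal_def by (rule ideal_gen_minimal[OF _ iP]) (use lP in blast)
    have zP: "?z \<notin> P"
    proof
      assume z: "?z \<in> P"
      have xP: "Var (Some i) \<in> P" for i
        using ideal_add[OF iP lP[of i] ideal_mult[OF iP z, of "Const (a i)"]] by simp
      have "Var v \<in> P" for v by (cases v) (simp_all only: z xP)
      then have "range Var \<subseteq> P" by blast
      then have "irrelevant_ideal \<subseteq> P"
        unfolding irrelevant_ideal_def by (rule ideal_gen_minimal[OF _ iP])
      with P'(4) show False by blast
    qed
    show "P \<subseteq> proj_point_ideal a"
    proof
      fix r assume r: "r \<in> P"
      have "poly_part d r \<in> proj_point_ideal a" for d
      proof (rule ccontr)
        let ?r = "poly_part d r"
        assume notin: "?r \<notin> proj_point_ideal a"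
        \<comment> \<open>Modulo the ideal of the point, a form of degree \<open>d\<close> is a multiple of \<open>z^d\<close>.\<close>
        define c where "c = contract ?r (Lp_pow a d) 0"
        have "contract ?r (Lp_pow a e) 0 = 0" if "e \<noteq> d" for e
          by (rule contract_at_zero_homogeneous[OF homogeneous_poly_part])
            (use that in \<open>simp add: Lp_pow_def\<close>)
        then have line: "restrict_line a ?r = Poly_Mapping.single d c"
          by (intro poly_mapping_eqI) (simp add: lookup_restrict_line lookup_single when_def c_def)
        then have c: "c \<noteq> 0" using notin by (auto simp: proj_point_ideal_iff)
        have "?r - Const c * ?z ^ d \<in> P"
          using diff_line_poly_mem[of ?r a] sup by (auto simp: line line_poly_single)
        from ideal_diff[OF iP graded_ideal_poly_part[OF P'(2) r, of d] this]
        have "Const c * ?z ^ d \<in> P" by simp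
        from ideal_mult[OF iP this, of "Const (1 / c)"]
        have "Const (1 / c) * Const c * ?z ^ d \<in> P" by (simp only: mult.assoc)
        moreover have "Const (1 / c) * Const c = (1 :: ('n option, 'k) mpoly)"
          using c by (simp add: Const_def mult_single)
        ultimately have "?z ^ d \<in> P" by simp
        then show False using prime_ideal_power[OF P'(1)] zP by blast
      qed
      then show "r \<in> proj_point_ideal a"
        by (rule ideal_if_poly_parts[OF graded_ideal_is_ideal[OF graded_proj_point_ideal]])
    qed
  qed
  with pt have "Proj_points ?I = {proj_point_ideal a}" by blast
  then show ?thesis
    using gI sat by (simp add: punctual_scheme_ideal_def zero_dimensional_def)
qed

lemma gmap_proj_point_ideal: "gmap a ` proj_point_ideal a = proj_point_ideal 0"
proof
  let ?l = "\<lambda>i. Var (Some i) - Const (a i) * Var None"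
  have l: "gmap a (?l i) = Var (Some i) - Const (0 i) * Var None" for i
    by (simp add: ring_map_simps[OF ring_map_gmap] Const_simps)
  have i0: "is_ideal (proj_point_ideal (0 :: 'a \<Rightarrow> 'b))"
    unfolding proj_point_ideal_def by (rule is_ideal_ideal_gen)
  have "is_ideal {r. gmap a r \<in> proj_point_ideal 0}"
    using i0 by (auto simp: is_ideal_iff ring_map_simps[OF ring_map_gmap])
  then have "proj_point_ideal a \<subseteq> {r. gmap a r \<in> proj_point_ideal 0}"
    unfolding proj_point_ideal_def[of a]
    by (rule ideal_gen_minimal[rotated]) (use l x_minus_az_mem[where a = 0] in auto)
  then show "gmap a ` proj_point_ideal a \<subseteq> proj_point_ideal 0" by blast
  have "Var (Some i) - Const (0 i) * Var None \<in> gmap a ` proj_point_ideal a" for i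
    unfolding l[symmetric] by (rule imageI[OF x_minus_az_mem])
  then have "range (\<lambda>i. Var (Some i) - Const (0 i) * Var None) \<subseteq> gmap a ` proj_point_ideal a"
    by blast
  then show "proj_point_ideal 0 \<subseteq> gmap a ` proj_point_ideal a"
    unfolding proj_point_ideal_def[of 0]
    by (rule ideal_gen_minimal)
      (rule graded_ideal_is_ideal[OF graded_ideal_gmap[OF graded_proj_point_ideal]])
qed

lemma module_hom_gstar: "module_hom (\<lambda>r. contract (gmap a r)) contract (gstar a)"
proof unfold_locales
  fix x y F
  show "contract (gmap a (x + y)) F = contract (gmap a x) F + contract (gmap a y) F"
    by (simp only: ring_map_add[OF ring_map_gmap] contract_add_left)
  show "contract (gmap a x) (contract (gmap a y) F) = contract (gmap a (x * y)) F"
    by (simp only: ring_map_mult[OF ring_map_gmap] contract_mult)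
  show "contract (gmap a 1) F = F"
    by (simp only: ring_map_1[OF ring_map_gmap] contraction.scale_one)
qed (simp_all only: contract_add_right gstar_add contract_gstar)

theorem theorem2p24:
  fixes a :: "'n::finite \<Rightarrow> 'k::field"
    and I :: "('n option, 'k) mpoly set" and L :: "('n option, 'k) dps set"
    and J' J :: "('n, 'k) mpoly set" and L' L'' V'' :: "('n, 'k) dps set"
    and \<alpha> :: nat and V :: "('n option, 'k) dps set"
    and I\<^sub>o :: "('n option, 'k) mpoly set" and L\<^sub>o :: "('n option, 'k) dps set"
  assumes Z: "punctual_scheme_ideal a I"
    and L: "L = global_inverse I"
    and J': "J' = dehomogenize ` I"
    and L': "L' = affine_inverse J'"
    and J: "J = translate a -` J'"
    and L'': "L'' = affine_inverse J"
    and \<alpha>: "\<alpha> = socle_degree a J'"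
    and V'': "V'' \<subseteq> dp_le \<alpha>" "L'' = contraction.span V''"
    and V: "V = Homog V'' a \<alpha>"
    and I\<^sub>o: "I\<^sub>o = saturation (gmap a ` I)"
    and L\<^sub>o: "L\<^sub>o = global_inverse I\<^sub>o"
  shows
    \<comment> \<open>(i)\<close>
    "(\<forall>i. L \<inter> dp_hom i = Homog (L'' \<inter> dp_le \<alpha>) a i \<and>
          Homog (L'' \<inter> dp_le \<alpha>) a i = forms_act \<alpha> (raised_power a \<alpha> V i)) \<and>
    \<comment> \<open>(ii): the maps \<open>g\<close> and \<open>g*\<close>, and \<open>L = g* L_o\<close>\<close>
     gmap a ` proj_point_ideal a = proj_point_ideal 0 \<and>
     (\<forall>i. gstar a (dp_monom (unit_exp (Some i))) = dp_monom (unit_exp (Some i))) \<and>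
     gstar a (dp_monom (unit_exp None)) = Lp_pow a 1 \<and>
     L = gstar a ` L\<^sub>o \<and>
    \<comment> \<open>\<open>g*\<close> is an isomorphism of \<open>L_o\<close> onto \<open>L\<close>, linear over the automorphism \<open>g\<close> of \<open>R\<close>\<close>
     bij (gmap a) \<and>
     module_hom (\<lambda>r. contract (gmap a r)) contract (gstar a) \<and>
     bij_betw (gstar a) L\<^sub>o L \<and>
    \<comment> \<open>every zero-dimensional scheme concentrated at \<open>p\<close> arises by homogenization\<close>
     (\<forall>I\<^sub>1. punctual_scheme_ideal a I\<^sub>1 \<longrightarrow>
        (\<exists>M. contraction.subspace M \<and> M \<subseteq> dp_le (socle_degree a (dehomogenize ` I\<^sub>1)) \<and>
             (\<forall>i. global_inverse I\<^sub>1 \<inter> dp_hom i =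
                  Homog (M \<inter> dp_le (socle_degree a (dehomogenize ` I\<^sub>1))) a i))) \<and>
    \<comment> \<open>conversely\<close>
     (\<forall>L\<^sub>1 M \<beta>. inverse_system L\<^sub>1 \<longrightarrow> L\<^sub>1 \<noteq> {0} \<longrightarrow> M \<subseteq> dp_ring \<longrightarrow>
        (\<forall>i. L\<^sub>1 \<inter> dp_hom i = Homog (M \<inter> dp_le \<beta>) a i) \<longrightarrow>
        (\<exists>I\<^sub>1. punctual_scheme_ideal a I\<^sub>1 \<and> L\<^sub>1 = global_inverse I\<^sub>1))"
proof -
  have L''_eq: "L'' = affine_inverse (translate a -` (dehomogenize ` I))" by (simp only: L'' J J')
  have "L'' \<subseteq> dp_le \<alpha>"
    using punctual_affine_inverse_dp_le[OF Z] by (simp only: L''_eq \<alpha> J')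
  then have L''_le: "L'' \<inter> dp_le \<alpha> = L''" by blast
  have sub: "contraction.subspace (affine_inverse K)" for K :: "('n, 'k) mpoly set"
    by (rule subspace_affine_inverse)
  have Homog_sub: "Homog S a i = (\<lambda>f. Homog1 f a i) ` S" if "contraction.subspace S" for S i
    using kspace.span_eq_iff[THEN iffD2, OF kspace_subspace_contraction[OF that]]
    by (simp only: Homog_conv_image)
  have Homog_L'': "Homog (L'' \<inter> dp_le \<alpha>) a i = (\<lambda>f. Homog1 f a i) ` L''" for i
    unfolding L''_le by (rule Homog_sub) (simp only: L'' sub)
  have part_i: "L \<inter> dp_hom i = Homog (L'' \<inter> dp_le \<alpha>) a i \<and>
      Homog (L'' \<inter> dp_le \<alpha>) a i = forms_act \<alpha> (raised_power a \<alpha> V i)" for i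
    using punctual_global_inverse[OF Z, of i] forms_act_raised_power[OF V''(1), of a i]
    by (simp only: Homog_L'' L L''_eq[symmetric] V V''(2)[symmetric] conj_absorb)
  have Io: "I\<^sub>o = gmap a ` I"
    unfolding I\<^sub>o by (rule saturation_gmap[OF punctual_graded[OF Z] punctual_saturation[OF Z]])
  have L_gstar: "L = gstar a ` L\<^sub>o"
    unfolding L L\<^sub>o Io by (rule global_inverse_gstar)
  have bij: "bij_betw (gstar a) L\<^sub>o L"
    unfolding L_gstar by (rule bij_betw_imageI) (auto simp: inj_on_def gstar_eq_iff)
  have "\<exists>M. contraction.subspace M \<and> M \<subseteq> dp_le (socle_degree a (dehomogenize ` I\<^sub>1)) \<and>
      (\<forall>i. global_inverse I\<^sub>1 \<inter> dp_hom i =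
        Homog (M \<inter> dp_le (socle_degree a (dehomogenize ` I\<^sub>1))) a i)"
    if I1: "punctual_scheme_ideal a I\<^sub>1" for I\<^sub>1
  proof -
    let ?M = "affine_inverse (translate a -` (dehomogenize ` I\<^sub>1))"
    have le: "?M \<subseteq> dp_le (socle_degree a (dehomogenize ` I\<^sub>1))"
      by (rule punctual_affine_inverse_dp_le[OF I1])
    then have "?M \<inter> dp_le (socle_degree a (dehomogenize ` I\<^sub>1)) = ?M" by blast
    then show ?thesis
      using le by (intro exI[of _ ?M]) (simp add: sub Homog_sub punctual_global_inverse[OF I1])
  qed
  then have all: "\<forall>I\<^sub>1. punctual_scheme_ideal a I\<^sub>1 \<longrightarrow>
      (\<exists>M. contraction.subspace M \<and> M \<subseteq> dp_le (socle_degree a (dehomogenize ` I\<^sub>1)) \<and>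
        (\<forall>i. global_inverse I\<^sub>1 \<inter> dp_hom i =
          Homog (M \<inter> dp_le (socle_degree a (dehomogenize ` I\<^sub>1))) a i))"
    by (intro allI impI)
  have "\<exists>I\<^sub>1. punctual_scheme_ideal a I\<^sub>1 \<and> L\<^sub>1 = global_inverse I\<^sub>1"
    if L1: "inverse_system L\<^sub>1" "L\<^sub>1 \<noteq> {0}" and LM: "\<forall>i. L\<^sub>1 \<inter> dp_hom i = Homog (M \<inter> dp_le \<beta>) a i"
    for L\<^sub>1 M \<beta>
  proof (intro exI conjI)
    have "kspace.span (M \<inter> dp_le \<beta>) \<subseteq> dp_le \<beta>"
      by (rule kspace.span_minimal[OF _ subspace_dp_le]) blast
    then show "punctual_scheme_ideal a (annihilator L\<^sub>1)"
      using LM by (intro punctual_annihilator[OF L1]) (simp_all add: Homog_conv_image)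
    show "L\<^sub>1 = global_inverse (annihilator L\<^sub>1)"
      by (rule global_inverse_annihilator[OF L1(1), symmetric])
  qed
  then have conv: "\<forall>L\<^sub>1 M \<beta>. inverse_system L\<^sub>1 \<longrightarrow> L\<^sub>1 \<noteq> {0} \<longrightarrow> M \<subseteq> dp_ring \<longrightarrow>
      (\<forall>i. L\<^sub>1 \<inter> dp_hom i = Homog (M \<inter> dp_le \<beta>) a i) \<longrightarrow>
      (\<exists>I\<^sub>1. punctual_scheme_ideal a I\<^sub>1 \<and> L\<^sub>1 = global_inverse I\<^sub>1)"
    by (intro allI impI)
  show ?thesis
    by (intro conjI)
      (rule allI[OF part_i] gmap_proj_point_ideal allI[OF gstar_X] gstar_Z L_gstar bij_gmap
        module_hom_gstar bij all conv)+
qed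

end
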